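(* Let $k\in\mathbb{N}_0^d$ be a multi-index and let $\psi:\mathbb{C}^d\times\mathbb{C}^d\to\mathbb{C}$ be a Borel function such that $$SF(z)=\int_{\mathbb{C}^d}F(w)\,e^{\pi z\overline{w}}\,\psi(z-w,z-\overline{w})\,e^{-\pi|w|^2}\,dw$$ defines an operator $S:\mathcal{F}^1_k(\mathbb{C}^d)\to\mathcal{F}^\infty_k(\mathbb{C}^d)$. If there exists $H\in L^1(\mathbb{C}^d)$ such that $$\big|\psi(w-z,w-\overline{z})\big|\le\big|e^{\pi(|z|^2+|w|^2)/2-\pi w\overline{z}}\big|\cdot H(z-w)\qquad\text{for all }z,w\in\mathbb{C}^d,$$ then $S$ is bounded on $\mathcal{F}^p_k(\mathbb{C}^d)$ for all $1\le p\le\infty$.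
   Context: For $x,y\in\mathbb{C}^d$ write $xy=\sum_jx_jy_j$, $x^2=xx$, $|w|^2=w\overline{w}$; for a multi-index $k$, $|k|=\sum_jk_j$, $k!=\prod_jk_j!$, $\frac{d^k}{dz^k}=\prod_j\partial_{z_j}^{k_j}$. $dw$ is Lebesgue measure on $\mathbb{C}^d\cong\mathbb{R}^{2d}$. Modulation spaces: let $\varphi_0(t)=2^{d/4}e^{-\pi t^2}$ on $\mathbb{R}^d$, $\pi(x,\omega)f(t)=e^{2\pi i\omega t}f(t-x)$, $V_{\varphi_0}f(x,\omega)=\langle f,\pi(x,\omega)\varphi_0\rangle$ for $f\in\mathscr{S}'(\mathbb{R}^d)$ (antilinear in the second slot); $M^p(\mathbb{R}^d)=\{f\in\mathscr{S}'(\mathbb{R}^d):V_{\varphi_0}f\in L^p(\mathbb{R}^{2d})\}$, $1\le p\le\infty$. For $f\in M^p(\mathbb{R}^d)$, $Bf(z)=2^{d/4}\int_{\mathbb{R}^d}f(x)e^{2\pi xz-\pi x^2-\pi z^2/2}\,dx$ (as a distributional pairing) and $B^kf(z)=c_k\,e^{\pi|z|^2}\frac{d^k}{dz^k}\big(e^{-\pi|z|^2}Bf(z)\big)$ with $c_k=1/\sqrt{k!\,\pi^{|k|}}$. The polyanalytic Sobolev-Fock space is $\mathcal{F}^p_k(\mathbb{C}^d)=B^k(M^p(\mathbb{R}^d))$, normed by $\|F\|=\|F(z)e^{-\pi|z|^2/2}\|_{L^p(\mathbb{C}^d)}$. "Bounded on $\mathcal{F}^p_k$" means that the integral formula defines (or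 extends from $\mathcal{F}^1_k$ to) a bounded operator $\mathcal{F}^p_k\to\mathcal{F}^p_k$. *)

theory Defs
  imports "HOL-Analysis.Analysis" "HOL-Probability.Essential_Supremum"
begin

section \<open>Vectors\<close>

text \<open>The bilinear product, without conjugation.\<close>

definition bprod :: "complex ^ 'n \<Rightarrow> complex ^ 'n \<Rightarrow> complex"  (infixl "\<odot>" 70)
  where "x \<odot> y = (\<Sum>j\<in>UNIV. x $ j * y $ j)"

definition vcnj :: "complex ^ 'n \<Rightarrow> complex ^ 'n"
  where "vcnj z = (\<chi> j. cnj (z $ j))"

definition vcomplex :: "real ^ 'n \<Rightarrow> complex ^ 'n"
  where "vcomplex x = (\<chi> j. complex_of_real (x $ j))"


section \<open>Lebesgue norms\<close>

definition Lp_norm :: "ennreal \<Rightarrow> 'a measure \<Rightarrow> ('a \<Rightarrow> complex) \<Rightarrow> ennreal"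
  where "Lp_norm p M f =
    (if p = \<infinity> then esssup M (\<lambda>x. ennreal (norm (f x)))
     else let I = (\<integral>\<^sup>+ x. ennreal (norm (f x) powr enn2real p) \<partial>M)
          in if I = \<infinity> then \<infinity> else ennreal (enn2real I powr (1 / enn2real p)))"

definition Lp :: "ennreal \<Rightarrow> 'a measure \<Rightarrow> ('a \<Rightarrow> complex) set"
  where "Lp p M = {f \<in> borel_measurable M. Lp_norm p M f < \<infinity>}"


section \<open>Tempered distributions\<close>

definition partial :: "'n \<Rightarrow> (real ^ 'n::finite \<Rightarrow> complex) \<Rightarrow> real ^ 'n \<Rightarrow> complex"
  where "partial j \<phi> x = frechet_derivative \<phi> (at x) (axis j 1)"

text \<open>Iterated partial derivatives are indexed by words in the coordinates instead of
  multi-indices; for smooth functions only the number of occurrences of each coordinate matters.\<close>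

definition partials :: "'n list \<Rightarrow> (real ^ 'n::finite \<Rightarrow> complex) \<Rightarrow> real ^ 'n \<Rightarrow> complex"
  where "partials js \<phi> = foldr partial js \<phi>"

definition schwartz :: "(real ^ 'n::finite \<Rightarrow> complex) set"
  where "schwartz = {\<phi>. (\<forall>js x. partials js \<phi> differentiable (at x)) \<and>
    (\<forall>N js. bounded (range (\<lambda>x. (1 + norm x) ^ N * norm (partials js \<phi> x))))}"

definition schwartz_seminorm :: "nat \<Rightarrow> (real ^ 'n::finite \<Rightarrow> complex) \<Rightarrow> real"
  where "schwartz_seminorm N \<phi> =
    (\<Sum>js | length js \<le> N. SUP x. (1 + norm x) ^ N * norm (partials js \<phi> x))"

text \<open>Complex-linear functionals on the Schwartz space that are continuous for the topology of
  the above increasing family of seminorms.  Extensionality makes equality of distributions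
  coincide with equality in HOL.\<close>

definition tempered :: "((real ^ 'n::finite \<Rightarrow> complex) \<Rightarrow> complex) set"
  where "tempered = {f \<in> extensional schwartz.
    (\<forall>\<phi>\<in>schwartz. \<forall>\<psi>\<in>schwartz. f (\<lambda>t. \<phi> t + \<psi> t) = f \<phi> + f \<psi>) \<and>
    (\<forall>c. \<forall>\<phi>\<in>schwartz. f (\<lambda>t. c * \<phi> t) = c * f \<phi>) \<and>
    (\<exists>C N. \<forall>\<phi>\<in>schwartz. norm (f \<phi>) \<le> C * schwartz_seminorm N \<phi>)}"


section \<open>Modulation spaces\<close>

definition gauss0 :: "real ^ 'n::finite \<Rightarrow> complex"
  where "gauss0 t = complex_of_real (2 powr (real CARD('n) / 4) * exp (- pi * (t \<bullet> t)))"

definition tf_shift :: "real ^ 'n::finite \<Rightarrow> real ^ 'n \<Rightarrow> (real ^ 'n \<Rightarrow> complex) \<Rightarrow> real ^ 'n \<Rightarrow> complex"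
  where "tf_shift x \<omega> \<phi> t = exp (2 * of_real pi * \<i> * of_real (\<omega> \<bullet> t)) * \<phi> (t - x)"

text \<open>A distribution acts linearly on test functions, so the pairing that is antilinear in its
  second argument evaluates it at the complex conjugate.\<close>

definition stft :: "((real ^ 'n::finite \<Rightarrow> complex) \<Rightarrow> complex) \<Rightarrow> (real ^ 'n) \<times> (real ^ 'n) \<Rightarrow> complex"
  where "stft f = (\<lambda>(x, \<omega>). f (\<lambda>t. cnj (tf_shift x \<omega> gauss0 t)))"

definition modulation :: "ennreal \<Rightarrow> ((real ^ 'n::finite \<Rightarrow> complex) \<Rightarrow> complex) set"
  where "modulation p = {f \<in> tempered. stft f \<in> Lp p lborel}"


section \<open>Polyanalytic Sobolev-Fock spaces\<close>

definition bargmann :: "((real ^ 'n::finite \<Rightarrow> complex) \<Rightarrow> complex) \<Rightarrow> complex ^ 'n \<Rightarrow> complex"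
  where "bargmann f z = of_real (2 powr (real CARD('n) / 4)) *
    f (\<lambda>x. exp (2 * of_real pi * (vcomplex x \<odot> z) - of_real (pi * (x \<bullet> x))
                - of_real pi * (z \<odot> z) / 2))"

text \<open>The Wirtinger derivative, also for functions that are only real-differentiable.\<close>

definition wirtinger :: "'n \<Rightarrow> (complex ^ 'n::finite \<Rightarrow> complex) \<Rightarrow> complex ^ 'n \<Rightarrow> complex"
  where "wirtinger j F z =
    (frechet_derivative F (at z) (axis j 1) - \<i> * frechet_derivative F (at z) (axis j \<i>)) / 2"

text \<open>The operators \<open>wirtinger j\<close> commute on smooth functions, so the choice of the enumeration
  of the coordinates is immaterial.\<close>

definition coords :: "'n::finite list"
  where "coords = (SOME js. distinct js \<and> set js = UNIV)"

definition wirtinger_multi :: "nat ^ 'n \<Rightarrow> (complex ^ 'n::finite \<Rightarrow> complex) \<Rightarrow> complex ^ 'n \<Rightarrow> complex"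
  where "wirtinger_multi k F = foldr (\<lambda>j. wirtinger j ^^ (k $ j)) coords F"

definition poly_bargmann ::
    "nat ^ 'n \<Rightarrow> ((real ^ 'n::finite \<Rightarrow> complex) \<Rightarrow> complex) \<Rightarrow> complex ^ 'n \<Rightarrow> complex"
  where "poly_bargmann k f z =
    of_real (1 / sqrt ((\<Prod>j\<in>UNIV. fact (k $ j)) * pi ^ (\<Sum>j\<in>UNIV. k $ j))) *
    of_real (exp (pi * (norm z)\<^sup>2)) *
    wirtinger_multi k (\<lambda>u. of_real (exp (- pi * (norm u)\<^sup>2)) * bargmann f u) z"

definition fock :: "ennreal \<Rightarrow> nat ^ 'n \<Rightarrow> (complex ^ 'n::finite \<Rightarrow> complex) set"
  where "fock p k = poly_bargmann k ` modulation p"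

definition fock_norm :: "ennreal \<Rightarrow> (complex ^ 'n::finite \<Rightarrow> complex) \<Rightarrow> ennreal"
  where "fock_norm p F = Lp_norm p lborel (\<lambda>z. F z * of_real (exp (- pi * (norm z)\<^sup>2 / 2)))"


section \<open>The integral operator\<close>

definition S_integrand ::
    "((complex ^ 'n::finite) \<times> (complex ^ 'n) \<Rightarrow> complex) \<Rightarrow> (complex ^ 'n \<Rightarrow> complex) \<Rightarrow>
     complex ^ 'n \<Rightarrow> complex ^ 'n \<Rightarrow> complex"
  where "S_integrand \<psi> F z w =
    F w * exp (of_real pi * (z \<odot> vcnj w)) * \<psi> (z - w, z - vcnj w) * of_real (exp (- pi * (norm w)\<^sup>2))"

definition S_op ::
    "((complex ^ 'n::finite) \<times> (complex ^ 'n) \<Rightarrow> complex) \<Rightarrow> (complex ^ 'n \<Rightarrow> complex) \<Rightarrow>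
     complex ^ 'n \<Rightarrow> complex"
  where "S_op \<psi> F z = (LINT w|lborel. S_integrand \<psi> F z w)"

text \<open>The integrability clause is needed because the Bochner integral of a non-integrable
  function is 0 by convention.\<close>

definition S_maps ::
    "((complex ^ 'n::finite) \<times> (complex ^ 'n) \<Rightarrow> complex) \<Rightarrow> (complex ^ 'n \<Rightarrow> complex) set \<Rightarrow>
     (complex ^ 'n \<Rightarrow> complex) set \<Rightarrow> bool"
  where "S_maps \<psi> A B \<longleftrightarrow>
    (\<forall>F\<in>A. (\<forall>z. integrable lborel (S_integrand \<psi> F z)) \<and> S_op \<psi> F \<in> B)"

text \<open>Linearity is not listed: it follows from integrability.\<close>

definition S_bounded ::
    "((complex ^ 'n::finite) \<times> (complex ^ 'n) \<Rightarrow> complex) \<Rightarrow> ennreal \<Rightarrow> nat ^ 'n \<Rightarrow> bool"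
  where "S_bounded \<psi> p k \<longleftrightarrow> S_maps \<psi> (fock p k) (fock p k) \<and>
    (\<exists>C::real. \<forall>F\<in>fock p k. fock_norm p (S_op \<psi> F) \<le> ennreal C * fock_norm p F)"

end

theory Submission
  imports Defs "HOL-Complex_Analysis.Cauchy_Integral_Formula"
begin

text \<open>
  On functions weighted by the Gaussian \<open>exp (- pi * norm z ^ 2 / 2)\<close> the hypothesis on \<open>\<psi>\<close> says
  that the kernel of \<open>S\<close> is dominated by \<open>H (w - z)\<close>. Young's inequality for convolutions
  (\<open>young_convolution\<close>) then bounds \<open>S F\<close> in the norm of every \<open>L\<^sup>p\<close>. The point of the theorem is
  that \<open>S\<close> maps \<open>fock p k\<close> into itself for every \<open>p\<close>, that is, that \<open>S F\<close> is again the polyanalytic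
  Bargmann transform of a distribution in the modulation space.

  The Bargmann transform identifies the modulation space with the space of entire functions \<open>F\<close>
  whose weighted version lies in \<open>L\<^sup>p\<close>. It produces entire functions because the Bargmann kernel
  depends holomorphically on its parameter in every Schwartz seminorm (\<open>slice_entire_bargmann\<close>).
  It is onto (\<open>bargmann_surj\<close>) because such an \<open>F\<close> can be paired, with respect to the Gaussian
  measure, with the Bargmann transforms of Schwartz functions, which decay rapidly after weighting.
  The mean value property, averaged over rotations \<open>w \<mapsto> e *s w\<close> and transported to an arbitrary
  centre by a twisted translation, gives two tools: weighted \<open>L\<^sup>p\<close> functions that are entire are
  weighted bounded (\<open>slice_entire_Lp_imp_gauss_bounded\<close>), and they satisfy the reproducing formula
  \<open>F z = \<integral> F w * exp (pi * (z \<odot> vcnj w) - pi * norm w ^ 2)\<close> up to a constant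
  (\<open>reproducing_formula\<close>).

  Differentiating the reproducing formula turns the polyanalytic transform of order \<open>k\<close> into an
  integral operator \<open>kconv P\<close> whose kernel has the additional factor \<open>cnj (w - z) ^ k\<close>. Integration
  by parts shows that the operator with the factor \<open>(w - z) ^ k\<close> inverts it (\<open>kconv_mon_cmon\<close>). Hence
  \<open>fock p k\<close> is the image under \<open>kconv P\<close> of the weighted \<open>L\<^sup>p\<close> entire functions, and there is an
  operator \<open>kconv Q\<close> with \<open>kconv Q (kconv P F) = F\<close> (\<open>fock_characterization\<close>). Both operators have
  kernels dominated by convolutions, just as \<open>S\<close> does; such operators preserve weighted \<open>L\<^sup>p\<close> and
  are continuous for pointwise convergence with a uniform weighted bound.

  For \<open>E = kconv P F\<close> in \<open>fock p k\<close> the dilations \<open>F (r *s z)\<close> with \<open>r\<close> increasing to \<open>1\<close> are weighted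
  integrable and converge to \<open>F\<close> with a uniform weighted bound. Their images \<open>E' n\<close> lie in
  \<open>fock 1 k\<close>, so by assumption \<open>S (E' n) = kconv P (G' n)\<close> with \<open>G' n\<close> entire and, by inversion,
  \<open>G' n = kconv Q (S (E' n))\<close>. Passing to the limit, \<open>G' n\<close> tends to \<open>G = kconv Q (S E)\<close>, the function
  \<open>G\<close> inherits the reproducing formula and is therefore entire, and \<open>S E = kconv P G\<close>. Finally \<open>G\<close>
  is weighted \<open>L\<^sup>p\<close> since \<open>S E\<close> is, so \<open>S E\<close> belongs to \<open>fock p k\<close>.
\<close>


section \<open>Integration on Euclidean spaces\<close>

lemma distr_lborel_translate: "distr lborel borel (\<lambda>x. x + c) = (lborel :: 'a::euclidean_space measure)"
proof -
  have "(\<lambda>x. x + c) = (+) c" by (simp add: fun_eq_iff add.commute)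
  then show ?thesis using lborel_distr_plus[of c] by simp
qed

lemma distr_lborel_reflect: "distr lborel borel (\<lambda>x. c - x) = (lborel :: 'a::euclidean_space measure)"
  using lborel_affine[of "-1" c] by (simp add: density_1)

lemma nn_integral_translate:
  fixes f :: "'a::euclidean_space \<Rightarrow> ennreal"
  assumes "f \<in> borel_measurable borel"
  shows "(\<integral>\<^sup>+x. f (x + c) \<partial>lborel) = (\<integral>\<^sup>+x. f x \<partial>lborel)"
proof -
  have "(\<integral>\<^sup>+x. f x \<partial>distr lborel borel (\<lambda>x. x + c)) = (\<integral>\<^sup>+x. f (x + c) \<partial>lborel)"
    using assms by (intro nn_integral_distr) auto
  then show ?thesis by (simp add: distr_lborel_translate)
qed

lemma nn_integral_reflect:
  fixes f :: "'a::euclidean_space \<Rightarrow> ennreal"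
  assumes "f \<in> borel_measurable borel"
  shows "(\<integral>\<^sup>+x. f (c - x) \<partial>lborel) = (\<integral>\<^sup>+x. f x \<partial>lborel)"
proof -
  have "(\<integral>\<^sup>+x. f x \<partial>distr lborel borel (\<lambda>x. c - x)) = (\<integral>\<^sup>+x. f (c - x) \<partial>lborel)"
    using assms by (intro nn_integral_distr) auto
  then show ?thesis by (simp add: distr_lborel_reflect)
qed

lemma
  fixes f :: "'a::euclidean_space \<Rightarrow> 'b::{banach, second_countable_topology}"
  assumes [measurable]: "f \<in> borel_measurable borel"
  shows integral_translate: "(LINT x|lborel. f (x + c)) = (LINT x|lborel. f x)"
    and integrable_translate_iff: "integrable lborel (\<lambda>x. f (x + c)) \<longleftrightarrow> integrable lborel f"
proof -
  have "(LINT x|distr lborel borel (\<lambda>x. x + c). f x) = (LINT x|lborel. f (x + c))"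
    by (intro integral_distr) auto
  then show "(LINT x|lborel. f (x + c)) = (LINT x|lborel. f x)"
    by (simp add: distr_lborel_translate)
  have "integrable (distr lborel borel (\<lambda>x. x + c)) f \<longleftrightarrow> integrable lborel (\<lambda>x. f (x + c))"
    by (intro integrable_distr_eq) auto
  then show "integrable lborel (\<lambda>x. f (x + c)) \<longleftrightarrow> integrable lborel f"
    by (simp add: distr_lborel_translate)
qed

text \<open>Uniqueness of translation-invariant measures: let \<open>\<mu>\<close> be the image measure. Integrating
  \<open>indicator A x * indicator B (x + y)\<close> in both orders, and translating by \<open>y\<close> in between, gives
  \<open>\<mu> A * lborel B = lborel A * \<mu> B\<close>. For the unit ball \<open>B\<close> the two measures agree because \<open>T\<close> is
  an isometry.\<close>

lemma distr_lborel_isometry: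
  fixes T :: "'a::euclidean_space \<Rightarrow> 'b::euclidean_space"
  assumes lin: "linear T" and iso: "\<And>x. norm (T x) = norm x" and surj: "surj T"
  shows "distr lborel borel T = lborel"
proof (rule measure_eqI)
  have inj: "inj T"
    using iso lin by (metis linear_injective_0 norm_eq_zero)
  have dim: "DIM('a) = DIM('b)"
    using dim_image_eq[OF lin, of UNIV] inj surj by (simp add: dim_UNIV)
  have contT: "continuous_on UNIV T"
    using lin linear_continuous_on linear_conv_bounded_linear by blast
  have T[measurable]: "T \<in> borel \<rightarrow>\<^sub>M borel"
    by (rule borel_measurable_continuous_onI[OF contT])
  fix A :: "'b set" assume "A \<in> sets (distr lborel borel T)"
  then have A[measurable]: "A \<in> sets borel" by simp
  define B where "B = (ball 0 1 :: 'b set)"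
  have B[measurable]: "B \<in> sets borel" by (simp add: B_def)
  have mu: "(\<integral>\<^sup>+x. indicator S (T x) \<partial>lborel) = emeasure (distr lborel borel T) S"
    if "S \<in> sets borel" for S :: "'b set"
  proof -
    have "(\<integral>\<^sup>+x. indicator S (T x) \<partial>lborel) = (\<integral>\<^sup>+x. indicator S x \<partial>distr lborel borel T)"
      by (rule nn_integral_distr[symmetric]) (use that T in auto)
    then show ?thesis using that by simp
  qed
  have inv: "(\<integral>\<^sup>+x. f (T x + y) \<partial>lborel) = (\<integral>\<^sup>+x. f (T x) \<partial>lborel)"
    if [measurable]: "f \<in> borel_measurable borel" for f :: "'b \<Rightarrow> ennreal" and y
  proof -
    obtain c where "T c = y" using surj by (metis surjD)
    then have "T x + y = T (x + c)" for x using lin by (simp add: linear_add)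
    then show ?thesis
      using nn_integral_translate[of "\<lambda>x. f (T x)" c] by simp
  qed
  have "(\<integral>\<^sup>+y. (\<integral>\<^sup>+x. indicator A (T x) * indicator B (T x + y) \<partial>lborel) \<partial>lborel)
      = (\<integral>\<^sup>+x. (\<integral>\<^sup>+y. indicator A (T x) * indicator B (T x + y) \<partial>lborel) \<partial>lborel)"
    by (rule lborel_pair.Fubini'[symmetric]) measurable
  also have "\<dots> = (\<integral>\<^sup>+x. indicator A (T x) * emeasure lborel B \<partial>lborel)"
  proof (rule nn_integral_cong)
    fix x
    have "(\<integral>\<^sup>+y. indicator B (T x + y) \<partial>lborel) = (\<integral>\<^sup>+y. indicator B y \<partial>(lborel :: 'b measure))"
      using nn_integral_translate[of "indicator B" "T x"] by (simp add: add.commute)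
    then show "(\<integral>\<^sup>+y. indicator A (T x) * indicator B (T x + y) \<partial>lborel)
        = indicator A (T x) * emeasure lborel B"
      by (subst nn_integral_cmult) auto
  qed
  also have "\<dots> = emeasure (distr lborel borel T) A * emeasure lborel B"
    by (subst nn_integral_multc) (auto simp: mu)
  finally have 1: "(\<integral>\<^sup>+y. (\<integral>\<^sup>+x. indicator A (T x) * indicator B (T x + y) \<partial>lborel) \<partial>lborel)
      = emeasure (distr lborel borel T) A * emeasure lborel B" .
  have "(\<integral>\<^sup>+x. indicator A (T x) * indicator B (T x + y) \<partial>lborel)
      = (\<integral>\<^sup>+x. indicator A (T x - y) * indicator B (T x) \<partial>lborel)" for y
    using inv[of "\<lambda>v. indicator A (v - y) * indicator B v" y] by simp
  then have "(\<integral>\<^sup>+y. (\<integral>\<^sup>+x. indicator A (T x) * indicator B (T x + y) \<partial>lborel) \<partial>lborel)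
      = (\<integral>\<^sup>+y. (\<integral>\<^sup>+x. indicator A (T x - y) * indicator B (T x) \<partial>lborel) \<partial>lborel)"
    by simp
  also have "\<dots> = (\<integral>\<^sup>+x. (\<integral>\<^sup>+y. indicator A (T x - y) * indicator B (T x) \<partial>lborel) \<partial>lborel)"
    by (rule lborel_pair.Fubini'[symmetric]) measurable
  also have "\<dots> = (\<integral>\<^sup>+x. emeasure lborel A * indicator B (T x) \<partial>lborel)"
  proof (rule nn_integral_cong)
    fix x
    have "(\<integral>\<^sup>+y. indicator A (T x - y) \<partial>lborel) = emeasure lborel A"
      using nn_integral_reflect[of "indicator A" "T x"] by simp
    then show "(\<integral>\<^sup>+y. indicator A (T x - y) * indicator B (T x) \<partial>lborel)
        = emeasure lborel A * indicator B (T x)"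
      by (subst nn_integral_multc) auto
  qed
  also have "\<dots> = emeasure lborel A * emeasure (distr lborel borel T) B"
    by (subst nn_integral_cmult) (auto simp: mu)
  finally have 2: "emeasure (distr lborel borel T) A * emeasure lborel B
      = emeasure lborel A * emeasure (distr lborel borel T) B"
    using 1 by simp
  have "emeasure (distr lborel borel T) B = emeasure lborel (ball (0::'a) 1)"
    by (subst emeasure_distr) (auto simp: B_def iso vimage_def ball_def intro!: arg_cong[where f="emeasure lborel"])
  also have "\<dots> = emeasure lborel B"
    unfolding B_def by (simp add: emeasure_ball dim)
  finally have "emeasure (distr lborel borel T) A * emeasure lborel B
      = emeasure lborel A * emeasure lborel B"
    using 2 by simp
  moreover have "emeasure lborel B \<noteq> 0" "emeasure lborel B \<noteq> \<infinity>"
    unfolding B_def by (auto simp: emeasure_ball unit_ball_vol_pos less_imp_neq[symmetric])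
  ultimately show "emeasure (distr lborel borel T) A = emeasure lborel A"
    by (metis ennreal_mult_divide_eq infinity_ennreal_def)
qed simp

text \<open>Between the spheres of radius \<open>m\<close> and \<open>m + 1\<close> the integrand is at most
  \<open>1 / (m + 1) ^ (DIM('a) + 2)\<close>, and the ball of radius \<open>m + 1\<close> has volume proportional to
  \<open>(m + 1) ^ DIM('a)\<close>, so the series of inverse squares is a majorant.\<close>

lemma integrable_inverse_power:
  "integrable lborel (\<lambda>x::'a::euclidean_space. 1 / (1 + norm x) ^ (DIM('a) + 2))"
proof (rule integrableI_bounded)
  let ?n = "DIM('a) + 2"
  define g :: "nat \<Rightarrow> 'a \<Rightarrow> ennreal"
    where "g m x = ennreal (1 / real (Suc m) ^ ?n) * indicator (cball 0 (real (Suc m))) x" for m x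
  have meas: "g m \<in> borel_measurable lborel" for m
    unfolding g_def[abs_def]
    by (intro borel_measurable_times_ennreal borel_measurable_const borel_measurable_indicator) simp
  have pt: "ennreal (norm (1 / (1 + norm x) ^ ?n)) \<le> (\<Sum>m. g m x)" for x :: 'a
  proof -
    define m where "m = nat \<lfloor>norm x\<rfloor>"
    have m: "real m \<le> norm x" "norm x \<le> real (Suc m)"
      using norm_ge_zero[of x] unfolding m_def by linarith+
    have "1 / (1 + norm x) ^ ?n \<le> 1 / real (Suc m) ^ ?n"
      using m by (intro divide_left_mono power_mono) (auto intro!: mult_pos_pos zero_less_power)
    then have "ennreal (norm (1 / (1 + norm x) ^ ?n)) \<le> ennreal (1 / real (Suc m) ^ ?n)"
      by (intro ennreal_leI) auto
    also have "\<dots> = (\<Sum>m\<in>{m}. g m x)"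
      using m by (simp add: g_def)
    also have "\<dots> \<le> (\<Sum>m. g m x)"
      by (rule sum_le_suminf) auto
    finally show ?thesis .
  qed
  have g: "(\<integral>\<^sup>+x. g m x \<partial>lborel) = ennreal (unit_ball_vol (real DIM('a)) * (1 / real (Suc m) ^ 2))" for m
  proof -
    have e: "emeasure lborel (cball (0::'a) (real (Suc m))) = ennreal (unit_ball_vol (real DIM('a)) * real (Suc m) ^ DIM('a))"
      by (rule emeasure_cball) simp
    have a: "1 / real (Suc m) ^ ?n * (unit_ball_vol (real DIM('a)) * (real (Suc m)) ^ DIM('a))
        = unit_ball_vol (real DIM('a)) * (1 / real (Suc m) ^ 2)"
      unfolding power_add by (simp del: of_nat_Suc)
    have "(\<integral>\<^sup>+x. g m x \<partial>lborel) = ennreal (1 / real (Suc m) ^ ?n) * emeasure lborel (cball (0::'a) (real (Suc m)))"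
      unfolding g_def by (rule nn_integral_cmult_indicator) simp
    then show ?thesis
      unfolding e a[symmetric] by (subst ennreal_mult') simp_all
  qed
  have s: "summable (\<lambda>m. unit_ball_vol (real DIM('a)) * (1 / real (Suc m) ^ 2))"
    using inverse_squares_sums[THEN sums_summable] by (intro summable_mult) (simp add: add.commute)
  have "(\<integral>\<^sup>+x. ennreal (norm (1 / (1 + norm x) ^ ?n)) \<partial>(lborel::'a measure)) \<le> (\<integral>\<^sup>+x. (\<Sum>m. g m x) \<partial>lborel)"
    by (rule nn_integral_mono) (rule pt)
  also have "\<dots> = (\<Sum>m. \<integral>\<^sup>+x. g m x \<partial>lborel)"
    by (rule nn_integral_suminf) (rule meas)
  also have "\<dots> = ennreal (\<Sum>m. unit_ball_vol (real DIM('a)) * (1 / real (Suc m) ^ 2))"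
    unfolding g by (rule suminf_ennreal2[OF _ s]) simp
  also have "\<dots> < \<infinity>"
    by (simp only: ennreal_less_top infinity_ennreal_def)
  finally show "(\<integral>\<^sup>+x. ennreal (norm (1 / (1 + norm x) ^ ?n)) \<partial>(lborel::'a measure)) < \<infinity>" .
qed measurable

lemma integrable_of_decay:
  fixes f :: "'a::euclidean_space \<Rightarrow> 'b::{banach, second_countable_topology}"
  assumes [measurable]: "f \<in> borel_measurable borel"
    and "\<And>x. norm (f x) \<le> C / (1 + norm x) ^ (DIM('a) + 2)"
  shows "integrable lborel f"
proof (rule Bochner_Integration.integrable_bound)
  show "integrable lborel (\<lambda>x::'a. C * (1 / (1 + norm x) ^ (DIM('a) + 2)))"
    by (intro integrable_mult_right integrable_inverse_power)
  show "AE x in lborel. norm (f x) \<le> norm (C * (1 / (1 + norm x) ^ (DIM('a) + 2)))"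
  proof (rule AE_I2)
    fix x
    show "norm (f x) \<le> norm (C * (1 / (1 + norm x) ^ (DIM('a) + 2)))"
      using order.trans[OF assms(2)[of x] abs_ge_self] by (simp only: real_norm_def mult_1_right times_divide_eq_right)
  qed
qed simp

text \<open>The polynomial factor is at most \<open>exp (N * r)\<close>, and completing the square bounds the
  remaining exponent.\<close>

lemma poly_times_gauss_bounded:
  fixes a b :: real
  assumes "0 < a"
  obtains C where "0 < C" "\<And>r. 0 \<le> r \<Longrightarrow> (1 + r) ^ N * exp (b * r - a * r\<^sup>2) \<le> C"
proof
  show "0 < exp ((real N + b)\<^sup>2 / (4 * a))" by simp
  fix r :: real assume r: "0 \<le> r"
  have "(1 + r) ^ N \<le> exp r ^ N"
    using r exp_ge_add_one_self by (intro power_mono) auto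
  also have "\<dots> = exp (real N * r)" by (simp add: exp_of_nat_mult)
  finally have "(1 + r) ^ N * exp (b * r - a * r\<^sup>2) \<le> exp (real N * r) * exp (b * r - a * r\<^sup>2)"
    by (intro mult_right_mono) auto
  also have "\<dots> = exp ((real N + b) * r - a * r\<^sup>2)"
    by (simp add: exp_add[symmetric] algebra_simps)
  also have "(real N + b) * r - a * r\<^sup>2 \<le> (real N + b)\<^sup>2 / (4 * a)"
  proof -
    have "0 \<le> (2 * a * r - (real N + b))\<^sup>2" by simp
    then have "((real N + b) * r - a * r\<^sup>2) * (4 * a) \<le> (real N + b)\<^sup>2"
      by (simp add: algebra_simps power2_eq_square)
    then show ?thesis using assms by (subst pos_le_divide_eq) simp_all
  qed
  finally show "(1 + r) ^ N * exp (b * r - a * r\<^sup>2) \<le> exp ((real N + b)\<^sup>2 / (4 * a))" by simp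
qed

lemma integrable_gauss:
  assumes "0 < c"
  shows "integrable lborel (\<lambda>x :: 'a::euclidean_space. exp (- c * (norm x)\<^sup>2))"
proof -
  obtain C where C: "\<And>r. 0 \<le> r \<Longrightarrow> (1 + r) ^ (DIM('a) + 2) * exp (0 * r - c * r\<^sup>2) \<le> C"
    using poly_times_gauss_bounded[OF assms] by blast
  show ?thesis
  proof (rule integrable_of_decay)
    show "(\<lambda>x :: 'a. exp (- c * (norm x)\<^sup>2)) \<in> borel_measurable borel"
      by (intro borel_measurable_continuous_onI continuous_intros)
    fix x :: 'a
    have "0 < (1 + norm x) ^ (DIM('a) + 2)" by (simp add: add_pos_nonneg)
    then show "norm (exp (- c * (norm x)\<^sup>2)) \<le> C / (1 + norm x) ^ (DIM('a) + 2)"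
      using C[of "norm x"] by (simp add: pos_le_divide_eq mult.commute)
  qed
qed

lemma nonzero_gauss_integral:
  fixes c :: real
  assumes "0 < c"
  shows "(LINT x|lborel. exp (- c * (norm (x :: 'a::euclidean_space))\<^sup>2)) \<noteq> 0"
proof
  assume "(LINT x|lborel. exp (- c * (norm (x :: 'a))\<^sup>2)) = 0"
  then have "AE x in lborel. exp (- c * (norm (x :: 'a))\<^sup>2) = 0"
    by (subst (asm) integral_nonneg_eq_0_iff_AE[OF integrable_gauss[OF assms]]) auto
  then have "AE x in (lborel :: 'a measure). False" by simp
  then show False
    by (simp add: AE_iff_measurable[OF _ refl] eventually_False ae_filter_eq_bot_iff)
qed

lemma difference_quotient_LIMSEQ:
  fixes f :: "'a::real_normed_vector \<Rightarrow> 'b::real_normed_vector"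
  assumes der: "(f has_derivative D) (at x)" and e: "\<And>n. 0 < e n" "e \<longlonglongrightarrow> 0"
  shows "(\<lambda>n. (1 / e n) *\<^sub>R (f (x + e n *\<^sub>R v) - f x)) \<longlonglongrightarrow> D v"
proof (cases "v = 0")
  case True
  have "D 0 = 0" using der has_derivative_linear linear_0 by blast
  then show ?thesis using True by simp
next
  case False
  have lin: "linear D" using der has_derivative_linear by blast
  have "((\<lambda>y. norm ((f y - f x) - D (y - x)) / norm (y - x)) \<longlongrightarrow> 0) (at x)"
    using der by (simp add: has_derivative_iff_norm)
  moreover have "(\<lambda>n. x + e n *\<^sub>R v) \<longlonglongrightarrow> x"
    using tendsto_add[OF tendsto_const tendsto_scaleR[OF e(2) tendsto_const], of x v] by simp
  moreover have "x + e n *\<^sub>R v \<noteq> x" for n using e(1)[of n] False by simp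
  ultimately have "(\<lambda>n. norm ((f (x + e n *\<^sub>R v) - f x) - D (e n *\<^sub>R v)) / norm (e n *\<^sub>R v)) \<longlonglongrightarrow> 0"
    unfolding tendsto_at_iff_sequentially comp_def by (auto dest!: spec[of _ "\<lambda>n. x + e n *\<^sub>R v"])
  then have "(\<lambda>n. norm v * (norm ((f (x + e n *\<^sub>R v) - f x) - D (e n *\<^sub>R v)) / norm (e n *\<^sub>R v))) \<longlonglongrightarrow> norm v * 0"
    by (intro tendsto_mult tendsto_const)
  moreover have "norm v * (norm ((f (x + e n *\<^sub>R v) - f x) - D (e n *\<^sub>R v)) / norm (e n *\<^sub>R v))
      = norm ((1 / e n) *\<^sub>R (f (x + e n *\<^sub>R v) - f x) - D v)" for n
  proof -
    have "(f (x + e n *\<^sub>R v) - f x) - D (e n *\<^sub>R v)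
        = e n *\<^sub>R ((1 / e n) *\<^sub>R (f (x + e n *\<^sub>R v) - f x) - D v)"
      using e(1)[of n] by (simp add: linear_cmul[OF lin] scaleR_diff_right)
    then show ?thesis using e(1)[of n] False by simp
  qed
  ultimately have "(\<lambda>n. norm ((1 / e n) *\<^sub>R (f (x + e n *\<^sub>R v) - f x) - D v)) \<longlonglongrightarrow> 0"
    by simp
  then show ?thesis
    by (rule LIM_zero_cancel[OF tendsto_norm_zero_cancel])
qed

text \<open>Differentiation under the integral sign. The mean value inequality bounds the difference
  quotients by \<open>B\<close>, and dominated convergence applies along every sequence tending to \<open>z0\<close>.\<close>

lemma has_derivative_lebesgue_integral:
  fixes q :: "'a::euclidean_space \<Rightarrow> 'b \<Rightarrow> 'c::{banach, second_countable_topology}"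
  assumes der: "\<And>z w. z \<in> ball z0 1 \<Longrightarrow> ((\<lambda>z. q z w) has_derivative D z w) (at z)"
    and bound: "\<And>z w h. z \<in> ball z0 1 \<Longrightarrow> norm (D z w h) \<le> B w * norm h"
    and q: "\<And>z. z \<in> ball z0 1 \<Longrightarrow> integrable M (q z)"
    and B: "integrable M B"
  shows "integrable M (\<lambda>w. D z0 w h)" (is ?int)
    and "((\<lambda>z. LINT w|M. q z w) has_derivative (\<lambda>h. LINT w|M. D z0 w h)) (at z0)" (is ?der)
proof -
  have z0: "z0 \<in> ball z0 1" by simp
  have lip: "norm (q z w - q z0 w) \<le> B w * norm (z - z0)" if "z \<in> ball z0 1" for z w
  proof (rule differentiable_bound[OF convex_ball _ _ that z0])
    show "((\<lambda>z. q z w) has_derivative D x w) (at x within ball z0 1)" if "x \<in> ball z0 1" for x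
      using der[OF that] has_derivative_at_withinI by blast
    show "onorm (D x w) \<le> B w" if "x \<in> ball z0 1" for x
      using bound[OF that] by (rule onorm_le)
  qed
  have lin: "linear (D z0 w)" for w
    using der[OF z0] has_derivative_linear by blast
  have int: "integrable M (\<lambda>w. D z0 w h)" for h
  proof (rule Bochner_Integration.integrable_bound)
    show "integrable M (\<lambda>w. B w * norm h)" using B by simp
    show "AE w in M. norm (D z0 w h) \<le> norm (B w * norm h)"
      using order.trans[OF bound[OF z0] abs_ge_self] by simp
    \<comment> \<open>The derivative is measurable as a pointwise limit of difference quotients.\<close>
    define e where "e n = 1 / ((1 + norm h) * real (Suc n))" for n
    have e: "e n > 0" "e n * norm h < 1" for n
    proof -
      have 1: "norm h < 1 + norm h" "1 \<le> real (Suc n)" by auto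
      then have "norm h * 1 < (1 + norm h) * real (Suc n)"
        by (intro mult_less_le_imp_less) auto
      then show "e n > 0" "e n * norm h < 1"
        using 1 by (auto simp: e_def divide_simps add_pos_nonneg)
    qed
    have ball: "z0 + e n *\<^sub>R h \<in> ball z0 1" for n
      using e[of n] by (simp add: dist_norm)
    have elim: "e \<longlonglongrightarrow> 0"
    proof -
      have "(\<lambda>n. 1 / (1 + norm h) * inverse (real (Suc n))) \<longlonglongrightarrow> 1 / (1 + norm h) * 0"
        by (intro tendsto_mult LIMSEQ_inverse_real_of_nat tendsto_const)
      then show ?thesis by (simp add: e_def[abs_def] field_simps)
    qed
    show "(\<lambda>w. D z0 w h) \<in> borel_measurable M"
    proof (rule borel_measurable_LIMSEQ_metric)
      show "(\<lambda>w. (1 / e n) *\<^sub>R (q (z0 + e n *\<^sub>R h) w - q z0 w)) \<in> borel_measurable M" for n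
        using q[OF ball] q[OF z0] by measurable
      fix w
      show "(\<lambda>n. (1 / e n) *\<^sub>R (q (z0 + e n *\<^sub>R h) w - q z0 w)) \<longlonglongrightarrow> D z0 w h"
        by (rule difference_quotient_LIMSEQ[OF der[OF z0] e(1) elim])
    qed
  qed
  show ?int by (rule int)
  show ?der
    unfolding has_derivative_iff_norm
  proof
    show "bounded_linear (\<lambda>h. LINT w|M. D z0 w h)"
    proof (rule bounded_linear_intro)
      show "(LINT w|M. D z0 w (x + y)) = (LINT w|M. D z0 w x) + (LINT w|M. D z0 w y)" for x y
        using int by (simp add: linear_add[OF lin])
      show "(LINT w|M. D z0 w (r *\<^sub>R x)) = r *\<^sub>R (LINT w|M. D z0 w x)" for r x
        by (simp add: linear_cmul[OF lin])
      show "norm (LINT w|M. D z0 w x) \<le> norm x * (LINT w|M. B w)" for x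
      proof -
        have "norm (LINT w|M. D z0 w x) \<le> (LINT w|M. norm (D z0 w x))" by simp
        also have "\<dots> \<le> (LINT w|M. B w * norm x)"
          using int B bound[OF z0] by (intro integral_mono) auto
        finally show ?thesis by (simp add: mult.commute)
      qed
    qed
    have eq: "at z0 = at z0 within ball z0 1"
      by (rule at_within_open[symmetric]) auto
    show "((\<lambda>z. norm ((LINT w|M. q z w) - (LINT w|M. q z0 w) - (LINT w|M. D z0 w (z - z0))) / norm (z - z0)) \<longlongrightarrow> 0) (at z0)"
      unfolding eq tendsto_at_iff_sequentially comp_def
    proof (intro allI impI)
      fix X :: "nat \<Rightarrow> 'a"
      assume X: "\<forall>i. X i \<in> ball z0 1 - {z0}" and lim: "X \<longlonglongrightarrow> z0"
      have Xb: "X i \<in> ball z0 1" and X0: "norm (X i - z0) > 0" for i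
        using X by auto
      define g where "g i w = (1 / norm (X i - z0)) *\<^sub>R (q (X i) w - q z0 w - D z0 w (X i - z0))" for i w
      have gint: "integrable M (g i)" for i
        unfolding g_def using q[OF Xb] q[OF z0] int by auto
      have "(\<lambda>i. LINT w|M. g i w) \<longlonglongrightarrow> (LINT w|M. 0)"
      proof (rule integral_dominated_convergence)
        show "integrable M (\<lambda>w. 2 * B w)" using B by simp
        show "g i \<in> borel_measurable M" for i using gint by auto
        show "AE w in M. (\<lambda>i. g i w) \<longlonglongrightarrow> 0"
        proof (rule AE_I2)
          fix w
          have "((\<lambda>y. norm (q y w - q z0 w - D z0 w (y - z0)) / norm (y - z0)) \<longlongrightarrow> 0) (at z0)"
            using der[OF z0, of w] by (simp add: has_derivative_iff_norm)
          then have "(\<lambda>i. norm (q (X i) w - q z0 w - D z0 w (X i - z0)) / norm (X i - z0)) \<longlonglongrightarrow> 0"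
            using X lim unfolding tendsto_at_iff_sequentially comp_def by (auto dest!: spec[of _ X])
          moreover have "norm (g i w) = norm (q (X i) w - q z0 w - D z0 w (X i - z0)) / norm (X i - z0)" for i
            unfolding g_def by simp
          ultimately have "(\<lambda>i. norm (g i w)) \<longlonglongrightarrow> 0" by simp
          then show "(\<lambda>i. g i w) \<longlonglongrightarrow> 0"
            by (rule tendsto_norm_zero_cancel)
        qed
        show "AE w in M. norm (g i w) \<le> 2 * B w" for i
        proof (rule AE_I2)
          fix w
          have "norm (q (X i) w - q z0 w - D z0 w (X i - z0)) \<le> B w * norm (X i - z0) + B w * norm (X i - z0)"
            by (rule order.trans[OF norm_triangle_ineq4 add_mono[OF lip[OF Xb] bound[OF z0]]])
          then have "norm (q (X i) w - q z0 w - D z0 w (X i - z0)) / norm (X i - z0) \<le> 2 * B w"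
            using X0[of i] by (simp add: pos_divide_le_eq)
          then show "norm (g i w) \<le> 2 * B w"
            unfolding g_def by simp
        qed
      qed simp
      then have "(\<lambda>i. norm (LINT w|M. g i w)) \<longlonglongrightarrow> 0"
        by (simp add: tendsto_norm_zero)
      moreover have "norm (LINT w|M. g i w)
          = norm ((LINT w|M. q (X i) w) - (LINT w|M. q z0 w) - (LINT w|M. D z0 w (X i - z0))) / norm (X i - z0)" for i
      proof -
        have "(LINT w|M. g i w) = (1 / norm (X i - z0)) *\<^sub>R
            ((LINT w|M. q (X i) w) - (LINT w|M. q z0 w) - (LINT w|M. D z0 w (X i - z0)))"
          unfolding g_def using q[OF Xb] q[OF z0] int by simp
        then show ?thesis by simp
      qed
      ultimately show "(\<lambda>i. norm ((LINT w|M. q (X i) w) - (LINT w|M. q z0 w) - (LINT w|M. D z0 w (X i - z0))) / norm (X i - z0)) \<longlonglongrightarrow> 0"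
        by simp
    qed
  qed
qed

text \<open>Translation invariance makes the integral of every difference quotient vanish, and the
  decay of the derivative dominates the difference quotients.\<close>

lemma integral_directional_derivative_eq_0:
  fixes u :: "'a::euclidean_space \<Rightarrow> 'b::{banach, second_countable_topology}"
  assumes der: "\<And>x. (u has_derivative D x) (at x)"
    and int: "integrable lborel u"
    and bound: "\<And>x. norm (D x v) \<le> C / (1 + norm x) ^ (DIM('a) + 2)"
  shows "(LINT x|lborel. D x v) = 0"
proof -
  let ?n = "DIM('a) + 2"
  have u[measurable]: "u \<in> borel_measurable borel"
    using int by auto
  define B where "B x = C * (1 + norm v) ^ ?n * (1 / (1 + norm x) ^ ?n)" for x :: 'a
  have C: "C \<ge> 0"
    using order.trans[OF norm_ge_zero bound[of 0]] by simp
  have Dv: "norm (D (x + t *\<^sub>R v) v) \<le> B x" if "\<bar>t\<bar> \<le> 1" for x t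
  proof -
    have "1 + norm x \<le> (1 + norm v) * (1 + norm (x + t *\<^sub>R v))"
    proof -
      have "norm x \<le> norm (x + t *\<^sub>R v) + norm (t *\<^sub>R v)"
        using norm_triangle_ineq4[of "x + t *\<^sub>R v" "t *\<^sub>R v"] by simp
      also have "norm (t *\<^sub>R v) \<le> norm v"
        using that mult_right_mono[OF that, of "norm v"] by simp
      finally have "1 + norm x \<le> 1 + norm v + norm (x + t *\<^sub>R v)" by simp
      also have "\<dots> \<le> (1 + norm v) * (1 + norm (x + t *\<^sub>R v))" by (simp add: algebra_simps)
      finally show ?thesis .
    qed
    then have "(1 + norm x) ^ ?n \<le> (1 + norm v) ^ ?n * (1 + norm (x + t *\<^sub>R v)) ^ ?n"
      unfolding power_mult_distrib[symmetric] by (intro power_mono) auto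
    then have "C * (1 + norm x) ^ ?n \<le> C * ((1 + norm v) ^ ?n * (1 + norm (x + t *\<^sub>R v)) ^ ?n)"
      using C by (rule mult_left_mono)
    then have "C / (1 + norm (x + t *\<^sub>R v)) ^ ?n \<le> B x"
      unfolding B_def by (subst pos_divide_le_eq) (simp_all add: divide_simps add_pos_nonneg mult_ac del: power_Suc)
    then show ?thesis using bound[of "x + t *\<^sub>R v"] by linarith
  qed
  define e where "e n = inverse (real (Suc n))" for n
  have e: "e n > 0" "e n \<le> 1" for n by (auto simp: e_def divide_simps)
  have elim: "e \<longlonglongrightarrow> 0" unfolding e_def[abs_def] by (rule LIMSEQ_inverse_real_of_nat)
  have lin: "linear (D x)" for x using der has_derivative_linear by blast
  have path: "((\<lambda>t::real. u (x + t *\<^sub>R v)) has_derivative (\<lambda>h. h *\<^sub>R D (x + t *\<^sub>R v) v)) (at t)" for x t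
  proof -
    have "((\<lambda>t::real. u (x + t *\<^sub>R v)) has_derivative (\<lambda>h. D (x + t *\<^sub>R v) (h *\<^sub>R v))) (at t)"
      by (rule has_derivative_compose[where f="\<lambda>t. x + t *\<^sub>R v" and g=u and f'="\<lambda>t. t *\<^sub>R v"])
        (use der in \<open>auto intro!: derivative_eq_intros\<close>)
    then show ?thesis by (simp add: linear_cmul[OF lin])
  qed
  have "(\<lambda>n. LINT x|lborel. (1 / e n) *\<^sub>R (u (x + e n *\<^sub>R v) - u x)) \<longlonglongrightarrow> (LINT x|lborel. D x v)"
  proof (rule integral_dominated_convergence)
    show "integrable lborel B"
      unfolding B_def by (intro integrable_mult_right integrable_inverse_power)
    have lim: "(\<lambda>n. (1 / e n) *\<^sub>R (u (x + e n *\<^sub>R v) - u x)) \<longlonglongrightarrow> D x v" for x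
      by (rule difference_quotient_LIMSEQ[OF der e(1) elim])
    then show "AE x in lborel. (\<lambda>n. (1 / e n) *\<^sub>R (u (x + e n *\<^sub>R v) - u x)) \<longlonglongrightarrow> D x v" by simp
    show "(\<lambda>x. (1 / e n) *\<^sub>R (u (x + e n *\<^sub>R v) - u x)) \<in> borel_measurable lborel" for n by measurable
    show "(\<lambda>x. D x v) \<in> borel_measurable lborel"
      using lim by (rule borel_measurable_LIMSEQ_metric[rotated]) measurable
    show "AE x in lborel. norm ((1 / e n) *\<^sub>R (u (x + e n *\<^sub>R v) - u x)) \<le> B x" for n
    proof (rule AE_I2)
      fix x
      have "norm (u (x + e n *\<^sub>R v) - u (x + 0 *\<^sub>R v)) \<le> B x * norm (e n - 0)"
      proof (rule differentiable_bound[where S="{0..1}" and f="\<lambda>t. u (x + t *\<^sub>R v)"])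
        show "((\<lambda>t. u (x + t *\<^sub>R v)) has_derivative (\<lambda>h. h *\<^sub>R D (x + t *\<^sub>R v) v)) (at t within {0..1})" for t
          using path has_derivative_at_withinI by blast
        show "onorm (\<lambda>h. h *\<^sub>R D (x + t *\<^sub>R v) v) \<le> B x" if "t \<in> {0..1}" for t
        proof (rule onorm_le)
          fix h :: real
          show "norm (h *\<^sub>R D (x + t *\<^sub>R v) v) \<le> B x * norm h"
            using mult_right_mono[OF Dv[of t x] norm_ge_zero[of h]] that by (simp add: mult.commute)
        qed
      qed (use e in \<open>auto simp: less_imp_le\<close>)
      then show "norm ((1 / e n) *\<^sub>R (u (x + e n *\<^sub>R v) - u x)) \<le> B x"
        using e(1)[of n] by (simp add: divide_simps mult.commute)
    qed
  qed
  moreover have "(LINT x|lborel. (1 / e n) *\<^sub>R (u (x + e n *\<^sub>R v) - u x)) = 0" for n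
    using int integrable_translate_iff[OF u, of "e n *\<^sub>R v"] integral_translate[OF u, of "e n *\<^sub>R v"] by simp
  ultimately show ?thesis
    by (simp only: LIMSEQ_const_iff)
qed

section \<open>Lebesgue norms and Young's inequality\<close>

text \<open>The graph of \<open>t powr p\<close> lies above its tangent line at \<open>c\<close>.\<close>

lemma powr_tangent_le:
  fixes p :: real
  assumes p: "1 \<le> p" and c: "0 < c" and t: "0 \<le> t"
  shows "p * c powr (p - 1) * t \<le> t powr p + (p - 1) * c powr p"
proof (cases "p = 1")
  case True
  then show ?thesis using t c by simp
next
  case False
  define q where "q = p / (p - 1)"
  have p1: "1 < p" and p0: "p - 1 \<noteq> 0" using p False by auto
  have q: "1 < q" "1 / p + 1 / q = 1" "(p - 1) * q = p"
    using p1 by (auto simp: q_def field_simps)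
  have "t * c powr (p - 1) \<le> t powr p / p + (c powr (p - 1)) powr q / q"
    by (rule Youngs_inequality) (use p1 q t in auto)
  also have "(c powr (p - 1)) powr q = c powr p"
    by (simp add: powr_powr q)
  finally have "p * (t * c powr (p - 1)) \<le> p * (t powr p / p + c powr p / q)"
    using p by (intro mult_left_mono) auto
  also have "\<dots> = t powr p + (p - 1) * c powr p"
    using p1 by (simp add: q_def field_simps)
  finally show ?thesis by (simp add: mult_ac)
qed

lemma Lp_norm_finite_iff:
  assumes "p \<noteq> \<infinity>"
  shows "Lp_norm p M f < \<infinity> \<longleftrightarrow> (\<integral>\<^sup>+ x. ennreal (norm (f x) powr enn2real p) \<partial>M) < \<infinity>"
  using assms by (auto simp: Lp_norm_def Let_def less_top)

lemma enn2real_ge_1: "1 \<le> p \<Longrightarrow> p \<noteq> (\<infinity>::ennreal) \<Longrightarrow> 1 \<le> enn2real p"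
  by (cases p) (auto simp: ennreal_le_iff[of _ 1, simplified] ennreal_1[symmetric] simp del: ennreal_1)

lemma Lp_norm_cong_norm:
  assumes "\<And>x. norm (f x) = norm (g x)"
  shows "Lp_norm p M f = Lp_norm p M g"
  unfolding Lp_norm_def assms ..

text \<open>Young's inequality for convolution with a kernel of mass at most \<open>m\<close>. For finite \<open>p\<close> the
  pointwise step is Jensen's inequality, obtained by integrating the tangent-line bound for
  the convex function \<open>t powr p\<close> at \<open>c = norm (u z) / m\<close>.\<close>

lemma young_convolution:
  fixes f u :: "'a::euclidean_space \<Rightarrow> complex" and h :: "'a \<Rightarrow> ennreal"
  assumes p: "1 \<le> p" and [measurable]: "f \<in> borel_measurable borel" "u \<in> borel_measurable borel"
      "h \<in> borel_measurable borel"
    and m: "0 < m" "(\<integral>\<^sup>+x. h x \<partial>lborel) \<le> ennreal m"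
    and u: "\<And>z. ennreal (norm (u z)) \<le> (\<integral>\<^sup>+w. ennreal (norm (f w)) * h (w - z) \<partial>lborel)"
  shows "Lp_norm p lborel u \<le> ennreal m * Lp_norm p lborel f"
proof -
  have mass: "(\<integral>\<^sup>+w. h (w - z) \<partial>lborel) \<le> ennreal m" for z
    using nn_integral_translate[of h "- z"] m by simp
  show ?thesis
  proof (cases "p = \<infinity>")
    case True
    define E where "E = esssup lborel (\<lambda>x. ennreal (norm (f x)))"
    have AE: "AE w in lborel. ennreal (norm (f w)) \<le> E"
      unfolding E_def by (rule esssup_AE)
    have "ennreal (norm (u z)) \<le> ennreal m * E" for z
    proof -
      have "ennreal (norm (u z)) \<le> (\<integral>\<^sup>+w. E * h (w - z) \<partial>lborel)"
      proof (rule order.trans[OF u nn_integral_mono_AE])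
        show "AE w in lborel. ennreal (norm (f w)) * h (w - z) \<le> E * h (w - z)"
          using AE by eventually_elim (simp add: mult_right_mono)
      qed
      also have "\<dots> = E * (\<integral>\<^sup>+w. h (w - z) \<partial>lborel)"
        by (rule nn_integral_cmult) measurable
      also have "\<dots> \<le> E * ennreal m" by (rule mult_left_mono[OF mass]) simp
      finally show ?thesis by (simp add: mult.commute)
    qed
    then have "esssup lborel (\<lambda>x. ennreal (norm (u x))) \<le> ennreal m * E"
      by (intro esssup_I) auto
    then show ?thesis using True by (simp add: Lp_norm_def E_def)
  next
    case False
    define r where "r = enn2real p"
    have r: "1 \<le> r" unfolding r_def using p False by (rule enn2real_ge_1)
    define If where "If = (\<integral>\<^sup>+ x. ennreal (norm (f x) powr r) \<partial>lborel)"
    define Iu where "Iu = (\<integral>\<^sup>+ x. ennreal (norm (u x) powr r) \<partial>lborel)"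
    have pt: "ennreal (norm (u z) powr r)
        \<le> ennreal (m powr (r - 1)) * (\<integral>\<^sup>+w. ennreal (norm (f w) powr r) * h (w - z) \<partial>lborel)" for z
    proof (cases "u z = 0")
      case True then show ?thesis using r by simp
    next
      case False
      define K where "K = (\<integral>\<^sup>+w. ennreal (norm (f w) powr r) * h (w - z) \<partial>lborel)"
      define U where "U = norm (u z)"
      define c where "c = U / m"
      have U: "0 < U" using False by (simp add: U_def)
      have c: "0 < c" using U m by (simp add: c_def)
      have a: "0 \<le> r * c powr (r - 1)" using r by simp
      have b: "0 \<le> (r - 1) * c powr r" using r by simp
      have "ennreal (r * c powr (r - 1) * U) \<le> ennreal (r * c powr (r - 1)) * (\<integral>\<^sup>+w. ennreal (norm (f w)) * h (w - z) \<partial>lborel)"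
        unfolding ennreal_mult'[OF a] U_def by (rule mult_left_mono[OF u]) simp
      also have "\<dots> = (\<integral>\<^sup>+w. ennreal (r * c powr (r - 1)) * (ennreal (norm (f w)) * h (w - z)) \<partial>lborel)"
        by (rule nn_integral_cmult[symmetric]) measurable
      also have "\<dots> \<le> (\<integral>\<^sup>+w. ennreal (norm (f w) powr r) * h (w - z) + ennreal ((r - 1) * c powr r) * h (w - z) \<partial>lborel)"
      proof (rule nn_integral_mono)
        fix w
        have "ennreal (r * c powr (r - 1)) * ennreal (norm (f w)) \<le> ennreal (norm (f w) powr r + (r - 1) * c powr r)"
          unfolding ennreal_mult'[OF a, symmetric] by (rule ennreal_leI[OF powr_tangent_le[OF r c]]) simp
        also have "\<dots> = ennreal (norm (f w) powr r) + ennreal ((r - 1) * c powr r)"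
          by (rule ennreal_plus) (use b in auto)
        finally show "ennreal (r * c powr (r - 1)) * (ennreal (norm (f w)) * h (w - z))
            \<le> ennreal (norm (f w) powr r) * h (w - z) + ennreal ((r - 1) * c powr r) * h (w - z)"
          unfolding mult.assoc[symmetric] distrib_right[symmetric] by (rule mult_right_mono) simp
      qed
      also have "\<dots> = K + (\<integral>\<^sup>+w. ennreal ((r - 1) * c powr r) * h (w - z) \<partial>lborel)"
        unfolding K_def by (rule nn_integral_add) measurable
      also have "(\<integral>\<^sup>+w. ennreal ((r - 1) * c powr r) * h (w - z) \<partial>lborel)
          = ennreal ((r - 1) * c powr r) * (\<integral>\<^sup>+w. h (w - z) \<partial>lborel)"
        by (rule nn_integral_cmult) measurable
      finally have "ennreal (r * c powr (r - 1) * U) \<le> K + ennreal ((r - 1) * c powr r) * (\<integral>\<^sup>+w. h (w - z) \<partial>lborel)" .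
      also have "\<dots> \<le> K + ennreal ((r - 1) * c powr r) * ennreal m"
        by (intro add_left_mono mult_left_mono mass) simp
      finally have main: "ennreal (r * c powr (r - 1) * U) \<le> K + ennreal ((r - 1) * c powr r * m)"
        by (simp add: ennreal_mult'[OF b])
      have pw: "c powr r * m = U powr r * m powr (1 - r)" "c powr (r - 1) * U = U powr r * m powr (1 - r)"
        using U m by (simp_all add: c_def powr_divide powr_diff field_simps)
      show ?thesis
      proof (cases K)
        case (real k)
        have "ennreal (r * c powr (r - 1) * U) \<le> ennreal (k + (r - 1) * c powr r * m)"
          using main real b m by (simp add: ennreal_plus)
        then have "r * c powr (r - 1) * U \<le> k + (r - 1) * c powr r * m"
          by (rule ennreal_le_iff[THEN iffD1, rotated]) (use real b m in auto)
        then have "r * (U powr r * m powr (1 - r)) \<le> k + (r - 1) * (U powr r * m powr (1 - r))"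
          by (simp only: mult.assoc pw)
        then have "U powr r * m powr (1 - r) \<le> k" by (simp add: algebra_simps)
        then have "m powr (r - 1) * (U powr r * m powr (1 - r)) \<le> m powr (r - 1) * k"
          by (rule mult_left_mono) simp
        moreover have "m powr (r - 1) * (U powr r * m powr (1 - r)) = U powr r"
          using m by (simp add: powr_diff)
        ultimately show ?thesis
          using real unfolding K_def[symmetric] U_def[symmetric]
          by (simp add: ennreal_mult'[symmetric] ennreal_leI)
      next
        case top
        then show ?thesis using m unfolding K_def[symmetric] by (simp add: ennreal_mult_top)
      qed
    qed
    have "Iu \<le> (\<integral>\<^sup>+z. ennreal (m powr (r - 1)) * (\<integral>\<^sup>+w. ennreal (norm (f w) powr r) * h (w - z) \<partial>lborel) \<partial>lborel)"
      unfolding Iu_def by (rule nn_integral_mono) (rule pt)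
    also have "\<dots> = ennreal (m powr (r - 1)) * (\<integral>\<^sup>+z. (\<integral>\<^sup>+w. ennreal (norm (f w) powr r) * h (w - z) \<partial>lborel) \<partial>lborel)"
      by (rule nn_integral_cmult) measurable
    also have "(\<integral>\<^sup>+z. (\<integral>\<^sup>+w. ennreal (norm (f w) powr r) * h (w - z) \<partial>lborel) \<partial>lborel)
        = (\<integral>\<^sup>+w. (\<integral>\<^sup>+z. ennreal (norm (f w) powr r) * h (w - z) \<partial>lborel) \<partial>lborel)"
      by (rule lborel_pair.Fubini') measurable
    also have "\<dots> = (\<integral>\<^sup>+w. ennreal (norm (f w) powr r) * (\<integral>\<^sup>+z. h z \<partial>lborel) \<partial>lborel)"
      by (intro nn_integral_cong) (subst nn_integral_cmult, auto simp: nn_integral_reflect)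
    also have "\<dots> = If * (\<integral>\<^sup>+z. h z \<partial>lborel)"
      unfolding If_def by (rule nn_integral_multc) measurable
    also have "\<dots> \<le> If * ennreal m" by (rule mult_left_mono[OF m(2)]) simp
    finally have I: "Iu \<le> ennreal (m powr (r - 1)) * (If * ennreal m)"
      by (simp add: mult_left_mono)
    have mm: "m powr (r - 1) * m = m powr r" using m by (simp add: powr_diff)
    show ?thesis
    proof (cases If)
      case top
      then have "Lp_norm p lborel f = \<infinity>"
        using False by (simp add: Lp_norm_def Let_def If_def r_def)
      then show ?thesis using m by (simp add: ennreal_mult_top)
    next
      case (real i)
      have "Iu \<le> ennreal (m powr r * i)"
        using I m unfolding real(2) mm[symmetric] by (simp add: ennreal_mult'[symmetric] real(1) mult_ac)
      then obtain j where j: "Iu = ennreal j" "0 \<le> j" "j \<le> m powr r * i"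
        using real(1) by (cases Iu) (auto simp: top_unique)
      have "j powr (1 / r) \<le> (m powr r * i) powr (1 / r)"
        using j r by (intro powr_mono2) auto
      also have "\<dots> = m * i powr (1 / r)"
        using m real r by (simp add: powr_mult powr_powr)
      finally have "ennreal (j powr (1 / r)) \<le> ennreal m * ennreal (i powr (1 / r))"
        using m by (simp add: ennreal_mult'[symmetric] ennreal_leI)
      moreover have "Lp_norm p lborel u = ennreal (j powr (1 / r))"
        unfolding Lp_norm_def Let_def r_def[symmetric] Iu_def[symmetric] using False j by simp
      moreover have "Lp_norm p lborel f = ennreal (i powr (1 / r))"
        unfolding Lp_norm_def Let_def r_def[symmetric] If_def[symmetric] using False real by simp
      ultimately show ?thesis by simp
    qed
  qed
qed

text \<open>For finite \<open>p\<close> the elementary bound \<open>t \<le> 1 + t powr p\<close> takes the place of Hoelder's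
  inequality, since only finiteness uniformly in \<open>z\<close> matters.\<close>

lemma Lp_locally_bounded:
  fixes f :: "'a::euclidean_space \<Rightarrow> complex"
  assumes p: "1 \<le> p" and f: "f \<in> Lp p lborel"
  obtains K where "\<And>z. (\<integral>\<^sup>+w\<in>ball z 1. ennreal (norm (f w)) \<partial>lborel) \<le> ennreal K"
proof -
  define V where "V = emeasure lborel (ball (0::'a) 1)"
  have V: "emeasure lborel (ball z 1) = V" for z :: 'a
    unfolding V_def by (simp add: emeasure_ball)
  have Vfin: "V < \<infinity>" unfolding V_def by (simp add: emeasure_ball)
  have [measurable]: "f \<in> borel_measurable borel" using f by (simp add: Lp_def)
  have "\<exists>B<\<infinity>. \<forall>z. (\<integral>\<^sup>+w\<in>ball z 1. ennreal (norm (f w)) \<partial>lborel) \<le> B"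
  proof (cases "p = \<infinity>")
    case True
    define E where "E = esssup lborel (\<lambda>x. ennreal (norm (f x)))"
    have AE: "AE w in lborel. ennreal (norm (f w)) \<le> E"
      unfolding E_def by (rule esssup_AE)
    have "(\<integral>\<^sup>+w\<in>ball z 1. ennreal (norm (f w)) \<partial>lborel) \<le> E * V" for z
    proof -
      have "(\<integral>\<^sup>+w\<in>ball z 1. ennreal (norm (f w)) \<partial>lborel) \<le> (\<integral>\<^sup>+w\<in>ball z 1. E \<partial>lborel)"
      proof (rule nn_integral_mono_AE)
        show "AE w in lborel. ennreal (norm (f w)) * indicator (ball z 1) w \<le> E * indicator (ball z 1) w"
          using AE by eventually_elim (simp add: mult_right_mono)
      qed
      also have "\<dots> = E * V" using V by (simp add: nn_integral_cmult_indicator)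
      finally show ?thesis .
    qed
    moreover have "E < \<infinity>" using f True by (simp add: Lp_def Lp_norm_def E_def)
    ultimately show ?thesis
      using Vfin by (intro exI[of _ "E * V"]) (simp add: ennreal_mult_less_top)
  next
    case False
    define r where "r = enn2real p"
    have r: "1 \<le> r" unfolding r_def using p False by (rule enn2real_ge_1)
    define I where "I = (\<integral>\<^sup>+ x. ennreal (norm (f x) powr r) \<partial>lborel)"
    have I: "I < \<infinity>"
      using f Lp_norm_finite_iff[OF False, of lborel f] by (simp add: Lp_def I_def r_def)
    have "(\<integral>\<^sup>+w\<in>ball z 1. ennreal (norm (f w)) \<partial>lborel) \<le> V + I" for z
    proof -
      have "(\<integral>\<^sup>+w\<in>ball z 1. ennreal (norm (f w)) \<partial>lborel) \<le> (\<integral>\<^sup>+w. indicator (ball z 1) w + ennreal (norm (f w) powr r) \<partial>lborel)"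
      proof (rule nn_integral_mono)
        fix w
        have "norm (f w) \<le> 1 + norm (f w) powr r"
        proof (cases "norm (f w) \<le> 1")
          case False
          then have "norm (f w) powr 1 \<le> norm (f w) powr r" using r by (intro powr_mono) auto
          then show ?thesis using False by simp
        qed (simp add: add_increasing2)
        then have "ennreal (norm (f w)) \<le> 1 + ennreal (norm (f w) powr r)"
          using ennreal_leI ennreal_plus[of 1 "norm (f w) powr r"] by fastforce
        then show "ennreal (norm (f w)) * indicator (ball z 1) w \<le> indicator (ball z 1) w + ennreal (norm (f w) powr r)"
          by (auto split: split_indicator)
      qed
      also have "\<dots> = V + I"
        using V unfolding I_def by (subst nn_integral_add) (auto intro!: borel_measurable_indicator)
      finally show ?thesis .
    qed
    then show ?thesis using I Vfin by (intro exI[of _ "V + I"]) (simp add: ennreal_add_less_top)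
  qed
  then obtain B where B: "B < \<infinity>" "\<And>z. (\<integral>\<^sup>+w\<in>ball z 1. ennreal (norm (f w)) \<partial>lborel) \<le> B" by blast
  show thesis
    by (rule that[of "enn2real B"]) (use B in \<open>auto simp: less_top\<close>)
qed

section \<open>The bilinear product and the Bargmann kernel\<close>

lemma norm_square_vec: "(norm (z :: complex ^ 'n::finite))\<^sup>2 = (\<Sum>j\<in>UNIV. (norm (z $ j))\<^sup>2)"
  by (simp add: norm_vec_def L2_set_def sum_nonneg)

lemma norm_bprod_le: "norm (x \<odot> y) \<le> norm x * norm (y :: complex ^ 'n::finite)"
proof -
  have "norm (x \<odot> y) \<le> (\<Sum>j\<in>UNIV. \<bar>norm (x $ j)\<bar> * \<bar>norm (y $ j)\<bar>)"
    unfolding bprod_def by (rule order.trans[OF norm_sum]) (simp add: norm_mult)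
  also have "\<dots> \<le> norm x * norm y"
    unfolding norm_vec_def by (rule L2_set_mult_ineq)
  finally show ?thesis .
qed

lemma bounded_bilinear_bprod: "bounded_bilinear (bprod :: complex ^ 'n::finite \<Rightarrow> _)"
  by (rule bounded_bilinear.intro)
    (auto simp: bprod_def sum.distrib[symmetric] algebra_simps scaleR_sum_right norm_bprod_le[unfolded bprod_def]
      intro!: exI[of _ 1])

interpretation bprod: bounded_bilinear "bprod :: complex ^ 'n::finite \<Rightarrow> _"
  by (rule bounded_bilinear_bprod)

lemmas [continuous_intros] = bprod.continuous_on
lemmas [derivative_intros] = bprod.FDERIV

lemma bprod_commute: "x \<odot> y = y \<odot> (x :: complex ^ 'n::finite)"
  by (simp add: bprod_def mult.commute)

lemma bprod_smult_left: "(c *s x) \<odot> y = c * (x \<odot> (y :: complex ^ 'n::finite))"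
  by (simp add: bprod_def sum_distrib_left mult_ac)

lemma bprod_smult_right: "x \<odot> (c *s y) = c * (x \<odot> (y :: complex ^ 'n::finite))"
  by (simp add: bprod_def sum_distrib_left mult_ac)

lemma bprod_axis: "x \<odot> axis j c = x $ j * c"
  by (simp add: bprod_def axis_def if_distrib[of "\<lambda>y. _ * y"] cong: if_cong)

lemma bounded_linear_vcnj: "bounded_linear (vcnj :: complex ^ 'n::finite \<Rightarrow> _)"
  by (rule bounded_linear_intro[where K=1])
    (auto simp: vcnj_def vec_eq_iff norm_vec_def)

lemma bounded_linear_vcomplex: "bounded_linear (vcomplex :: real ^ 'n::finite \<Rightarrow> _)"
  by (rule bounded_linear_intro[where K=1])
    (auto simp: vcomplex_def vec_eq_iff norm_vec_def scaleR_conv_of_real[where 'a=complex])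

lemmas [continuous_intros] = bounded_linear.continuous_on[OF bounded_linear_vcnj]
  bounded_linear.continuous_on[OF bounded_linear_vcomplex]
lemmas [derivative_intros] = bounded_linear.has_derivative[OF bounded_linear_vcnj]
  bounded_linear.has_derivative[OF bounded_linear_vcomplex]

lemma norm_vcomplex: "norm (vcomplex x) = norm (x :: real ^ 'n::finite)"
  by (simp add: vcomplex_def norm_vec_def)

lemma norm_vcnj: "norm (vcnj z) = norm (z :: complex ^ 'n::finite)"
  by (simp add: vcnj_def norm_vec_def)

lemma vcnj_nth [simp]: "vcnj z $ j = cnj (z $ j)"
  by (simp add: vcnj_def)

lemma vcomplex_nth [simp]: "vcomplex x $ j = of_real (x $ j)"
  by (simp add: vcomplex_def)

lemma Re_bprod_vcnj: "Re (z \<odot> vcnj w) = z \<bullet> (w :: complex ^ 'n::finite)"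
  by (simp add: bprod_def inner_vec_def inner_complex_def)

lemma bprod_vcnj_self: "z \<odot> vcnj z = of_real ((norm (z :: complex ^ 'n::finite))\<^sup>2)"
  unfolding norm_square_vec by (simp add: bprod_def complex_norm_square[symmetric] del: complex_norm_square)

lemma vcnj_vcnj [simp]: "vcnj (vcnj z) = z"
  by (simp add: vec_eq_iff)

text \<open>The Bargmann kernel without the normalising factor \<open>2 powr (n / 4)\<close>.\<close>

definition bkernel :: "complex ^ 'n::finite \<Rightarrow> real ^ 'n \<Rightarrow> complex"
  where "bkernel z x = exp (2 * of_real pi * (vcomplex x \<odot> z) - of_real (pi * (x \<bullet> x))
                - of_real pi * (z \<odot> z) / 2)"

lemma bargmann_eq: "bargmann f z = of_real (2 powr (real CARD('n) / 4)) * f (bkernel (z :: complex ^ 'n::finite))"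
  unfolding bargmann_def bkernel_def[abs_def] ..

lemma norm_bkernel_le:
  "norm (bkernel z x) \<le> exp (pi * (norm z)\<^sup>2 / 2) * exp (2 * pi * norm z * norm x - pi * (norm x)\<^sup>2)"
proof -
  have "norm (bkernel z x) = exp (2 * pi * Re (vcomplex x \<odot> z) - pi * (norm x)\<^sup>2 - pi * Re (z \<odot> z) / 2)"
    by (simp add: bkernel_def power2_norm_eq_inner)
  also have "\<dots> \<le> exp (2 * pi * (norm x * norm z) - pi * (norm x)\<^sup>2 + pi * (norm z * norm z) / 2)"
  proof -
    have 1: "Re (vcomplex x \<odot> z) \<le> norm x * norm z"
      using norm_bprod_le[of "vcomplex x" z] complex_Re_le_cmod[of "vcomplex x \<odot> z"] by (simp add: norm_vcomplex)
    have 2: "- Re (z \<odot> z) \<le> norm z * norm z"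
      using norm_bprod_le[of z z] abs_Re_le_cmod[of "z \<odot> z"] by linarith
    have "2 * pi * Re (vcomplex x \<odot> z) \<le> 2 * pi * (norm x * norm z)"
      by (rule mult_left_mono[OF 1]) simp
    moreover have "- (pi * Re (z \<odot> z)) \<le> pi * (norm z * norm z)"
      using mult_left_mono[OF 2, of pi] by simp
    ultimately show ?thesis unfolding exp_le_cancel_iff by linarith
  qed
  also have "\<dots> = exp (pi * (norm z)\<^sup>2 / 2) * exp (2 * pi * norm z * norm x - pi * (norm x)\<^sup>2)"
    by (simp add: exp_add[symmetric] power2_eq_square mult_ac add_ac)
  finally show ?thesis .
qed

lemma continuous_on_bkernel [continuous_intros]:
  "continuous_on S f \<Longrightarrow> continuous_on S g \<Longrightarrow> continuous_on S (\<lambda>y. bkernel (f y) (g y))"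
  unfolding bkernel_def by (intro continuous_intros) auto

lemma has_field_derivative_compose_FDERIV:
  fixes f :: "complex \<Rightarrow> complex"
  assumes "(f has_field_derivative d) (at (g x))" "(g has_derivative D) (at x)"
  shows "((\<lambda>x. f (g x)) has_derivative (\<lambda>h. D h * d)) (at x)"
  using has_derivative_compose[OF assms(2) assms(1)[unfolded has_field_derivative_def]]
  by (simp add: mult.commute)

lemma has_derivative_bkernel:
  "(bkernel z has_derivative (\<lambda>h. (2 * of_real pi * (vcomplex h \<odot> z) - of_real (2 * pi * (x \<bullet> h))) * bkernel z x)) (at x)"
proof -
  have "((\<lambda>x. 2 * of_real pi * (vcomplex x \<odot> z) - of_real (pi * (x \<bullet> x)) - of_real pi * (z \<odot> z) / 2)
      has_derivative (\<lambda>h. 2 * of_real pi * (vcomplex h \<odot> z) - of_real (2 * pi * (x \<bullet> h)))) (at x)"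
    by (rule has_derivative_eq_rhs, (rule derivative_intros)+)
      (simp add: fun_eq_iff bprod.zero_right inner_commute algebra_simps)
  from has_field_derivative_compose_FDERIV[OF DERIV_exp this] show ?thesis
    by (simp add: bkernel_def[abs_def])
qed

text \<open>Moving the parameter along a complex line multiplies the kernel by a scalar and by an
  exponential that is linear in \<open>\<zeta>\<close>, so holomorphy in \<open>\<zeta>\<close> reduces to the exponential series.\<close>

lemma bkernel_shift:
  "bkernel (z + \<zeta> *s v) x = exp (- of_real pi * (\<zeta> * (z \<odot> v) + \<zeta>\<^sup>2 * (v \<odot> v) / 2)) *
     (bkernel z x * exp (\<zeta> * (2 * of_real pi * (vcomplex x \<odot> v))))"
  unfolding bkernel_def exp_add[symmetric]
  by (rule arg_cong[where f=exp])
    (simp add: bprod.add_left bprod.add_right bprod_smult_left bprod_smult_right bprod_commute[of v z]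
      algebra_simps power2_eq_square add_divide_distrib)


section \<open>Schwartz functions\<close>

lemma partial_eqI: "(\<phi> has_derivative D) (at x) \<Longrightarrow> partial j \<phi> x = D (axis j 1)"
  unfolding partial_def by (simp add: frechet_derivative_at[symmetric])

lemma partial_add:
  assumes "\<phi> differentiable at x" "\<psi> differentiable at x"
  shows "partial j (\<lambda>x. \<phi> x + \<psi> x) x = partial j \<phi> x + partial j \<psi> x"
  using has_derivative_add[OF assms[unfolded frechet_derivative_works]]
  by (subst partial_eqI) (auto simp: partial_def)

lemma partial_mult:
  assumes "\<phi> differentiable at x" "\<psi> differentiable at x"
  shows "partial j (\<lambda>x. \<phi> x * \<psi> x) x = partial j \<phi> x * \<psi> x + \<phi> x * partial j \<psi> x"
  using has_derivative_mult[OF assms[unfolded frechet_derivative_works]]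
  by (subst partial_eqI) (auto simp: partial_def add.commute)

text \<open>A way to obtain seminorm bounds that are uniform in a parameter without computing iterated
  derivatives: it suffices to exhibit a set of families that contains the given one, is closed
  under partial derivatives, and consists of families with the required decay.\<close>

lemma schwartz_family:
  fixes A :: "('p \<Rightarrow> real ^ 'n::finite \<Rightarrow> complex) set"
  assumes diff: "\<And>\<phi> p x. \<phi> \<in> A \<Longrightarrow> \<phi> p differentiable at x"
    and closed: "\<And>\<phi> j. \<phi> \<in> A \<Longrightarrow> \<exists>\<phi>'\<in>A. \<forall>p. partial j (\<phi> p) = \<phi>' p"
    and bound: "\<And>\<phi> N. \<phi> \<in> A \<Longrightarrow> \<exists>C. \<forall>p\<in>P. \<forall>x. (1 + norm x) ^ N * norm (\<phi> p x) \<le> C * \<omega> p"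
    and \<phi>: "\<phi> \<in> A"
  shows "p \<in> P \<Longrightarrow> \<phi> p \<in> schwartz"
    and "\<exists>C. \<forall>p\<in>P. schwartz_seminorm N (\<phi> p) \<le> C * \<omega> p"
proof -
  have words: "\<exists>\<phi>'\<in>A. \<forall>p. partials js (\<phi> p) = \<phi>' p" for js
  proof (induction js)
    case Nil
    then show ?case using \<phi> by (auto simp: partials_def)
  next
    case (Cons j js)
    then obtain \<phi>' where "\<phi>' \<in> A" "\<And>p. partials js (\<phi> p) = \<phi>' p" by blast
    then show ?case using closed[of \<phi>' j] by (simp add: partials_def)
  qed
  have wbound: "\<exists>C. \<forall>p\<in>P. \<forall>x. (1 + norm x) ^ N * norm (partials js (\<phi> p) x) \<le> C * \<omega> p" for js N
  proof -
    obtain \<phi>' where "\<phi>' \<in> A" "\<And>p. partials js (\<phi> p) = \<phi>' p" using words by blast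
    then show ?thesis using bound[of \<phi>' N] by simp
  qed
  show "\<phi> p \<in> schwartz" if p: "p \<in> P" for p
    unfolding schwartz_def
  proof (intro CollectI conjI allI)
    fix js x
    show "partials js (\<phi> p) differentiable at x"
      using words[of js] diff by metis
    fix N
    obtain C where C: "\<And>x. (1 + norm x) ^ N * norm (partials js (\<phi> p) x) \<le> C"
      using wbound p by blast
    show "bounded (range (\<lambda>x. (1 + norm x) ^ N * norm (partials js (\<phi> p) x)))"
      unfolding bounded_iff using C by (intro exI[of _ C]) auto
  qed
  obtain C where C: "\<And>js p x. p \<in> P \<Longrightarrow> (1 + norm x) ^ N * norm (partials js (\<phi> p) x) \<le> C js * \<omega> p"
    using wbound[of N] by metis
  show "\<exists>C. \<forall>p\<in>P. schwartz_seminorm N (\<phi> p) \<le> C * \<omega> p"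
  proof (intro exI ballI)
    fix p assume "p \<in> P"
    then show "schwartz_seminorm N (\<phi> p) \<le> (\<Sum>js | length js \<le> N. C js) * \<omega> p"
      unfolding schwartz_seminorm_def sum_distrib_right
      by (intro sum_mono cSUP_least C) auto
  qed
qed

lemma schwartz_seminorm_bound:
  fixes \<phi> :: "real ^ 'n::finite \<Rightarrow> complex"
  assumes \<phi>: "\<phi> \<in> schwartz" and js: "length js \<le> N"
  shows "(1 + norm x) ^ N * norm (partials js \<phi> x) \<le> schwartz_seminorm N \<phi>"
proof -
  let ?f = "\<lambda>js x. (1 + norm x) ^ N * norm (partials js \<phi> x)"
  have bdd: "bdd_above (range (?f js))" for js
    using \<phi> unfolding schwartz_def by (auto intro: bounded_imp_bdd_above)
  have up: "?f js x \<le> (SUP x. ?f js x)" for js x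
    by (rule cSUP_upper[OF UNIV_I bdd])
  have "?f js x \<le> (SUP x. ?f js x)" by (rule up)
  also have "\<dots> \<le> schwartz_seminorm N \<phi>"
    unfolding schwartz_seminorm_def
  proof (rule member_le_sum)
    have "finite {xs :: 'n list. set xs \<subseteq> UNIV \<and> length xs \<le> N}"
      by (rule finite_lists_length_le) simp
    then show "finite {js :: 'n list. length js \<le> N}" by simp
    show "0 \<le> (SUP x. ?f js x)" for js
      by (rule order.trans[OF _ up[where js=js and x=0]]) simp
  qed (use js in simp)
  finally show ?thesis .
qed

lemma schwartz_seminorm_nonneg: "\<phi> \<in> schwartz \<Longrightarrow> 0 \<le> schwartz_seminorm N \<phi>"
  by (rule order.trans[OF _ schwartz_seminorm_bound[of \<phi> "[]" N 0]]) auto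

text \<open>Polynomial functions, as a set of functions on which one can induct.\<close>

inductive_set polyfun :: "(real ^ 'n::finite \<Rightarrow> complex) set" where
  const: "(\<lambda>x. c) \<in> polyfun"
| coord: "(\<lambda>x. of_real (x $ j)) \<in> polyfun"
| add: "p \<in> polyfun \<Longrightarrow> q \<in> polyfun \<Longrightarrow> (\<lambda>x. p x + q x) \<in> polyfun"
| mult: "p \<in> polyfun \<Longrightarrow> q \<in> polyfun \<Longrightarrow> (\<lambda>x. p x * q x) \<in> polyfun"

lemma polyfun_sum: "(\<And>i. i \<in> I \<Longrightarrow> p i \<in> polyfun) \<Longrightarrow> (\<lambda>x. \<Sum>i\<in>I. p i x) \<in> polyfun"
  by (induction I rule: infinite_finite_induct) (auto intro: polyfun.intros)

lemma polyfun_bprod: "(\<lambda>x. c * (vcomplex x \<odot> v)) \<in> polyfun"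
  unfolding bprod_def by (auto intro!: polyfun.intros polyfun_sum)

lemma polyfun_differentiable: "p \<in> polyfun \<Longrightarrow> p differentiable at x"
proof (induction rule: polyfun.induct)
  case (coord j)
  show ?case by (intro differentiableI) (rule derivative_intros bounded_linear.has_derivative[OF bounded_linear_vec_nth] has_derivative_ident)+
qed auto

lemma polyfun_partial: "p \<in> polyfun \<Longrightarrow> partial j p \<in> polyfun"
proof (induction rule: polyfun.induct)
  case (const c)
  have "partial j (\<lambda>x. c) = (\<lambda>x. 0)"
    by (rule ext) (simp add: partial_eqI[OF has_derivative_const])
  then show ?case by (simp add: polyfun.const)
next
  case (coord i)
  have "partial j (\<lambda>x. of_real (x $ i)) = (\<lambda>x. of_real ((axis j 1 :: real ^ 'a) $ i))"
    by (rule ext, rule partial_eqI,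
      (rule derivative_intros bounded_linear.has_derivative[OF bounded_linear_vec_nth] has_derivative_ident)+)
  then show ?case by (simp add: polyfun.const)
next
  case (add p q)
  have "partial j (\<lambda>x. p x + q x) = (\<lambda>x. partial j p x + partial j q x)"
    using add by (intro ext partial_add polyfun_differentiable)
  then show ?case using add by (simp add: polyfun.add)
next
  case (mult p q)
  have "partial j (\<lambda>x. p x * q x) = (\<lambda>x. partial j p x * q x + p x * partial j q x)"
    using mult by (intro ext partial_mult polyfun_differentiable)
  then show ?case using mult by (auto intro!: polyfun.intros)
qed

lemma polyfun_growth: "p \<in> polyfun \<Longrightarrow> \<exists>C N. 0 \<le> C \<and> (\<forall>x. norm (p x) \<le> C * (1 + norm x) ^ N)"
proof (induction rule: polyfun.induct)
  case (const c)
  show ?case by (intro exI[of _ "norm c"] exI[of _ 0]) simp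
next
  case (coord j)
  have "\<bar>x $ j\<bar> \<le> 1 + norm x" for x :: "real ^ 'a"
    using component_le_norm_cart[of x j] by simp
  then show ?case by (intro exI[of _ 1] exI[of _ 1]) simp
next
  case (add p q)
  then obtain C N D M where C: "0 \<le> C" "\<And>x. norm (p x) \<le> C * (1 + norm x) ^ N"
    and D: "0 \<le> D" "\<And>x. norm (q x) \<le> D * (1 + norm x) ^ M" by blast
  have "norm (p x + q x) \<le> (C + D) * (1 + norm x) ^ (N + M)" for x
  proof -
    have "C * (1 + norm x) ^ N \<le> C * (1 + norm x) ^ (N + M)" "D * (1 + norm x) ^ M \<le> D * (1 + norm x) ^ (N + M)"
      using C D by (auto intro!: mult_left_mono power_increasing)
    then show ?thesis
      using norm_triangle_ineq[of "p x" "q x"] C(2)[of x] D(2)[of x] by (simp add: distrib_right)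
  qed
  then show ?case using C(1) D(1) by (intro exI[of _ "C + D"] exI[of _ "N + M"]) simp
next
  case (mult p q)
  then obtain C N D M where C: "0 \<le> C" "\<And>x. norm (p x) \<le> C * (1 + norm x) ^ N"
    and D: "0 \<le> D" "\<And>x. norm (q x) \<le> D * (1 + norm x) ^ M" by blast
  have "norm (p x * q x) \<le> (C * D) * (1 + norm x) ^ (N + M)" for x
  proof -
    have "norm (p x) * norm (q x) \<le> (C * (1 + norm x) ^ N) * (D * (1 + norm x) ^ M)"
      using C D by (intro mult_mono) auto
    then show ?thesis by (simp add: norm_mult power_add mult_ac)
  qed
  then show ?case using C(1) D(1) by (intro exI[of _ "C * D"] exI[of _ "N + M"]) simp
qed

text \<open>The remainders of the exponential series of orders two and one, continued by the
  exponential itself: each function of the sequence is the derivative of its predecessor.\<close>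

definition exp_rem :: "nat \<Rightarrow> complex \<Rightarrow> complex"
  where "exp_rem i y = exp y - (if i = 0 then 1 + y else if i = 1 then 1 else 0)"

lemma has_field_derivative_exp_rem: "(exp_rem i has_field_derivative exp_rem (Suc i) y) (at y)"
  unfolding exp_rem_def[abs_def] by (cases i) (auto intro!: derivative_eq_intros)

lemma norm_exp_rem_le:
  assumes \<zeta>: "norm \<zeta> \<le> 1"
  shows "norm (\<zeta> ^ i * exp_rem i (\<zeta> * s)) \<le> (norm \<zeta>)\<^sup>2 * exp (3 * norm s)"
proof -
  have y: "norm (\<zeta> * s) \<le> norm s"
    using mult_right_mono[OF \<zeta>, of "norm s"] by (simp add: norm_mult)
  then have re: "exp \<bar>Re (\<zeta> * s)\<bar> \<le> exp (norm s)"
    using abs_Re_le_cmod[of "\<zeta> * s"] by simp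
  have s: "norm s \<le> exp (norm s)" using exp_ge_add_one_self[of "norm s"] by linarith
  have s2: "(norm s)\<^sup>2 \<le> exp (norm s) * exp (norm s)"
    unfolding power2_eq_square using s by (intro mult_mono) auto
  have e3: "exp (3 * norm s) = exp (norm s) * exp (norm s) * exp (norm s)"
    unfolding exp_add[symmetric] by simp
  have e1: "1 \<le> exp (norm s)" by simp
  consider "i = 0" | "i = 1" | "2 \<le> i" by linarith
  then show ?thesis
  proof cases
    case 1
    have "norm (exp (\<zeta> * s) - (1 + \<zeta> * s)) \<le> exp \<bar>Re (\<zeta> * s)\<bar> * norm (\<zeta> * s) ^ 2"
      using Taylor_exp[of "\<zeta> * s" 1] by (simp add: numeral_2_eq_2)
    also have "\<dots> \<le> exp (norm s) * ((norm \<zeta>)\<^sup>2 * (norm s)\<^sup>2)"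
      unfolding norm_mult power_mult_distrib by (rule mult_right_mono[OF re]) simp
    also have "\<dots> \<le> exp (norm s) * ((norm \<zeta>)\<^sup>2 * (exp (norm s) * exp (norm s)))"
      by (intro mult_left_mono s2) auto
    finally show ?thesis unfolding e3 using 1 by (simp add: exp_rem_def mult_ac)
  next
    case 2
    have "norm (exp (\<zeta> * s) - 1) \<le> exp \<bar>Re (\<zeta> * s)\<bar> * norm (\<zeta> * s)"
      using Taylor_exp[of "\<zeta> * s" 0] by simp
    also have "\<dots> \<le> exp (norm s) * (norm \<zeta> * exp (norm s))"
      unfolding norm_mult using re s by (intro mult_mono) auto
    finally have "norm \<zeta> * norm (exp (\<zeta> * s) - 1) \<le> norm \<zeta> * (exp (norm s) * (norm \<zeta> * exp (norm s)))"
      by (rule mult_left_mono) simp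
    also have "\<dots> = (norm \<zeta>)\<^sup>2 * (exp (norm s) * exp (norm s)) * 1"
      by (simp add: power2_eq_square mult_ac)
    also have "\<dots> \<le> (norm \<zeta>)\<^sup>2 * (exp (norm s) * exp (norm s)) * exp (norm s)"
      by (rule mult_left_mono[OF e1]) simp
    finally show ?thesis unfolding e3 using 2 by (simp add: exp_rem_def norm_mult mult_ac)
  next
    case 3
    have "norm (\<zeta> ^ i * exp (\<zeta> * s)) \<le> (norm \<zeta>)\<^sup>2 * exp (norm s)"
      unfolding norm_mult norm_power
    proof (rule mult_mono)
      show "norm \<zeta> ^ i \<le> (norm \<zeta>)\<^sup>2" using 3 \<zeta> by (intro power_decreasing) auto
      show "norm (exp (\<zeta> * s)) \<le> exp (norm s)"
        using y complex_Re_le_cmod[of "\<zeta> * s"] by simp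
    qed auto
    also have "\<dots> \<le> (norm \<zeta>)\<^sup>2 * exp (3 * norm s)" by (intro mult_left_mono) auto
    finally show ?thesis using 3 by (simp add: exp_rem_def)
  qed
qed

text \<open>Families of test functions of size \<open>norm \<zeta> ^ 2\<close>, closed under partial derivatives: each
  derivative of the remainder factor lowers its order by one but contributes a factor \<open>\<zeta>\<close>.\<close>

inductive_set kernel_family :: "complex ^ 'n::finite \<Rightarrow> complex ^ 'n \<Rightarrow> (complex \<Rightarrow> real ^ 'n \<Rightarrow> complex) set"
  for z v where
  basic: "p \<in> polyfun \<Longrightarrow>
    (\<lambda>\<zeta> x. p x * (\<zeta> ^ i * exp_rem i (\<zeta> * (2 * of_real pi * (vcomplex x \<odot> v)))) * bkernel z x) \<in> kernel_family z v"
| add: "\<phi> \<in> kernel_family z v \<Longrightarrow> \<psi> \<in> kernel_family z v \<Longrightarrow> (\<lambda>\<zeta> x. \<phi> \<zeta> x + \<psi> \<zeta> x) \<in> kernel_family z v"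

lemma has_derivative_kernel_factor:
  "((\<lambda>x. \<zeta> ^ i * exp_rem i (\<zeta> * (2 * of_real pi * (vcomplex x \<odot> v)))) has_derivative
    (\<lambda>h. 2 * of_real pi * (vcomplex h \<odot> v) * (\<zeta> ^ Suc i * exp_rem (Suc i) (\<zeta> * (2 * of_real pi * (vcomplex x \<odot> v)))))) (at x)"
proof -
  have "((\<lambda>x. \<zeta> * (2 * of_real pi * (vcomplex x \<odot> v))) has_derivative
      (\<lambda>h. \<zeta> * (2 * of_real pi * (vcomplex h \<odot> v)))) (at x)"
    by (rule has_derivative_eq_rhs, (rule derivative_intros)+) (simp add: fun_eq_iff bprod.zero_right)
  from has_derivative_mult_right[OF has_field_derivative_compose_FDERIV[OF has_field_derivative_exp_rem this], of "\<zeta> ^ i"]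
  show ?thesis by (rule has_derivative_eq_rhs) (simp add: fun_eq_iff mult_ac)
qed

lemma kernel_family_differentiable: "\<phi> \<in> kernel_family z v \<Longrightarrow> \<phi> \<zeta> differentiable at x"
proof (induction rule: kernel_family.induct)
  case (basic p i)
  show ?case
    by (intro differentiable_mult polyfun_differentiable basic differentiableI[OF has_derivative_kernel_factor]
        differentiableI[OF has_derivative_bkernel])
qed auto

lemma kernel_family_partial: "\<phi> \<in> kernel_family z v \<Longrightarrow> \<exists>\<phi>'\<in>kernel_family z v. \<forall>\<zeta>. partial j (\<phi> \<zeta>) = \<phi>' \<zeta>"
proof (induction rule: kernel_family.induct)
  case (basic p i)
  define r where "r i \<zeta> x = \<zeta> ^ i * exp_rem i (\<zeta> * (2 * of_real pi * (vcomplex x \<odot> v)))" for i \<zeta> x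
  define q where "q x = 2 * of_real pi * (vcomplex (axis j 1) \<odot> z) + of_real (- 2 * pi) * of_real (x $ j)" for x
  define \<phi>' where "\<phi>' \<zeta> x = partial j p x * r i \<zeta> x * bkernel z x
      + (p x * (2 * of_real pi * (vcomplex (axis j 1) \<odot> v)) * r (Suc i) \<zeta> x * bkernel z x
      + p x * q x * r i \<zeta> x * bkernel z x)" for \<zeta> x
  have q: "q \<in> polyfun" unfolding q_def[abs_def] by (intro polyfun.intros)
  have "\<phi>' \<in> kernel_family z v"
    unfolding \<phi>'_def[abs_def] r_def
    by (intro kernel_family.intros polyfun.mult polyfun.const polyfun_partial basic q)
  moreover have "partial j (\<lambda>x. p x * r i \<zeta> x * bkernel z x) x = \<phi>' \<zeta> x" for \<zeta> x
  proof -
    have dr: "r i \<zeta> differentiable at x" for x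
      unfolding r_def[abs_def] by (rule differentiableI[OF has_derivative_kernel_factor])
    have db: "bkernel z differentiable at x" for x
      by (rule differentiableI[OF has_derivative_bkernel])
    have pr: "partial j (r i \<zeta>) x = 2 * of_real pi * (vcomplex (axis j 1) \<odot> v) * r (Suc i) \<zeta> x"
      unfolding r_def[abs_def] by (rule partial_eqI[OF has_derivative_kernel_factor])
    have pb: "partial j (bkernel z) x = q x * bkernel z x"
      by (subst partial_eqI[OF has_derivative_bkernel]) (simp add: q_def inner_axis)
    have dp: "p differentiable at x" by (rule polyfun_differentiable[OF basic])
    have "partial j (\<lambda>x. p x * r i \<zeta> x * bkernel z x) x
        = partial j (\<lambda>x. p x * r i \<zeta> x) x * bkernel z x + p x * r i \<zeta> x * partial j (bkernel z) x"
      by (rule partial_mult[OF differentiable_mult[OF dp dr] db])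
    also have "partial j (\<lambda>x. p x * r i \<zeta> x) x = partial j p x * r i \<zeta> x + p x * partial j (r i \<zeta>) x"
      by (rule partial_mult[OF dp dr])
    finally show ?thesis
      unfolding \<phi>'_def pr pb by (simp add: algebra_simps)
  qed
  then have "partial j (\<lambda>x. p x * r i \<zeta> x * bkernel z x) = \<phi>' \<zeta>" for \<zeta> by (rule ext)
  ultimately show ?case unfolding r_def by blast
next
  case (add \<phi> \<psi>)
  then obtain \<phi>' \<psi>' where *: "\<phi>' \<in> kernel_family z v" "\<And>\<zeta>. partial j (\<phi> \<zeta>) = \<phi>' \<zeta>"
    "\<psi>' \<in> kernel_family z v" "\<And>\<zeta>. partial j (\<psi> \<zeta>) = \<psi>' \<zeta>" by blast
  have "partial j (\<lambda>x. \<phi> \<zeta> x + \<psi> \<zeta> x) = (\<lambda>x. \<phi>' \<zeta> x + \<psi>' \<zeta> x)" for \<zeta>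
    using add * by (intro ext) (simp add: partial_add kernel_family_differentiable)
  then show ?case by (intro bexI[OF _ kernel_family.add[OF *(1,3)]] allI)
qed

lemma kernel_family_bound:
  "\<phi> \<in> kernel_family z v \<Longrightarrow> \<exists>C. \<forall>\<zeta>\<in>cball 0 1. \<forall>x. (1 + norm x) ^ N * norm (\<phi> \<zeta> x) \<le> C * (norm \<zeta>)\<^sup>2"
proof (induction rule: kernel_family.induct)
  case (basic p i)
  obtain D M where D: "0 \<le> D" "\<And>x. norm (p x) \<le> D * (1 + norm x) ^ M"
    using polyfun_growth[OF basic] by blast
  define b where "b = 6 * pi * norm v + 2 * pi * norm z"
  obtain E where E: "0 < E" "\<And>r. 0 \<le> r \<Longrightarrow> (1 + r) ^ (N + M) * exp (b * r - pi * r\<^sup>2) \<le> E"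
    using poly_times_gauss_bounded[OF pi_gt_zero] by blast
  show ?case
  proof (intro exI ballI allI)
    fix \<zeta> :: complex and x assume \<zeta>: "\<zeta> \<in> cball 0 1"
    let ?s = "2 * of_real pi * (vcomplex x \<odot> v)"
    have s: "norm ?s \<le> 2 * pi * (norm x * norm v)"
      using norm_bprod_le[of "vcomplex x" v] by (simp add: norm_mult norm_vcomplex)
    have "norm (\<zeta> ^ i * exp_rem i (\<zeta> * ?s)) \<le> (norm \<zeta>)\<^sup>2 * exp (3 * norm ?s)"
      using \<zeta> by (intro norm_exp_rem_le) simp
    also have "\<dots> \<le> (norm \<zeta>)\<^sup>2 * exp (6 * pi * norm v * norm x)"
      using s by (intro mult_left_mono) (auto simp: mult_ac)
    finally have r: "norm (\<zeta> ^ i * exp_rem i (\<zeta> * ?s)) \<le> (norm \<zeta>)\<^sup>2 * exp (6 * pi * norm v * norm x)" .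
    have "(1 + norm x) ^ N * norm (p x * (\<zeta> ^ i * exp_rem i (\<zeta> * ?s)) * bkernel z x)
        = (1 + norm x) ^ N * (norm (p x) * norm (\<zeta> ^ i * exp_rem i (\<zeta> * ?s)) * norm (bkernel z x))"
      by (simp add: norm_mult)
    also have "\<dots> \<le> (1 + norm x) ^ N * ((D * (1 + norm x) ^ M) * ((norm \<zeta>)\<^sup>2 * exp (6 * pi * norm v * norm x))
        * (exp (pi * (norm z)\<^sup>2 / 2) * exp (2 * pi * norm z * norm x - pi * (norm x)\<^sup>2)))"
      by (intro mult_left_mono mult_mono D r norm_bkernel_le) (use D(1) in auto)
    also have "\<dots> = (D * exp (pi * (norm z)\<^sup>2 / 2) * (norm \<zeta>)\<^sup>2) *
        ((1 + norm x) ^ (N + M) * (exp (6 * pi * norm v * norm x) * exp (2 * pi * norm z * norm x - pi * (norm x)\<^sup>2)))"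
      by (simp add: power_add mult_ac)
    also have "exp (6 * pi * norm v * norm x) * exp (2 * pi * norm z * norm x - pi * (norm x)\<^sup>2)
        = exp (b * norm x - pi * (norm x)\<^sup>2)"
      unfolding exp_add[symmetric] b_def by (simp add: algebra_simps)
    also have "(D * exp (pi * (norm z)\<^sup>2 / 2) * (norm \<zeta>)\<^sup>2) * ((1 + norm x) ^ (N + M) * \<dots>)
        \<le> (D * exp (pi * (norm z)\<^sup>2 / 2) * (norm \<zeta>)\<^sup>2) * E"
      using E D(1) by (intro mult_left_mono) auto
    finally show "(1 + norm x) ^ N * norm (p x * (\<zeta> ^ i * exp_rem i (\<zeta> * ?s)) * bkernel z x)
        \<le> (D * exp (pi * (norm z)\<^sup>2 / 2) * E) * (norm \<zeta>)\<^sup>2" by (simp add: mult_ac)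
  qed
next
  case (add \<phi> \<psi>)
  then obtain C D where *: "\<And>\<zeta> x. \<zeta> \<in> cball 0 1 \<Longrightarrow> (1 + norm x) ^ N * norm (\<phi> \<zeta> x) \<le> C * (norm \<zeta>)\<^sup>2"
    "\<And>\<zeta> x. \<zeta> \<in> cball 0 1 \<Longrightarrow> (1 + norm x) ^ N * norm (\<psi> \<zeta> x) \<le> D * (norm \<zeta>)\<^sup>2" by blast
  show ?case
  proof (intro exI[of _ "C + D"] ballI allI)
    fix \<zeta> :: complex and x assume \<zeta>: "\<zeta> \<in> cball 0 1"
    have "(1 + norm x) ^ N * norm (\<phi> \<zeta> x + \<psi> \<zeta> x) \<le> (1 + norm x) ^ N * (norm (\<phi> \<zeta> x) + norm (\<psi> \<zeta> x))"
      by (intro mult_left_mono norm_triangle_ineq) auto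
    then show "(1 + norm x) ^ N * norm (\<phi> \<zeta> x + \<psi> \<zeta> x) \<le> (C + D) * (norm \<zeta>)\<^sup>2"
      using *[OF \<zeta>, of x] by (simp add: distrib_left distrib_right)
  qed
qed

lemma kernel_family_schwartz:
  assumes \<phi>: "\<phi> \<in> kernel_family z v"
  shows "norm \<zeta> \<le> 1 \<Longrightarrow> \<phi> \<zeta> \<in> schwartz"
    and "\<exists>C. \<forall>\<zeta>\<in>cball 0 1. schwartz_seminorm N (\<phi> \<zeta>) \<le> C * (norm \<zeta>)\<^sup>2"
proof -
  note family = kernel_family_differentiable kernel_family_partial kernel_family_bound
  show "\<phi> \<zeta> \<in> schwartz" if "norm \<zeta> \<le> 1"
    by (rule schwartz_family(1)[where A="kernel_family z v" and P="cball 0 1" and \<omega>="\<lambda>\<zeta>. (norm \<zeta>)\<^sup>2"])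
      (use \<phi> that family in auto)
  show "\<exists>C. \<forall>\<zeta>\<in>cball 0 1. schwartz_seminorm N (\<phi> \<zeta>) \<le> C * (norm \<zeta>)\<^sup>2"
    by (rule schwartz_family(2)[where A="kernel_family z v"])
      (use \<phi> family in auto)
qed

lemma polyfun_bkernel_schwartz:
  assumes "p \<in> polyfun"
  shows "(\<lambda>x. p x * bkernel z x) \<in> schwartz"
  using kernel_family_schwartz(1)[OF kernel_family.basic[OF assms, of 2 0 z], of 1]
  by (simp add: exp_rem_def bprod.zero_right)

lemma bkernel_schwartz: "(\<lambda>x. c * bkernel z x) \<in> schwartz"
  by (rule polyfun_bkernel_schwartz) (rule polyfun.const)

lemma tempered_add: "f \<in> tempered \<Longrightarrow> \<phi> \<in> schwartz \<Longrightarrow> \<psi> \<in> schwartz \<Longrightarrow> f (\<lambda>t. \<phi> t + \<psi> t) = f \<phi> + f \<psi>"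
  by (simp add: tempered_def)

lemma tempered_mult: "f \<in> tempered \<Longrightarrow> \<phi> \<in> schwartz \<Longrightarrow> f (\<lambda>t. c * \<phi> t) = c * f \<phi>"
  by (simp add: tempered_def)


section \<open>Bargmann transforms are entire along complex lines\<close>

text \<open>Entire functions of several variables enter only through their restrictions to complex
  lines, so that one-variable complex analysis suffices.\<close>

definition slice_entire :: "(complex ^ 'n::finite \<Rightarrow> complex) \<Rightarrow> bool"
  where "slice_entire F \<longleftrightarrow> (\<forall>z v. (\<lambda>\<zeta>. F (z + \<zeta> *s v)) holomorphic_on UNIV)"

lemma slice_entireI:
  assumes "\<And>z v. (\<lambda>\<zeta>. F (z + \<zeta> *s v)) field_differentiable at 0"
  shows "slice_entire F"
  unfolding slice_entire_def holomorphic_on_def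
proof (intro allI ballI)
  fix z v and \<zeta> :: complex
  have "(\<lambda>\<eta>. F ((z + \<zeta> *s v) + \<eta> *s v)) field_differentiable at (\<zeta> - \<zeta>)"
    using assms by simp
  then have "(\<lambda>\<eta>. F ((z + \<zeta> *s v) + \<eta> *s v)) \<circ> (\<lambda>\<eta>. \<eta> - \<zeta>) field_differentiable at \<zeta>"
    by (intro field_differentiable_compose derivative_intros) auto
  moreover have "(\<lambda>\<eta>. F ((z + \<zeta> *s v) + \<eta> *s v)) \<circ> (\<lambda>\<eta>. \<eta> - \<zeta>) = (\<lambda>\<eta>. F (z + \<eta> *s v))"
    by (simp add: fun_eq_iff vec.scale_left_diff_distrib)
  ultimately show "(\<lambda>\<eta>. F (z + \<eta> *s v)) field_differentiable at \<zeta> within UNIV" by simp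
qed

text \<open>The second-order remainder \<open>R\<close> of the exponential series, times the kernel, lies in
  \<open>kernel_family\<close>; hence every Schwartz seminorm of it, and with it \<open>f (R \<zeta>)\<close>, is of the order
  of \<open>norm \<zeta> ^ 2\<close>.\<close>

lemma tempered_exp_field_differentiable:
  fixes v z :: "complex ^ 'n::finite"
  assumes f: "f \<in> tempered"
  defines "s \<equiv> \<lambda>x. 2 * of_real pi * (vcomplex x \<odot> v)"
  shows "(\<lambda>\<zeta>. f (\<lambda>x. bkernel z x * exp (\<zeta> * s x))) field_differentiable at 0"
proof -
  define R where "R \<zeta> x = 1 * (\<zeta> ^ 0 * exp_rem 0 (\<zeta> * s x)) * bkernel z x" for \<zeta> x
  have Rf: "R \<in> kernel_family z v"
    unfolding R_def[abs_def] s_def by (rule kernel_family.basic) (rule polyfun.const)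
  obtain C N where f_le: "\<And>\<phi>. \<phi> \<in> schwartz \<Longrightarrow> norm (f \<phi>) \<le> C * schwartz_seminorm N \<phi>"
    using f unfolding tempered_def by blast
  obtain D where D: "\<And>\<zeta>. \<zeta> \<in> cball 0 1 \<Longrightarrow> schwartz_seminorm N (R \<zeta>) \<le> D * (norm \<zeta>)\<^sup>2"
    using kernel_family_schwartz(2)[OF Rf] by blast
  have RS: "R \<zeta> \<in> schwartz" if "norm \<zeta> \<le> 1" for \<zeta>
    by (rule kernel_family_schwartz(1)[OF Rf that])
  have fR: "norm (f (R \<zeta>)) \<le> \<bar>C\<bar> * D * (norm \<zeta>)\<^sup>2" if \<zeta>: "norm \<zeta> \<le> 1" for \<zeta>
  proof -
    have "norm (f (R \<zeta>)) \<le> C * schwartz_seminorm N (R \<zeta>)" by (rule f_le[OF RS[OF \<zeta>]])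
    also have "\<dots> \<le> \<bar>C\<bar> * schwartz_seminorm N (R \<zeta>)"
      using schwartz_seminorm_nonneg[OF RS[OF \<zeta>]] by (intro mult_right_mono) auto
    also have "\<dots> \<le> \<bar>C\<bar> * (D * (norm \<zeta>)\<^sup>2)" using \<zeta> by (intro mult_left_mono D) auto
    finally show ?thesis by (simp add: mult.assoc)
  qed
  have sp: "s \<in> polyfun" unfolding s_def by (rule polyfun_bprod)
  have K: "bkernel z \<in> schwartz" using bkernel_schwartz[of 1 z] by simp
  have sK: "(\<lambda>x. s x * bkernel z x) \<in> schwartz" by (rule polyfun_bkernel_schwartz[OF sp])
  have \<zeta>sK: "(\<lambda>x. \<zeta> * (s x * bkernel z x)) \<in> schwartz" for \<zeta>
    using polyfun_bkernel_schwartz[OF polyfun.mult[OF polyfun.const sp], of \<zeta> z] by (simp add: mult.assoc)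
  have lin: "(\<lambda>x. bkernel z x + \<zeta> * (s x * bkernel z x)) \<in> schwartz" for \<zeta>
    using polyfun_bkernel_schwartz[OF polyfun.add[OF polyfun.const polyfun.mult[OF polyfun.const sp]], of 1 \<zeta> z]
    by (simp add: algebra_simps)
  have expand: "f (\<lambda>x. bkernel z x * exp (\<zeta> * s x)) = f (R \<zeta>) + f (bkernel z) + \<zeta> * f (\<lambda>x. s x * bkernel z x)"
    if \<zeta>: "norm \<zeta> \<le> 1" for \<zeta>
  proof -
    have "(\<lambda>x. bkernel z x * exp (\<zeta> * s x)) = (\<lambda>x. R \<zeta> x + (bkernel z x + \<zeta> * (s x * bkernel z x)))"
      by (simp add: fun_eq_iff R_def exp_rem_def algebra_simps)
    then show ?thesis
      using tempered_add[OF f RS[OF \<zeta>] lin] tempered_add[OF f K \<zeta>sK] tempered_mult[OF f sK] by simp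
  qed
  have 0: "f (\<lambda>x. bkernel z x * exp (0 * s x)) = f (bkernel z)" by simp
  have "((\<lambda>\<zeta>. (f (\<lambda>x. bkernel z x * exp (\<zeta> * s x)) - f (\<lambda>x. bkernel z x * exp (0 * s x))) / (\<zeta> - 0))
      \<longlongrightarrow> f (\<lambda>x. s x * bkernel z x)) (at 0)"
  proof (rule LIM_zero_cancel, rule Lim_null_comparison)
    show "((\<lambda>\<zeta>. \<bar>C\<bar> * D * norm (\<zeta> :: complex)) \<longlongrightarrow> 0) (at 0)"
      by (rule tendsto_eq_intros refl | simp)+
    have "\<forall>\<^sub>F \<zeta> in at (0 :: complex). \<zeta> \<in> ball 0 1 - {0}"
      by (rule eventually_at_in_open) auto
    then show "\<forall>\<^sub>F \<zeta> in at 0. norm ((f (\<lambda>x. bkernel z x * exp (\<zeta> * s x)) - f (\<lambda>x. bkernel z x * exp (0 * s x))) / (\<zeta> - 0)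
        - f (\<lambda>x. s x * bkernel z x)) \<le> \<bar>C\<bar> * D * norm \<zeta>"
    proof eventually_elim
      fix \<zeta> :: complex assume "\<zeta> \<in> ball 0 1 - {0}"
      then have \<zeta>: "norm \<zeta> \<le> 1" "\<zeta> \<noteq> 0" by auto
      have "(f (\<lambda>x. bkernel z x * exp (\<zeta> * s x)) - f (\<lambda>x. bkernel z x * exp (0 * s x))) / (\<zeta> - 0)
        - f (\<lambda>x. s x * bkernel z x) = f (R \<zeta>) / \<zeta>"
        unfolding 0 expand[OF \<zeta>(1)] using \<zeta>(2) by (simp add: field_simps)
      moreover have "norm (f (R \<zeta>) / \<zeta>) \<le> \<bar>C\<bar> * D * norm \<zeta>"
        using fR[OF \<zeta>(1)] \<zeta>(2) by (simp add: norm_divide pos_divide_le_eq power2_eq_square mult_ac)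
      ultimately show "norm ((f (\<lambda>x. bkernel z x * exp (\<zeta> * s x)) - f (\<lambda>x. bkernel z x * exp (0 * s x))) / (\<zeta> - 0)
        - f (\<lambda>x. s x * bkernel z x)) \<le> \<bar>C\<bar> * D * norm \<zeta>" by simp
    qed
  qed
  then show ?thesis
    unfolding field_differentiable_def has_field_derivative_iff by blast
qed

lemma slice_entire_bargmann:
  fixes f :: "(real ^ 'n::finite \<Rightarrow> complex) \<Rightarrow> complex"
  assumes f: "f \<in> tempered"
  shows "slice_entire (bargmann f)"
proof (rule slice_entireI)
  fix z v :: "complex ^ 'n"
  define s where "s = (\<lambda>x. 2 * of_real pi * (vcomplex x \<odot> v))"
  define e where "e \<zeta> = exp (- of_real pi * (\<zeta> * (z \<odot> v) + \<zeta>\<^sup>2 * (v \<odot> v) / 2))" for \<zeta>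
  have S: "(\<lambda>x. bkernel z x * exp (\<zeta> * s x)) \<in> schwartz" for \<zeta>
  proof -
    have "(\<lambda>x. inverse (e \<zeta>) * bkernel (z + \<zeta> *s v) x) = (\<lambda>x. bkernel z x * exp (\<zeta> * s x))"
      unfolding bkernel_shift e_def s_def by (simp add: fun_eq_iff)
    then show ?thesis using bkernel_schwartz by metis
  qed
  have "bargmann f (z + \<zeta> *s v) = of_real (2 powr (real CARD('n) / 4)) * (e \<zeta> * f (\<lambda>x. bkernel z x * exp (\<zeta> * s x)))" for \<zeta>
  proof -
    have "bkernel (z + \<zeta> *s v) = (\<lambda>x. e \<zeta> * (bkernel z x * exp (\<zeta> * s x)))"
      unfolding e_def s_def by (rule ext) (rule bkernel_shift)
    then show ?thesis unfolding bargmann_eq using tempered_mult[OF f S] by simp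
  qed
  moreover have "(\<lambda>\<zeta>. of_real (2 powr (real CARD('n) / 4)) * (e \<zeta> * f (\<lambda>x. bkernel z x * exp (\<zeta> * s x)))) field_differentiable at 0"
    unfolding e_def s_def
    by (intro field_differentiable_mult tempered_exp_field_differentiable f field_differentiable_const
        holomorphic_on_imp_differentiable_at[of _ UNIV] holomorphic_intros) auto
  ultimately show "(\<lambda>\<zeta>. bargmann f (z + \<zeta> *s v)) field_differentiable at 0" by simp
qed

section \<open>Mean values and the reproducing formula\<close>

lemma norm_smult_vec: "norm (c *s x) = norm c * norm (x :: complex ^ 'n::finite)"
proof -
  have "norm (c *s x) = sqrt ((norm c)\<^sup>2 * (\<Sum>j\<in>UNIV. (norm (x $ j))\<^sup>2))"
    by (simp add: norm_vec_def L2_set_def norm_mult power_mult_distrib sum_distrib_left)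
  also have "\<dots> = norm c * norm x"
    by (simp add: real_sqrt_mult norm_vec_def L2_set_def)
  finally show ?thesis .
qed

lemma continuous_on_smult_vec [continuous_intros]:
  fixes g :: "_ \<Rightarrow> complex ^ 'n::finite"
  assumes "continuous_on S f" "continuous_on S g"
  shows "continuous_on S (\<lambda>x. f x *s g x)"
  unfolding vector_scalar_mult_def by (intro continuous_intros assms)

lemma linear_smult_vec: "linear (\<lambda>x :: complex ^ 'n::finite. c *s x)"
  by (rule linearI) (simp_all add: vec_eq_iff algebra_simps)

lemma distr_lborel_rotation:
  assumes "norm c = 1"
  shows "distr lborel borel (\<lambda>x :: complex ^ 'n::finite. c *s x) = lborel"
proof (rule distr_lborel_isometry)
  show "linear (\<lambda>x :: complex ^ 'n. c *s x)" by (rule linear_smult_vec)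
  show "norm (c *s x) = norm x" for x :: "complex ^ 'n" using assms by (simp add: norm_smult_vec)
  show "surj (\<lambda>x :: complex ^ 'n. c *s x)"
  proof (rule surjI)
    have "c \<noteq> 0" using assms by auto
    then show "c *s (inverse c *s x) = x" for x :: "complex ^ 'n" by (simp add: vec_eq_iff)
  qed
qed

lemma mean_value_circle:
  assumes "h holomorphic_on UNIV"
  shows "(LINT t:{0..1}|lborel. h (exp (2 * of_real pi * \<i> * of_real t))) = h 0"
proof -
  let ?e = "\<lambda>t::real. exp (2 * of_real pi * \<i> * of_real t)"
  have "((\<lambda>u. h u / (u - 0)) has_contour_integral (2 * of_real pi * \<i> * h 0)) (circlepath 0 1)"
    by (rule Cauchy_integral_circlepath_simple) (use assms in \<open>auto intro: holomorphic_on_subset\<close>)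
  then have "((\<lambda>t. h (circlepath 0 1 t) / (circlepath 0 1 t - 0) * vector_derivative (circlepath 0 1) (at t within {0..1}))
      has_integral (2 * of_real pi * \<i> * h 0)) {0..1}"
    by (simp add: has_contour_integral_def)
  then have "((\<lambda>t. 2 * of_real pi * \<i> * h (?e t)) has_integral (2 * of_real pi * \<i> * h 0)) {0..1}"
  proof (rule has_integral_eq[rotated])
    fix t :: real assume t: "t \<in> {0..1}"
    have "circlepath 0 1 t = ?e t" by (simp add: circlepath)
    moreover have "vector_derivative (circlepath 0 1) (at t within {0..1}) = 2 * of_real pi * \<i> * ?e t"
      using t by (subst vector_derivative_circlepath01) auto
    ultimately show "h (circlepath 0 1 t) / (circlepath 0 1 t - 0) * vector_derivative (circlepath 0 1) (at t within {0..1})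
        = 2 * of_real pi * \<i> * h (?e t)"
      by simp
  qed
  then have "((\<lambda>t. inverse (2 * of_real pi * \<i>) * (2 * of_real pi * \<i> * h (?e t)))
      has_integral inverse (2 * of_real pi * \<i>) * (2 * of_real pi * \<i> * h 0)) {0..1}"
    by (rule has_integral_mult_right)
  moreover have "inverse (2 * of_real pi * \<i>) * (2 * of_real pi * \<i> * y) = y" for y
    by (simp add: field_simps)
  ultimately have I: "((\<lambda>t. h (?e t)) has_integral h 0) {0..1}"
    by (simp only:)
  have "continuous_on UNIV h" using assms by (rule holomorphic_on_imp_continuous_on)
  then have "continuous_on {0..1} (\<lambda>t. h (?e t))"
    by (rule continuous_on_compose2) (auto intro!: continuous_intros)
  then have "set_integrable lborel {0..1} (\<lambda>t. h (?e t))"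
    by (rule borel_integrable_atLeastAtMost')
  then show ?thesis
    using I by (simp add: set_borel_integral_eq_integral(2) integral_unique)
qed

text \<open>The integral is invariant under the rotations \<open>w \<mapsto> e *s w\<close>, and averaging \<open>F (e *s w)\<close>
  over the unit circle gives \<open>F 0\<close> by Cauchy's formula on the complex line through \<open>w\<close>.\<close>

lemma mean_value_rotation_invariant:
  fixes F \<rho> :: "complex ^ 'n::finite \<Rightarrow> complex"
  assumes [measurable]: "F \<in> borel_measurable borel" "\<rho> \<in> borel_measurable borel"
    and entire: "slice_entire F"
    and rot: "\<And>c w. norm c = 1 \<Longrightarrow> \<rho> (c *s w) = \<rho> w"
    and int: "integrable lborel (\<lambda>w. F w * \<rho> w)"
  shows "(LINT w|lborel. F w * \<rho> w) = F 0 * (LINT w|lborel. \<rho> w)"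
proof -
  define e where "e t = exp (2 * of_real pi * \<i> * of_real t)" for t :: real
  have e: "norm (e t) = 1" for t by (simp add: e_def norm_exp_eq_Re)
  have e_cont: "continuous_on UNIV (\<lambda>p :: real \<times> (complex ^ 'n). e (fst p) *s snd p)"
    unfolding e_def by (intro continuous_intros)
  have e_meas: "(\<lambda>p :: real \<times> (complex ^ 'n). e (fst p) *s snd p) \<in> lborel \<Otimes>\<^sub>M lborel \<rightarrow>\<^sub>M borel"
    using borel_measurable_continuous_onI[OF e_cont] by (simp add: lborel_prod)
  have sm[measurable]: "(\<lambda>w :: complex ^ 'n. c *s w) \<in> borel \<rightarrow>\<^sub>M borel" for c
    by (intro borel_measurable_continuous_onI continuous_intros)
  define f where "f = (\<lambda>(t, w). indicator {0..1} t *\<^sub>R (F (e t *s w) * \<rho> w))"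
  have dist: "(lborel :: (complex ^ 'n) measure) = distr lborel borel (\<lambda>w. e t *s w)" for t
    by (rule distr_lborel_rotation[OF e, symmetric])
  have int_rot: "integrable lborel (\<lambda>w. F (e t *s w) * \<rho> w)" for t
  proof -
    have "integrable (distr lborel borel (\<lambda>w. e t *s w)) (\<lambda>w. F w * \<rho> w)"
      using int dist by metis
    then show ?thesis by (subst (asm) integrable_distr_eq) (auto simp: rot e)
  qed
  have integral_rot: "(LINT w|lborel. g (F (e t *s w) * \<rho> w)) = (LINT w|lborel. g (F w * \<rho> w))"
    if [measurable]: "g \<in> borel_measurable borel" for t and g :: "complex \<Rightarrow> 'b::{banach, second_countable_topology}"
  proof -
    have "(LINT w|lborel. g (F w * \<rho> w)) = (LINT w|distr lborel borel (\<lambda>w. e t *s w). g (F w * \<rho> w))"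
      using dist by metis
    also have "\<dots> = (LINT w|lborel. g (F (e t *s w) * \<rho> (e t *s w)))"
      by (rule integral_distr) auto
    finally show ?thesis by (simp add: rot e)
  qed
  have f_meas: "f \<in> borel_measurable (lborel \<Otimes>\<^sub>M lborel)"
  proof -
    have "(\<lambda>p. indicator {0..1} (fst p) *\<^sub>R (F (e (fst p) *s snd p) * \<rho> (snd p))) \<in> borel_measurable (lborel \<Otimes>\<^sub>M lborel)"
      using measurable_compose[OF e_meas, of F borel] by measurable
    then show ?thesis by (simp add: f_def case_prod_beta')
  qed
  have "integrable (lborel \<Otimes>\<^sub>M lborel) f"
  proof (rule lborel_pair.Fubini_integrable[OF f_meas])
    have "(\<lambda>t. LINT w|lborel. norm (f (t, w))) = (\<lambda>t. indicator {0..1} t *\<^sub>R (LINT w|lborel. norm (F w * \<rho> w)))"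
    proof
      fix t
      have "(LINT w|lborel. norm (f (t, w))) = (LINT w|lborel. indicator {0..1} t *\<^sub>R norm (F (e t *s w) * \<rho> w))"
        by (simp add: f_def)
      also have "\<dots> = indicator {0..1} t *\<^sub>R (LINT w|lborel. norm (F w * \<rho> w))"
        by (simp only: integral_scaleR_right integral_rot[of norm t] borel_measurable_norm measurable_ident_sets)
      finally show "(LINT w|lborel. norm (f (t, w))) = indicator {0..1} t *\<^sub>R (LINT w|lborel. norm (F w * \<rho> w))" .
    qed
    then show "integrable lborel (\<lambda>t. LINT w|lborel. norm (f (t, w)))"
      by simp
    show "AE t in lborel. integrable lborel (\<lambda>w. f (t, w))"
      using int_rot by (auto simp: f_def)
  qed
  then have fubini: "(LINT w|lborel. LINT t|lborel. f (t, w)) = (LINT t|lborel. LINT w|lborel. f (t, w))"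
    using lborel_pair.Fubini_integral[of "\<lambda>t w. f (t, w)"] by simp
  have "(LINT t|lborel. LINT w|lborel. f (t, w)) = (LINT t|lborel. indicator {0..1::real} t *\<^sub>R (LINT w|lborel. F w * \<rho> w))"
    using integral_rot[of "\<lambda>x. x"] by (simp add: f_def)
  also have "\<dots> = (LINT w|lborel. F w * \<rho> w)"
    by simp
  finally have 1: "(LINT t|lborel. LINT w|lborel. f (t, w)) = (LINT w|lborel. F w * \<rho> w)" .
  have "(LINT t|lborel. f (t, w)) = F 0 * \<rho> w" for w
  proof -
    have "(\<lambda>\<zeta>. F (0 + \<zeta> *s w)) holomorphic_on UNIV" using entire unfolding slice_entire_def by blast
    from mean_value_circle[OF this]
    have "(LINT t|lborel. indicator {0..1} t *\<^sub>R F (e t *s w)) = F 0"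
      by (simp add: e_def set_lebesgue_integral_def)
    moreover have "(LINT t|lborel. f (t, w)) = (LINT t|lborel. (indicator {0..1} t *\<^sub>R F (e t *s w)) * \<rho> w)"
      by (simp add: f_def)
    ultimately show ?thesis by (simp only: integral_mult_left_zero)
  qed
  then show ?thesis using fubini 1 by simp
qed

lemma slice_entire_mult: "slice_entire F \<Longrightarrow> slice_entire G \<Longrightarrow> slice_entire (\<lambda>w. F w * G w)"
  unfolding slice_entire_def by (auto intro!: holomorphic_intros)

lemma slice_entire_shift:
  assumes "slice_entire F"
  shows "slice_entire (\<lambda>w. F (w + z))"
  unfolding slice_entire_def
proof (intro allI)
  fix a v
  have "(\<lambda>\<zeta>. F ((a + z) + \<zeta> *s v)) holomorphic_on UNIV"
    using assms unfolding slice_entire_def by blast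
  then show "(\<lambda>\<zeta>. F (a + \<zeta> *s v + z)) holomorphic_on UNIV"
    by (simp only: add_ac)
qed

lemma slice_entire_exp: "slice_entire (\<lambda>w. exp (c * (w \<odot> a)))"
  unfolding slice_entire_def by (auto simp: bprod.add_left bprod_smult_left intro!: holomorphic_intros)

text \<open>The twisted translation \<open>w \<mapsto> F (w + z) * exp (- pi * (w \<odot> vcnj z))\<close> preserves holomorphy along
  complex lines and moves the value at \<open>z\<close> to the origin.\<close>

lemma mean_value_shifted:
  fixes F \<rho> :: "complex ^ 'n::finite \<Rightarrow> complex"
  assumes [measurable]: "F \<in> borel_measurable borel" "\<rho> \<in> borel_measurable borel"
    and entire: "slice_entire F"
    and rot: "\<And>c w. norm c = 1 \<Longrightarrow> \<rho> (c *s w) = \<rho> w"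
    and int: "integrable lborel (\<lambda>w. F w * exp (- of_real pi * ((w - z) \<odot> vcnj z)) * \<rho> (w - z))"
  shows "(LINT w|lborel. F w * exp (- of_real pi * ((w - z) \<odot> vcnj z)) * \<rho> (w - z)) = F z * (LINT w|lborel. \<rho> w)"
proof -
  define g where "g w = F w * exp (- of_real pi * ((w - z) \<odot> vcnj z)) * \<rho> (w - z)" for w
  have [measurable]: "(\<lambda>w :: complex ^ 'n. exp (- of_real pi * (w \<odot> a))) \<in> borel_measurable borel" for a
    by (intro borel_measurable_continuous_onI continuous_intros)
  have g[measurable]: "g \<in> borel_measurable borel" unfolding g_def by measurable
  have eq: "g (w + z) = F (w + z) * exp (- of_real pi * (w \<odot> vcnj z)) * \<rho> w" for w
    by (simp add: g_def)
  have "integrable lborel g"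
    using int unfolding g_def[abs_def] .
  then have int_g: "integrable lborel (\<lambda>w. g (w + z))"
    by (simp only: integrable_translate_iff[OF g])
  have "(LINT w|lborel. g (w + z)) = F (0 + z) * exp (- of_real pi * (0 \<odot> vcnj z)) * (LINT w|lborel. \<rho> w)"
    unfolding eq
  proof (rule mean_value_rotation_invariant)
    show "(\<lambda>w. F (w + z) * exp (- of_real pi * (w \<odot> vcnj z))) \<in> borel_measurable borel" by measurable
    show "\<rho> \<in> borel_measurable borel" by fact
    show "slice_entire (\<lambda>w. F (w + z) * exp (- of_real pi * (w \<odot> vcnj z)))"
      by (intro slice_entire_mult slice_entire_shift slice_entire_exp entire)
    show "\<rho> (c *s w) = \<rho> w" if "norm c = 1" for c w using that by (rule rot)
    show "integrable lborel (\<lambda>w. F (w + z) * exp (- of_real pi * (w \<odot> vcnj z)) * \<rho> w)"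
      using int_g unfolding eq .
  qed
  then have "(LINT w|lborel. g w) = F z * (LINT w|lborel. \<rho> w)"
    unfolding integral_translate[OF g] by (simp add: bprod.zero_left)
  then show ?thesis unfolding g_def .
qed

text \<open>The function whose Lebesgue norm is the Fock norm of \<open>F\<close>.\<close>

definition weighted :: "(complex ^ 'n::finite \<Rightarrow> complex) \<Rightarrow> complex ^ 'n \<Rightarrow> complex"
  where "weighted F z = F z * of_real (exp (- pi * (norm z)\<^sup>2 / 2))"

lemma fock_norm_eq: "fock_norm p F = Lp_norm p lborel (weighted F)"
  unfolding fock_norm_def weighted_def[abs_def] ..

lemma weighted_measurable [measurable]: "F \<in> borel_measurable borel \<Longrightarrow> weighted F \<in> borel_measurable borel"
  unfolding weighted_def[abs_def]
proof (rule borel_measurable_times)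
  show "(\<lambda>z :: complex ^ 'a. complex_of_real (exp (- pi * (norm z)\<^sup>2 / 2))) \<in> borel_measurable borel"
    by (intro borel_measurable_continuous_onI continuous_intros) auto
qed

lemma norm_weighted: "norm (weighted F z) = norm (F z) * exp (- pi * (norm z)\<^sup>2 / 2)"
  by (simp add: weighted_def norm_mult)

text \<open>The growth bound that holds on every space \<open>fock p k\<close>; it carries the constant explicitly
  because the limit arguments need it to be uniform along sequences.\<close>

definition gauss_bounded :: "real \<Rightarrow> (complex ^ 'n::finite \<Rightarrow> complex) \<Rightarrow> bool"
  where "gauss_bounded C F \<longleftrightarrow> F \<in> borel_measurable borel \<and> (\<forall>z. norm (weighted F z) \<le> C)"

lemma gauss_bounded_measurable [measurable_dest]: "gauss_bounded C F \<Longrightarrow> F \<in> borel_measurable borel"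
  by (simp add: gauss_bounded_def)

lemma gauss_bounded_norm_le:
  assumes "gauss_bounded C F"
  shows "norm (F z) \<le> C * exp (pi * (norm z)\<^sup>2 / 2)"
proof -
  have "norm (F z) = norm (weighted F z) * exp (pi * (norm z)\<^sup>2 / 2)"
    by (simp add: norm_weighted mult.assoc exp_add[symmetric])
  also have "\<dots> \<le> C * exp (pi * (norm z)\<^sup>2 / 2)"
    using assms by (intro mult_right_mono) (auto simp: gauss_bounded_def)
  finally show ?thesis .
qed

lemma norm_diff_square: "(norm (w - z))\<^sup>2 = (norm w)\<^sup>2 - 2 * (w \<bullet> z) + (norm (z :: 'a::real_inner))\<^sup>2"
  by (simp add: power2_norm_eq_inner inner_diff_left inner_diff_right inner_commute)

text \<open>The twisted mean value over the unit ball around \<open>z\<close> bounds \<open>weighted F z\<close> by a local \<open>L\<^sup>1\<close>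
  norm of \<open>weighted F\<close>, because the twist changes the Gaussian weight on that ball by a factor of
  at most \<open>exp (pi / 2)\<close>.\<close>

lemma slice_entire_Lp_imp_gauss_bounded:
  fixes F :: "complex ^ 'n::finite \<Rightarrow> complex"
  assumes entire: "slice_entire F" and Lp: "weighted F \<in> Lp p lborel" and p: "1 \<le> p"
  obtains C where "gauss_bounded C F"
proof -
  obtain K where K: "\<And>z. (\<integral>\<^sup>+w\<in>ball z 1. ennreal (norm (weighted F w)) \<partial>lborel) \<le> ennreal K"
    using Lp_locally_bounded[OF p Lp] by blast
  have wF: "weighted F \<in> borel_measurable borel" using Lp by (simp add: Lp_def)
  have "F = (\<lambda>w. weighted F w * of_real (exp (pi * (norm w)\<^sup>2 / 2)))"
    by (simp add: weighted_def fun_eq_iff mult.assoc of_real_mult[symmetric] exp_add[symmetric])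
  moreover have "(\<lambda>w. weighted F w * of_real (exp (pi * (norm w)\<^sup>2 / 2))) \<in> borel_measurable borel"
  proof (rule borel_measurable_times[OF wF])
    show "(\<lambda>z :: complex ^ 'n. complex_of_real (exp (pi * (norm z)\<^sup>2 / 2))) \<in> borel_measurable borel"
      by (intro borel_measurable_continuous_onI continuous_intros) auto
  qed
  ultimately have F[measurable]: "F \<in> borel_measurable borel" by simp
  define \<rho> :: "complex ^ 'n \<Rightarrow> complex" where "\<rho> = indicator (ball 0 1)"
  have \<rho>[measurable]: "\<rho> \<in> borel_measurable borel" unfolding \<rho>_def by (rule borel_measurable_indicator) simp
  define V where "V = measure lborel (ball (0 :: complex ^ 'n) 1)"
  have V: "0 < V" unfolding V_def by (simp add: content_ball unit_ball_vol_pos)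
  have I\<rho>: "(LINT w|lborel. \<rho> w) = of_real V"
  proof -
    have "\<rho> = (\<lambda>w. of_real (indicator (ball 0 1) w))" by (auto simp: \<rho>_def fun_eq_iff split: split_indicator)
    then have "(LINT w|lborel. \<rho> w) = of_real (LINT w|lborel. indicator (ball 0 1) (w :: complex ^ 'n))"
      by (simp only: integral_complex_of_real)
    also have "(LINT w|lborel. indicator (ball 0 1) (w :: complex ^ 'n)) = V"
      unfolding V_def by simp
    finally show ?thesis .
  qed
  have [measurable]: "(\<lambda>w :: complex ^ 'n. exp (- of_real pi * ((w - z) \<odot> vcnj z))) \<in> borel_measurable borel" for z
    by (intro borel_measurable_continuous_onI continuous_intros)
  have "norm (weighted F z) \<le> exp (pi / 2) * \<bar>K\<bar> / V" for z
  proof -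
    define g where "g w = F w * exp (- of_real pi * ((w - z) \<odot> vcnj z)) * \<rho> (w - z)" for w
    have [measurable]: "g \<in> borel_measurable borel" unfolding g_def by measurable
    define L where "L = exp (pi / 2) * exp (pi * (norm z)\<^sup>2 / 2)"
    have g_le: "norm (g w) \<le> L * (norm (weighted F w) * indicator (ball z 1) w)" for w
    proof (cases "w \<in> ball z 1")
      case True
      have nw: "(norm (w - z))\<^sup>2 \<le> 1"
        using True by (simp add: dist_norm norm_minus_commute power_le_one)
      have "norm (g w) = norm (F w) * exp (- pi * ((w - z) \<bullet> z))"
        using True by (simp add: g_def \<rho>_def norm_mult Re_bprod_vcnj dist_norm norm_minus_commute)
      also have "- pi * ((w - z) \<bullet> z) = - pi * (norm w)\<^sup>2 / 2 + (pi * (norm (w - z))\<^sup>2 / 2 + pi * (norm z)\<^sup>2 / 2)"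
        unfolding norm_diff_square inner_diff_left by (simp add: power2_norm_eq_inner field_simps)
      also have "norm (F w) * exp \<dots> = norm (weighted F w) * (exp (pi * (norm (w - z))\<^sup>2 / 2) * exp (pi * (norm z)\<^sup>2 / 2))"
        by (simp only: norm_weighted exp_add mult.assoc)
      also have "\<dots> \<le> norm (weighted F w) * L"
        unfolding L_def using nw by (intro mult_left_mono mult_right_mono) auto
      finally show ?thesis using True by (simp add: mult.commute)
    next
      case False
      then show ?thesis by (simp add: g_def \<rho>_def dist_norm norm_minus_commute)
    qed
    have L0: "0 \<le> L" by (simp add: L_def)
    have "(\<integral>\<^sup>+w. ennreal (norm (g w)) \<partial>lborel) \<le> (\<integral>\<^sup>+w. ennreal L * (ennreal (norm (weighted F w)) * indicator (ball z 1) w) \<partial>lborel)"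
    proof (rule nn_integral_mono)
      fix w
      have "ennreal (norm (g w)) \<le> ennreal (L * (norm (weighted F w) * indicator (ball z 1) w))"
        by (rule ennreal_leI[OF g_le])
      also have "\<dots> = ennreal L * (ennreal (norm (weighted F w)) * indicator (ball z 1) w)"
        using L0 by (simp add: ennreal_mult ennreal_indicator)
      finally show "ennreal (norm (g w)) \<le> ennreal L * (ennreal (norm (weighted F w)) * indicator (ball z 1) w)" .
    qed
    also have "\<dots> = ennreal L * (\<integral>\<^sup>+w\<in>ball z 1. ennreal (norm (weighted F w)) \<partial>lborel)"
      by (intro nn_integral_cmult borel_measurable_times_ennreal borel_measurable_indicator
          measurable_compose[OF _ measurable_ennreal] borel_measurable_norm) (simp_all add: wF)
    also have "\<dots> \<le> ennreal L * ennreal K" by (rule mult_left_mono[OF K]) simp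
    also have "\<dots> \<le> ennreal (L * \<bar>K\<bar>)"
      unfolding ennreal_mult'[OF L0] by (intro mult_left_mono ennreal_leI) auto
    finally have le: "(\<integral>\<^sup>+w. ennreal (norm (g w)) \<partial>lborel) \<le> ennreal (L * \<bar>K\<bar>)" .
    have int: "integrable lborel g"
    proof (rule integrableI_bounded)
      show "(\<integral>\<^sup>+w. ennreal (norm (g w)) \<partial>lborel) < \<infinity>"
        by (rule le_less_trans[OF le]) simp
    qed simp
    have "ennreal (norm (LINT w|lborel. g w)) \<le> ennreal (L * \<bar>K\<bar>)"
      using integral_norm_bound_ennreal[OF int] le by (rule order.trans)
    then have "norm (LINT w|lborel. g w) \<le> L * \<bar>K\<bar>"
      using L0 by (subst (asm) ennreal_le_iff) auto
    moreover have "(LINT w|lborel. g w) = F z * of_real V"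
      unfolding g_def I\<rho>[symmetric]
    proof (rule mean_value_shifted[OF F \<rho> entire])
      show "\<rho> (c *s w) = \<rho> w" if "norm c = 1" for c w
        by (simp add: \<rho>_def indicator_def norm_smult_vec that dist_norm)
      show "integrable lborel (\<lambda>w. F w * exp (- of_real pi * ((w - z) \<odot> vcnj z)) * \<rho> (w - z))"
        using int unfolding g_def[abs_def] .
    qed
    ultimately have "norm (F z) * V \<le> L * \<bar>K\<bar>" using V by (simp add: norm_mult)
    then have "norm (F z) \<le> L * \<bar>K\<bar> / V" using V by (simp add: pos_le_divide_eq)
    then have "norm (weighted F z) \<le> (L * \<bar>K\<bar> / V) * exp (- pi * (norm z)\<^sup>2 / 2)"
      unfolding norm_weighted by (rule mult_right_mono) simp
    also have "\<dots> = exp (pi / 2) * \<bar>K\<bar> / V * (exp (pi * (norm z)\<^sup>2 / 2) * exp (- pi * (norm z)\<^sup>2 / 2))"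
      by (simp add: L_def)
    finally show ?thesis by (simp add: exp_add[symmetric])
  qed
  then have "gauss_bounded (exp (pi / 2) * \<bar>K\<bar> / V) F" using F by (simp add: gauss_bounded_def)
  then show thesis by (rule that)
qed

section \<open>Integral operators dominated by convolutions\<close>

lemma gauss_bounded_nonneg: "gauss_bounded C G \<Longrightarrow> 0 \<le> C"
  unfolding gauss_bounded_def using order.trans[OF norm_ge_zero] by blast

lemma gauss_bounded_limit:
  assumes F: "\<And>n. gauss_bounded C (F n)" and lim: "\<And>w. (\<lambda>n. F n w) \<longlonglongrightarrow> G w"
  shows "gauss_bounded C G"
  unfolding gauss_bounded_def
proof (intro conjI allI)
  show "G \<in> borel_measurable borel"
    by (rule borel_measurable_LIMSEQ_metric[OF gauss_bounded_measurable[OF F] lim])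
  fix z
  have "(\<lambda>n. weighted (F n) z) \<longlonglongrightarrow> weighted G z"
    unfolding weighted_def by (intro tendsto_mult lim tendsto_const)
  then show "norm (weighted G z) \<le> C"
    by (rule Lim_bounded[OF tendsto_norm, of _ _ 0]) (use F in \<open>auto simp: gauss_bounded_def\<close>)
qed

definition kernel_op :: "(complex ^ 'n::finite \<Rightarrow> complex ^ 'n \<Rightarrow> complex) \<Rightarrow> (complex ^ 'n \<Rightarrow> complex) \<Rightarrow> complex ^ 'n \<Rightarrow> complex"
  where "kernel_op K E z = (LINT w|lborel. E w * K z w)"

text \<open>The summand \<open>1\<close> keeps the constant positive when \<open>h\<close> vanishes.\<close>

definition kmass :: "(complex ^ 'n::finite \<Rightarrow> real) \<Rightarrow> real"
  where "kmass h = (LINT v|lborel. h v) + 1"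

text \<open>The class of operators to which both the given operator and the operators \<open>kconv P\<close> below
  belong. The bound says that conjugation with the Gaussian weight leaves a kernel dominated by
  the translates of the integrable function \<open>h\<close>.\<close>

locale dominated_kernel =
  fixes K :: "complex ^ 'n::finite \<Rightarrow> complex ^ 'n \<Rightarrow> complex" and h :: "complex ^ 'n \<Rightarrow> real"
  assumes K: "(\<lambda>p. K (fst p) (snd p)) \<in> borel_measurable borel"
    and h: "h \<in> borel_measurable borel" "integrable lborel h" "\<And>v. 0 \<le> h v"
    and dom: "\<And>z. AE w in lborel. norm (K z w) \<le> exp (pi * (norm z)\<^sup>2 / 2) * (exp (- pi * (norm w)\<^sup>2 / 2) * h (w - z))"
begin

lemma kmass_pos: "0 < kmass h"
  unfolding kmass_def using Bochner_Integration.integral_nonneg[of lborel h] h(3) by (simp add: add_nonneg_pos)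

lemma h_shift: "integrable lborel (\<lambda>w. h (w - z))"
  using integrable_translate_iff[OF h(1), of "- z"] h(2) by simp

lemma nn_integral_h: "(\<integral>\<^sup>+x. ennreal (h x) \<partial>lborel) \<le> ennreal (kmass h)"
proof -
  have "(\<integral>\<^sup>+x. ennreal (h x) \<partial>lborel) = ennreal (LINT x|lborel. h x)"
    by (rule nn_integral_eq_integral[OF h(2)]) (simp add: h(3))
  then show ?thesis by (simp add: kmass_def ennreal_leI)
qed

lemma integrand_measurable:
  assumes E: "E \<in> borel_measurable borel"
  shows "(\<lambda>w. E w * K z w) \<in> borel_measurable borel"
proof -
  have "continuous_on UNIV (\<lambda>w :: complex ^ 'n. (z, w))" by (intro continuous_intros)
  from measurable_compose[OF borel_measurable_continuous_onI[OF this] K]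
  show ?thesis using E by simp
qed

lemma kernel_op_measurable:
  assumes E: "E \<in> borel_measurable borel"
  shows "kernel_op K E \<in> borel_measurable borel"
proof -
  have "continuous_on UNIV (snd :: (complex ^ 'n) \<times> (complex ^ 'n) \<Rightarrow> _)" by (intro continuous_intros)
  then have "(\<lambda>p :: (complex ^ 'n) \<times> (complex ^ 'n). E (snd p)) \<in> borel_measurable borel"
    by (intro measurable_compose[OF borel_measurable_continuous_onI E])
  then have "(\<lambda>p. E (snd p) * K (fst p) (snd p)) \<in> borel_measurable borel"
    by (intro borel_measurable_times K)
  then have "(\<lambda>(z, w). E w * K z w) \<in> borel_measurable (borel \<Otimes>\<^sub>M lborel)"
    by (simp add: case_prod_beta' measurable_cong_sets[OF sets_pair_measure_cong[OF refl sets_lborel] refl] borel_prod)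
  then show ?thesis
    unfolding kernel_op_def[abs_def] by (rule lborel.borel_measurable_lebesgue_integral)
qed

lemma dominated:
  "AE w in lborel. norm (E w * K z w) \<le> exp (pi * (norm z)\<^sup>2 / 2) * (norm (weighted E w) * h (w - z))"
  using dom[of z]
proof eventually_elim
  case (elim w)
  then have "norm (E w) * norm (K z w) \<le> norm (E w) * (exp (pi * (norm z)\<^sup>2 / 2) * (exp (- pi * (norm w)\<^sup>2 / 2) * h (w - z)))"
    by (rule mult_left_mono) simp
  then show ?case by (simp add: norm_mult norm_weighted mult_ac)
qed

lemma dominated_gauss_bounded:
  assumes E: "gauss_bounded C E"
  shows "AE w in lborel. norm (E w * K z w) \<le> exp (pi * (norm z)\<^sup>2 / 2) * (C * h (w - z))"
  using dominated[of E z]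
proof eventually_elim
  case (elim w)
  have "exp (pi * (norm z)\<^sup>2 / 2) * (norm (weighted E w) * h (w - z)) \<le> exp (pi * (norm z)\<^sup>2 / 2) * (C * h (w - z))"
    using E h(3) by (intro mult_left_mono mult_right_mono) (auto simp: gauss_bounded_def)
  then show ?case using elim by linarith
qed

lemma majorant_integrable: "integrable lborel (\<lambda>w. exp (pi * (norm z)\<^sup>2 / 2) * (C * h (w - z)))"
  by (intro integrable_mult_right h_shift)

lemma integrand_integrable:
  assumes E: "gauss_bounded C E"
  shows "integrable lborel (\<lambda>w. E w * K z w)"
proof (rule Bochner_Integration.integrable_bound[OF majorant_integrable])
  show "(\<lambda>w. E w * K z w) \<in> borel_measurable lborel"
    using integrand_measurable[OF gauss_bounded_measurable[OF E]] by simp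
  show "AE w in lborel. norm (E w * K z w) \<le> norm (exp (pi * (norm z)\<^sup>2 / 2) * (C * h (w - z)))"
    using dominated_gauss_bounded[OF E, of z]
  proof eventually_elim
    case (elim w)
    then show ?case unfolding real_norm_def by (rule order.trans[OF _ abs_ge_self])
  qed
qed

text \<open>Conjugating with the Gaussian weight turns the operator into one that is dominated by the
  convolution with \<open>h\<close>.\<close>

lemma weighted_kernel_op_le:
  assumes E: "gauss_bounded C E"
  shows "ennreal (norm (weighted (kernel_op K E) z)) \<le> (\<integral>\<^sup>+w. ennreal (norm (weighted E w)) * ennreal (h (w - z)) \<partial>lborel)"
proof -
  let ?I = "\<integral>\<^sup>+w. ennreal (norm (weighted E w)) * ennreal (h (w - z)) \<partial>lborel"
  let ?e = "exp (pi * (norm z)\<^sup>2 / 2)" and ?f = "exp (- pi * (norm z)\<^sup>2 / 2)"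
  have [measurable]: "E \<in> borel_measurable borel" "h \<in> borel_measurable borel"
    using gauss_bounded_measurable[OF E] h(1) by simp_all
  have "ennreal (norm (kernel_op K E z)) \<le> (\<integral>\<^sup>+w. ennreal (norm (E w * K z w)) \<partial>lborel)"
    unfolding kernel_op_def by (rule integral_norm_bound_ennreal[OF integrand_integrable[OF E]])
  also have "\<dots> \<le> (\<integral>\<^sup>+w. ennreal ?e * (ennreal (norm (weighted E w)) * ennreal (h (w - z))) \<partial>lborel)"
  proof (rule nn_integral_mono_AE)
    show "AE w in lborel. ennreal (norm (E w * K z w)) \<le> ennreal ?e * (ennreal (norm (weighted E w)) * ennreal (h (w - z)))"
      using dominated[of E z]
    proof eventually_elim
      case (elim w)
      then have "ennreal (norm (E w * K z w)) \<le> ennreal (?e * (norm (weighted E w) * h (w - z)))"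
        by (rule ennreal_leI)
      then show ?case by (simp add: ennreal_mult h(3))
    qed
  qed
  also have "\<dots> = ennreal ?e * ?I" by (rule nn_integral_cmult) measurable
  finally have "ennreal ?f * ennreal (norm (kernel_op K E z)) \<le> ennreal ?f * (ennreal ?e * ?I)"
    by (rule mult_left_mono) simp
  also have "\<dots> = ennreal (?f * ?e) * ?I"
    by (simp only: ennreal_mult[OF exp_ge_zero exp_ge_zero] mult.assoc)
  also have "?f * ?e = 1" unfolding exp_add[symmetric] by simp
  finally show ?thesis by (simp add: norm_weighted ennreal_mult' mult.commute)
qed

lemma kernel_op_norm_le:
  assumes E: "gauss_bounded C E" and p: "1 \<le> p"
  shows "Lp_norm p lborel (weighted (kernel_op K E)) \<le> ennreal (kmass h) * Lp_norm p lborel (weighted E)"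
proof (rule young_convolution[OF p])
  show "weighted E \<in> borel_measurable borel"
    by (rule weighted_measurable[OF gauss_bounded_measurable[OF E]])
  show "weighted (kernel_op K E) \<in> borel_measurable borel"
    by (rule weighted_measurable[OF kernel_op_measurable[OF gauss_bounded_measurable[OF E]]])
  show "(\<lambda>x. ennreal (h x)) \<in> borel_measurable borel" using h(1) by simp
qed (use kmass_pos nn_integral_h weighted_kernel_op_le[OF E] in auto)

lemma kernel_op_Lp:
  assumes E: "gauss_bounded C E" and p: "1 \<le> p" and Lp: "weighted E \<in> Lp p lborel"
  shows "weighted (kernel_op K E) \<in> Lp p lborel"
proof -
  have "Lp_norm p lborel (weighted (kernel_op K E)) \<le> ennreal (kmass h) * Lp_norm p lborel (weighted E)"
    by (rule kernel_op_norm_le[OF E p])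
  also have "\<dots> < \<infinity>" using Lp by (simp add: Lp_def ennreal_mult_less_top)
  finally show ?thesis
    using weighted_measurable[OF kernel_op_measurable[OF gauss_bounded_measurable[OF E]]] by (simp add: Lp_def)
qed

lemma kernel_op_gauss_bounded:
  assumes E: "gauss_bounded C E"
  shows "gauss_bounded (C * kmass h) (kernel_op K E)"
  unfolding gauss_bounded_def
proof (intro conjI allI)
  show "kernel_op K E \<in> borel_measurable borel"
    by (rule kernel_op_measurable[OF gauss_bounded_measurable[OF E]])
  fix z
  have C: "0 \<le> C" by (rule gauss_bounded_nonneg[OF E])
  have "ennreal (norm (weighted (kernel_op K E) z)) \<le> (\<integral>\<^sup>+w. ennreal (norm (weighted E w)) * ennreal (h (w - z)) \<partial>lborel)"
    by (rule weighted_kernel_op_le[OF E])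
  also have "\<dots> \<le> (\<integral>\<^sup>+w. ennreal C * ennreal (h (w - z)) \<partial>lborel)"
    using E by (intro nn_integral_mono mult_right_mono ennreal_leI) (auto simp: gauss_bounded_def)
  also have "\<dots> = ennreal C * (\<integral>\<^sup>+w. ennreal (h (w - z)) \<partial>lborel)"
    using h(1) by (intro nn_integral_cmult) simp
  also have "(\<integral>\<^sup>+w. ennreal (h (w - z)) \<partial>lborel) = (\<integral>\<^sup>+w. ennreal (h w) \<partial>lborel)"
    using nn_integral_translate[of "\<lambda>v. ennreal (h v)" "- z"] h(1) by simp
  also have "ennreal C * \<dots> \<le> ennreal C * ennreal (kmass h)"
    by (rule mult_left_mono[OF nn_integral_h]) simp
  also have "\<dots> = ennreal (C * kmass h)" using C kmass_pos by (simp add: ennreal_mult)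
  finally show "norm (weighted (kernel_op K E) z) \<le> C * kmass h"
    by (rule ennreal_le_iff[THEN iffD1, rotated]) (use C kmass_pos in simp)
qed

lemma kernel_op_tendsto:
  assumes F: "\<And>n. gauss_bounded C (F n)" and lim: "\<And>w. (\<lambda>n. F n w) \<longlonglongrightarrow> E w"
  shows "(\<lambda>n. kernel_op K (F n) z) \<longlonglongrightarrow> kernel_op K E z"
  unfolding kernel_op_def
proof (rule integral_dominated_convergence[OF _ _ majorant_integrable])
  show "(\<lambda>w. E w * K z w) \<in> borel_measurable lborel"
    using integrand_measurable[OF gauss_bounded_measurable[OF gauss_bounded_limit[OF F lim]]] by simp
  show "(\<lambda>w. F n w * K z w) \<in> borel_measurable lborel" for n
    using integrand_measurable[OF gauss_bounded_measurable[OF F]] by simp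
  show "AE w in lborel. (\<lambda>n. F n w * K z w) \<longlonglongrightarrow> E w * K z w"
    by (intro AE_I2 tendsto_mult lim tendsto_const)
  show "AE w in lborel. norm (F n w * K z w) \<le> exp (pi * (norm z)\<^sup>2 / 2) * (C * h (w - z))" for n
    by (rule dominated_gauss_bounded[OF F])
qed

end


section \<open>Operators with translated polynomial kernels\<close>

text \<open>Its value is \<open>1\<close>; the symbol spares the evaluation of the Gaussian integral.\<close>

definition gauss_mass :: "'n::finite itself \<Rightarrow> complex"
  where "gauss_mass _ = (LINT w|lborel. of_real (exp (- pi * (norm (w :: complex ^ 'n))\<^sup>2)))"

lemma gauss_mass_nonzero: "gauss_mass TYPE('n::finite) \<noteq> 0"
  unfolding gauss_mass_def integral_complex_of_real
  using nonzero_gauss_integral[OF pi_gt_zero, where 'a="complex ^ 'n"] by simp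

text \<open>The reproducing kernel of the Fock space times the Gaussian density.\<close>

definition rkernel :: "complex ^ 'n::finite \<Rightarrow> complex ^ 'n \<Rightarrow> complex"
  where "rkernel z w = exp (of_real pi * (z \<odot> vcnj w)) * of_real (exp (- pi * (norm w)\<^sup>2))"

definition poly_growth :: "(complex ^ 'n::finite \<Rightarrow> complex) \<Rightarrow> bool"
  where "poly_growth P \<longleftrightarrow> continuous_on UNIV P \<and> (\<exists>D N. 0 \<le> D \<and> (\<forall>w. norm (P w) \<le> D * (1 + norm w) ^ N))"

definition gkernel :: "(complex ^ 'n::finite \<Rightarrow> complex) \<Rightarrow> complex ^ 'n \<Rightarrow> real"
  where "gkernel P v = norm (P v) * exp (- pi * (norm v)\<^sup>2 / 2)"

text \<open>For \<open>P = 1\<close> this is the projection onto the entire functions. For a conjugated monomial it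
  is, up to a constant, the passage from the Bargmann transform to its polyanalytic version, and
  for a monomial the inverse of that passage.\<close>

definition kconv :: "(complex ^ 'n::finite \<Rightarrow> complex) \<Rightarrow> (complex ^ 'n \<Rightarrow> complex) \<Rightarrow> complex ^ 'n \<Rightarrow> complex"
  where "kconv P = kernel_op (\<lambda>z w. P (w - z) * rkernel z w)"

lemma kconv_eq: "kconv P G z = (LINT w|lborel. G w * P (w - z) * rkernel z w)"
  by (simp add: kconv_def kernel_op_def mult.assoc)

lemma norm_rkernel:
  "norm (rkernel z w) = exp (pi * (norm z)\<^sup>2 / 2) * (exp (- pi * (norm w)\<^sup>2 / 2) * exp (- pi * (norm (w - z))\<^sup>2 / 2))"
proof -
  have "norm (rkernel z w) = exp (pi * (z \<bullet> w) + - pi * (norm w)\<^sup>2)"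
    unfolding exp_add by (simp add: rkernel_def norm_mult Re_bprod_vcnj)
  also have "pi * (z \<bullet> w) + - pi * (norm w)\<^sup>2
      = pi * (norm z)\<^sup>2 / 2 + (- pi * (norm w)\<^sup>2 / 2 + - pi * (norm (w - z))\<^sup>2 / 2)"
    unfolding norm_diff_square by (simp add: inner_commute algebra_simps diff_divide_distrib add_divide_distrib)
  finally show ?thesis by (simp only: exp_add)
qed

lemma continuous_on_rkernel [continuous_intros]:
  "continuous_on S f \<Longrightarrow> continuous_on S g \<Longrightarrow> continuous_on S (\<lambda>x. rkernel (f x) (g x))"
  unfolding rkernel_def by (intro continuous_intros)

lemma gkernel_nonneg: "0 \<le> gkernel P v"
  by (simp add: gkernel_def)

lemma gkernel_decay:
  fixes P :: "complex ^ 'n::finite \<Rightarrow> complex"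
  assumes "poly_growth P"
  obtains E where "0 \<le> E" "\<And>v. gkernel P v \<le> E / (1 + norm v) ^ M"
proof -
  obtain D N where D: "0 \<le> D" "\<And>w. norm (P w) \<le> D * (1 + norm w) ^ N"
    using assms unfolding poly_growth_def by blast
  have "0 < pi / 2" by simp
  then obtain C where C: "0 < C" "\<And>r. 0 \<le> r \<Longrightarrow> (1 + r) ^ (N + M) * exp (0 * r - pi / 2 * r\<^sup>2) \<le> C"
    using poly_times_gauss_bounded by blast
  show thesis
  proof (rule that)
    show "0 \<le> D * C" using D C by simp
    fix v :: "complex ^ 'n"
    have pos: "0 < (1 + norm v) ^ M" by (simp add: add_pos_nonneg)
    have "gkernel P v * (1 + norm v) ^ M \<le> (D * (1 + norm v) ^ N * exp (- pi * (norm v)\<^sup>2 / 2)) * (1 + norm v) ^ M"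
      unfolding gkernel_def by (intro mult_right_mono D) auto
    also have "\<dots> = D * ((1 + norm v) ^ (N + M) * exp (0 * norm v - pi / 2 * (norm v)\<^sup>2))"
      by (simp add: power_add mult_ac)
    also have "\<dots> \<le> D * C" using C D by (intro mult_left_mono) auto
    finally show "gkernel P v \<le> D * C / (1 + norm v) ^ M"
      using pos by (simp add: pos_le_divide_eq)
  qed
qed

lemma gkernel_measurable:
  assumes "poly_growth P"
  shows "gkernel P \<in> borel_measurable borel"
  using assms unfolding gkernel_def[abs_def] poly_growth_def
  by (intro borel_measurable_continuous_onI continuous_intros) auto

lemma integrable_gkernel:
  fixes P :: "complex ^ 'n::finite \<Rightarrow> complex"
  assumes "poly_growth P"
  shows "integrable lborel (gkernel P)"
proof -
  obtain E where "\<And>v. gkernel P v \<le> E / (1 + norm v) ^ (DIM(complex ^ 'n) + 2)"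
    using gkernel_decay[OF assms] by blast
  then have "\<And>v. norm (gkernel P v) \<le> E / (1 + norm v) ^ (DIM(complex ^ 'n) + 2)"
    by (simp only: real_norm_def abs_of_nonneg[OF gkernel_nonneg])
  then show ?thesis
    by (rule integrable_of_decay[OF gkernel_measurable[OF assms]])
qed

lemma dominated_kernel_kconv:
  assumes P: "poly_growth P"
  shows "dominated_kernel (\<lambda>z w. P (w - z) * rkernel z w) (gkernel P)"
proof
  have "continuous_on UNIV (\<lambda>p. P (snd p - fst p) * rkernel (fst p) (snd p))"
    using P unfolding poly_growth_def
    by (intro continuous_intros continuous_on_compose2[of UNIV P UNIV "\<lambda>p. snd p - fst p"]) auto
  then show "(\<lambda>p. P (snd p - fst p) * rkernel (fst p) (snd p)) \<in> borel_measurable borel"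
    by (rule borel_measurable_continuous_onI)
  show "AE w in lborel. norm (P (w - z) * rkernel z w)
      \<le> exp (pi * (norm z)\<^sup>2 / 2) * (exp (- pi * (norm w)\<^sup>2 / 2) * gkernel P (w - z))" for z
    by (simp add: norm_mult norm_rkernel gkernel_def mult_ac)
qed (use gkernel_measurable[OF P] integrable_gkernel[OF P] gkernel_nonneg in auto)

lemma kconv_integrable:
  assumes "gauss_bounded C G" "poly_growth P"
  shows "integrable lborel (\<lambda>w. G w * P (w - z) * rkernel z w)"
  using dominated_kernel.integrand_integrable[OF dominated_kernel_kconv[OF assms(2)] assms(1), of z]
  by (simp add: mult.assoc)

lemmas kconv_gauss_bounded = dominated_kernel.kernel_op_gauss_bounded[OF dominated_kernel_kconv, folded kconv_def]
  and kconv_Lp = dominated_kernel.kernel_op_Lp[OF dominated_kernel_kconv, folded kconv_def]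
  and kconv_tendsto = dominated_kernel.kernel_op_tendsto[OF dominated_kernel_kconv, folded kconv_def]

lemma poly_growth_1: "poly_growth (\<lambda>_. 1)"
  unfolding poly_growth_def by (intro conjI continuous_intros exI[of _ 1] exI[of _ 0]) auto

text \<open>The twisted mean value formula for the Gaussian density \<open>\<rho>\<close>, whose twist at \<open>z\<close> is exactly
  \<open>rkernel z\<close>.\<close>

lemma reproducing_formula:
  fixes F :: "complex ^ 'n::finite \<Rightarrow> complex"
  assumes F: "gauss_bounded C F" and entire: "slice_entire F"
  shows "kconv (\<lambda>_. 1) F z = gauss_mass TYPE('n) * F z"
proof -
  define \<rho> where "\<rho> w = complex_of_real (exp (- pi * (norm (w :: complex ^ 'n))\<^sup>2))" for w
  have \<rho>: "\<rho> \<in> borel_measurable borel"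
    unfolding \<rho>_def[abs_def] by (intro borel_measurable_continuous_onI continuous_intros)
  have eq: "F w * exp (- of_real pi * ((w - z) \<odot> vcnj z)) * \<rho> (w - z) = F w * 1 * rkernel z w" for w
  proof -
    have 1: "of_real ((norm (w - z))\<^sup>2) = w \<odot> vcnj w - w \<odot> vcnj z - z \<odot> vcnj w + z \<odot> vcnj z"
      unfolding bprod_vcnj_self[symmetric]
      by (simp add: linear_diff[OF bounded_linear.linear[OF bounded_linear_vcnj]] bprod.diff_left bprod.diff_right)
    have 2: "of_real ((norm w)\<^sup>2) = w \<odot> vcnj w" by (simp only: bprod_vcnj_self)
    have "exp (- of_real pi * ((w - z) \<odot> vcnj z)) * \<rho> (w - z)
        = exp (- of_real pi * ((w - z) \<odot> vcnj z) + - of_real pi * of_real ((norm (w - z))\<^sup>2))"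
      unfolding exp_add \<rho>_def by (simp add: exp_of_real[symmetric])
    also have "\<dots> = exp (of_real pi * (z \<odot> vcnj w) + - of_real pi * of_real ((norm w)\<^sup>2))"
      unfolding 1 2 by (rule arg_cong[where f=exp]) (simp add: bprod.diff_left algebra_simps)
    also have "\<dots> = rkernel z w"
      unfolding exp_add rkernel_def by (simp add: exp_of_real[symmetric])
    finally show ?thesis by (simp add: mult.assoc)
  qed
  have "(LINT w|lborel. F w * exp (- of_real pi * ((w - z) \<odot> vcnj z)) * \<rho> (w - z)) = F z * (LINT w|lborel. \<rho> w)"
  proof (rule mean_value_shifted[OF gauss_bounded_measurable[OF F] \<rho> entire])
    show "\<rho> (c *s w) = \<rho> w" if "norm c = 1" for c w
      using that by (simp add: \<rho>_def norm_smult_vec)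
    show "integrable lborel (\<lambda>w. F w * exp (- of_real pi * ((w - z) \<odot> vcnj z)) * \<rho> (w - z))"
      unfolding eq by (rule kconv_integrable[OF F poly_growth_1])
  qed
  then have "kconv (\<lambda>_. 1) F z = F z * gauss_mass TYPE('n)"
    unfolding eq kconv_eq gauss_mass_def \<rho>_def[symmetric] .
  then show ?thesis by (simp only: mult.commute)
qed

text \<open>Differentiation under the integral sign: along a complex line the kernel depends on \<open>\<zeta>\<close>
  through a single exponential.\<close>

lemma slice_entire_kconv:
  assumes G: "gauss_bounded C G"
  shows "slice_entire (kconv (\<lambda>_. 1) (G :: complex ^ 'n::finite \<Rightarrow> complex))"
proof (rule slice_entireI)
  fix z v :: "complex ^ 'n"
  let ?M = "DIM(complex ^ 'n) + 2"
  define R where "R = norm z + norm v"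
  have "0 < pi / 2" by simp
  then obtain E where E: "0 < E" "\<And>r. 0 \<le> r \<Longrightarrow> (1 + r) ^ (1 + ?M) * exp (pi * R * r - pi / 2 * r\<^sup>2) \<le> E"
    using poly_times_gauss_bounded by blast
  have C: "0 \<le> C" by (rule gauss_bounded_nonneg[OF G])
  define q where "q \<zeta> w = G w * 1 * rkernel (z + \<zeta> *s v) w" for \<zeta> w
  define D where "D \<zeta> w h = h * (of_real pi * (v \<odot> vcnj w) * q \<zeta> w)" for \<zeta> w h
  define B where "B w = pi * norm v * C * E * (1 / (1 + norm w) ^ ?M)" for w :: "complex ^ 'n"
  have der: "((\<lambda>\<zeta>. q \<zeta> w) has_derivative D \<zeta> w) (at \<zeta>)" for \<zeta> w
  proof -
    have eq: "q \<zeta> w = (G w * rkernel z w) * exp (\<zeta> * (of_real pi * (v \<odot> vcnj w)))" for \<zeta>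
      by (simp add: q_def rkernel_def bprod.add_left bprod_smult_left exp_add distrib_left mult_ac)
    have "((\<lambda>\<zeta>. q \<zeta> w) has_field_derivative of_real pi * (v \<odot> vcnj w) * q \<zeta> w) (at \<zeta>)"
      unfolding eq by (rule derivative_eq_intros refl | simp)+
    then show ?thesis
      unfolding has_field_derivative_def D_def by (rule has_derivative_eq_rhs) (simp add: fun_eq_iff mult_ac)
  qed
  have bound: "norm (D \<zeta> w h) \<le> B w * norm h" if \<zeta>: "\<zeta> \<in> ball 0 1" for \<zeta> w h
  proof -
    define a where "a = z + \<zeta> *s v"
    have "norm (\<zeta> *s v) \<le> 1 * norm v"
      unfolding norm_smult_vec using \<zeta> by (intro mult_right_mono) auto
    then have a: "norm a \<le> R"
      unfolding a_def R_def using norm_triangle_ineq[of z "\<zeta> *s v"] by linarith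
    have "norm (q \<zeta> w) = norm (G w) * (exp (pi * (a \<bullet> w)) * exp (- pi * (norm w)\<^sup>2))"
      by (simp add: q_def a_def[symmetric] rkernel_def norm_mult Re_bprod_vcnj)
    also have "\<dots> \<le> (C * exp (pi * (norm w)\<^sup>2 / 2)) * (exp (pi * R * norm w) * exp (- pi * (norm w)\<^sup>2))"
    proof (intro mult_mono gauss_bounded_norm_le[OF G])
      have "a \<bullet> w \<le> norm a * norm w" by (rule norm_cauchy_schwarz)
      also have "\<dots> \<le> R * norm w" using a by (rule mult_right_mono) simp
      finally show "exp (pi * (a \<bullet> w)) \<le> exp (pi * R * norm w)"
        by (simp add: mult.assoc)
    qed (use C in auto)
    also have "\<dots> = C * exp (pi * R * norm w - pi / 2 * (norm w)\<^sup>2)"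
      by (simp add: exp_add[symmetric] algebra_simps)
    finally have q: "norm (q \<zeta> w) \<le> C * exp (pi * R * norm w - pi / 2 * (norm w)\<^sup>2)" .
    have pos: "0 < (1 + norm w) ^ ?M" by (simp add: add_pos_nonneg)
    have "norm (D \<zeta> w h) = norm h * (pi * norm (v \<odot> vcnj w) * norm (q \<zeta> w))"
      by (simp add: D_def norm_mult)
    also have "\<dots> \<le> norm h * (pi * (norm v * (1 + norm w)) * (C * exp (pi * R * norm w - pi / 2 * (norm w)\<^sup>2)))"
    proof (intro mult_left_mono mult_mono q)
      have "norm (v \<odot> vcnj w) \<le> norm v * norm w" using norm_bprod_le[of v "vcnj w"] by (simp add: norm_vcnj)
      also have "\<dots> \<le> norm v * (1 + norm w)" by (intro mult_left_mono) auto
      finally show "norm (v \<odot> vcnj w) \<le> norm v * (1 + norm w)" .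
    qed auto
    also have "\<dots> = norm h * (pi * norm v * C) * ((1 + norm w) ^ (1 + ?M) * exp (pi * R * norm w - pi / 2 * (norm w)\<^sup>2)) / (1 + norm w) ^ ?M"
      using pos by (simp only: power_add power_one_right) (simp add: mult_ac)
    also have "\<dots> \<le> norm h * (pi * norm v * C) * E / (1 + norm w) ^ ?M"
      using C pos by (intro divide_right_mono mult_left_mono E(2)) auto
    also have "\<dots> = B w * norm h" by (simp add: B_def)
    finally show ?thesis .
  qed
  have B: "integrable lborel B"
    unfolding B_def by (intro integrable_mult_right integrable_inverse_power)
  have int: "integrable lborel (q \<zeta>)" for \<zeta>
    unfolding q_def[abs_def] by (rule kconv_integrable[OF G poly_growth_1])
  have "((\<lambda>\<zeta>. LINT w|lborel. q \<zeta> w) has_derivative (\<lambda>h. LINT w|lborel. D 0 w h)) (at 0)"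
    by (rule has_derivative_lebesgue_integral(2)[where B=B and D=D, OF der bound int B])
  then have "((\<lambda>\<zeta>. kconv (\<lambda>_. 1) G (z + \<zeta> *s v)) has_derivative (\<lambda>h. (LINT w|lborel. of_real pi * (v \<odot> vcnj w) * q 0 w) * h)) (at 0)"
    by (simp add: q_def D_def kconv_eq mult.commute)
  then show "(\<lambda>\<zeta>. kconv (\<lambda>_. 1) G (z + \<zeta> *s v)) field_differentiable at 0"
    unfolding field_differentiable_def has_field_derivative_def by blast
qed

section \<open>Wirtinger derivatives of the weighted transform\<close>

definition mon :: "'n list \<Rightarrow> complex ^ 'n::finite \<Rightarrow> complex"
  where "mon js w = prod_list (map (\<lambda>j. w $ j) js)"

definition cmon :: "'n list \<Rightarrow> complex ^ 'n::finite \<Rightarrow> complex"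
  where "cmon js w = cnj (mon js w)"

lemma mon_Nil [simp]: "mon [] w = 1" and mon_Cons [simp]: "mon (j # js) w = w $ j * mon js w"
  by (simp_all add: mon_def)

lemma cmon_Nil [simp]: "cmon [] w = 1" and cmon_Cons [simp]: "cmon (j # js) w = cnj (w $ j) * cmon js w"
  by (simp_all add: cmon_def)

lemma norm_vec_nth_le: "norm (w $ j) \<le> norm (w :: complex ^ 'n::finite)"
  by (rule Finite_Cartesian_Product.norm_nth_le)

lemma norm_mon_le: "norm (mon js w) \<le> (1 + norm w) ^ length js"
proof (induction js)
  case (Cons j js)
  have "norm (w $ j) * norm (mon js w) \<le> (1 + norm w) * (1 + norm w) ^ length js"
    using norm_vec_nth_le[of w j] Cons by (intro mult_mono) auto
  then show ?case by (simp add: norm_mult)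
qed simp

lemma norm_cmon_le: "norm (cmon js w) \<le> (1 + norm w) ^ length js"
  using norm_mon_le[of js w] by (simp add: cmon_def)

lemma continuous_on_mon: "continuous_on S (mon js)"
proof (induction js)
  case (Cons j js)
  have "mon (j # js) = (\<lambda>w. w $ j * mon js w)" by (simp add: fun_eq_iff)
  then show ?case using Cons by (simp add: continuous_on_mult continuous_on_component)
next
  case Nil
  have "mon [] = (\<lambda>w. 1)" by (simp add: fun_eq_iff)
  then show ?case by simp
qed

lemma poly_growth_mon: "poly_growth (mon js)"
  unfolding poly_growth_def
  by (intro conjI continuous_on_mon exI[of _ "1 :: real"] exI[of _ "length js"]) (use norm_mon_le in auto)

lemma poly_growth_cmon: "poly_growth (cmon js)"
  unfolding poly_growth_def
proof (intro conjI exI[of _ "1 :: real"] exI[of _ "length js"])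
  show "continuous_on UNIV (cmon js)"
    unfolding cmon_def[abs_def] by (intro continuous_intros continuous_on_mon)
  show "\<forall>w. norm (cmon js w) \<le> 1 * (1 + norm w) ^ length js"
    using norm_cmon_le by (simp only: mult_1_left) blast
qed simp

lemma wirtinger_eqI: "(F has_derivative D) (at z) \<Longrightarrow> wirtinger j F z = (D (axis j 1) - \<i> * D (axis j \<i>)) / 2"
  unfolding wirtinger_def by (simp add: frechet_derivative_at[symmetric])

text \<open>The last conjunct says that conjugated monomials are antiholomorphic, so that the Wirtinger
  operators annihilate them.\<close>

lemma cmon_has_derivative:
  "\<exists>D. ((\<lambda>z. cmon js (w - z)) has_derivative D) (at z) \<and>
    (\<forall>h. norm (D h) \<le> real (length js) * (1 + norm (w - z)) ^ length js * norm h) \<and>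
    (\<forall>j. D (axis j \<i>) = - \<i> * D (axis j 1))"
proof (induction js)
  case Nil
  show ?case by (intro exI[of _ "\<lambda>_. 0"]) simp
next
  case (Cons i js)
  then obtain D where D: "((\<lambda>z. cmon js (w - z)) has_derivative D) (at z)"
    "\<And>h. norm (D h) \<le> real (length js) * (1 + norm (w - z)) ^ length js * norm h"
    "\<And>j. D (axis j \<i>) = - \<i> * D (axis j 1)" by blast
  define D' where "D' h = cnj ((w - z) $ i) * D h + - cnj (h $ i) * cmon js (w - z)" for h
  have lin: "((\<lambda>z. cnj ((w - z) $ i)) has_derivative (\<lambda>h. - cnj (h $ i))) (at z)"
    by (rule has_derivative_eq_rhs, (rule derivative_intros bounded_linear.has_derivative[OF bounded_linear_cnj]
        bounded_linear.has_derivative[OF bounded_linear_vec_nth])+) (simp add: fun_eq_iff)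
  have "((\<lambda>z. cmon (i # js) (w - z)) has_derivative D') (at z)"
    unfolding cmon_Cons D'_def by (rule has_derivative_mult[OF lin D(1)])
  moreover have "norm (D' h) \<le> real (length (i # js)) * (1 + norm (w - z)) ^ length (i # js) * norm h" for h
  proof -
    let ?r = "1 + norm (w - z)"
    have "norm (D' h) \<le> norm ((w - z) $ i) * norm (D h) + norm (h $ i) * norm (cmon js (w - z))"
      unfolding D'_def by (rule order.trans[OF norm_triangle_ineq]) (simp only: norm_mult norm_minus_cancel complex_mod_cnj)
    also have "\<dots> \<le> ?r * (real (length js) * ?r ^ length js * norm h) + norm h * ?r ^ length js"
      using norm_vec_nth_le[of "w - z" i] by (intro add_mono mult_mono D(2) norm_cmon_le norm_vec_nth_le) auto
    also have "norm h * ?r ^ length js \<le> norm h * (?r * ?r ^ length js)"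
      by (intro mult_left_mono) (auto simp: algebra_simps)
    finally show ?thesis by (simp add: algebra_simps)
  qed
  moreover have "D' (axis j \<i>) = - \<i> * D' (axis j 1)" for j
    unfolding D'_def D(3) by (simp add: axis_def algebra_simps)
  ultimately show ?case by blast
qed

lemma mon_has_derivative:
  "\<exists>D. ((\<lambda>w. mon js (w - z)) has_derivative D) (at w) \<and>
    (\<forall>h. norm (D h) \<le> real (length js) * (1 + norm (w - z)) ^ length js * norm h) \<and>
    (\<forall>j. D (axis j \<i>) = \<i> * D (axis j 1)) \<and>
    (\<forall>j. D (axis j 1) = of_nat (count_list js j) * mon (remove1 j js) (w - z))"
proof (induction js)
  case Nil
  show ?case by (intro exI[of _ "\<lambda>_. 0"]) simp
next
  case (Cons i js)
  then obtain D where D: "((\<lambda>w. mon js (w - z)) has_derivative D) (at w)"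
    "\<And>h. norm (D h) \<le> real (length js) * (1 + norm (w - z)) ^ length js * norm h"
    "\<And>j. D (axis j \<i>) = \<i> * D (axis j 1)"
    "\<And>j. D (axis j 1) = of_nat (count_list js j) * mon (remove1 j js) (w - z)" by blast
  define D' where "D' h = (w - z) $ i * D h + h $ i * mon js (w - z)" for h
  have lin: "((\<lambda>w. (w - z) $ i) has_derivative (\<lambda>h. h $ i)) (at w)"
    by (rule has_derivative_eq_rhs, (rule derivative_intros
        bounded_linear.has_derivative[OF bounded_linear_vec_nth])+) (simp add: fun_eq_iff)
  have "((\<lambda>w. mon (i # js) (w - z)) has_derivative D') (at w)"
    unfolding mon_Cons D'_def by (rule has_derivative_mult[OF lin D(1)])
  moreover have "norm (D' h) \<le> real (length (i # js)) * (1 + norm (w - z)) ^ length (i # js) * norm h" for h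
  proof -
    let ?r = "1 + norm (w - z)"
    have "norm (D' h) \<le> norm ((w - z) $ i) * norm (D h) + norm (h $ i) * norm (mon js (w - z))"
      unfolding D'_def by (rule order.trans[OF norm_triangle_ineq]) (simp only: norm_mult)
    also have "\<dots> \<le> ?r * (real (length js) * ?r ^ length js * norm h) + norm h * ?r ^ length js"
      using norm_vec_nth_le[of "w - z" i] by (intro add_mono mult_mono D(2) norm_mon_le norm_vec_nth_le) auto
    also have "norm h * ?r ^ length js \<le> norm h * (?r * ?r ^ length js)"
      by (intro mult_left_mono) (auto simp: algebra_simps)
    finally show ?thesis by (simp add: algebra_simps)
  qed
  moreover have "D' (axis j \<i>) = \<i> * D' (axis j 1)" for j
    unfolding D'_def D(3) by (simp add: axis_def algebra_simps)
  moreover have "D' (axis j 1) = of_nat (count_list (i # js) j) * mon (remove1 j (i # js)) (w - z)" for j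
  proof (cases "i = j")
    case True
    have "(w - z) $ j * (of_nat (count_list js j) * mon (remove1 j js) (w - z)) = of_nat (count_list js j) * mon js (w - z)"
    proof (cases "j \<in> set js")
      case True
      then have "mon js (w - z) = (w - z) $ j * mon (remove1 j js) (w - z)"
        by (induction js) auto
      then show ?thesis by simp
    next
      case False
      then show ?thesis by (simp add: count_list_0_iff[symmetric])
    qed
    then show ?thesis using True unfolding D'_def D(4) by (simp add: axis_def algebra_simps)
  next
    case False
    then show ?thesis unfolding D'_def D(4) by (simp add: axis_def)
  qed
  ultimately show ?case by blast
qed

text \<open>For \<open>js = []\<close> and an entire \<open>G\<close> with \<open>gauss_bounded K G\<close> this is a multiple of
  \<open>exp (- pi * norm z ^ 2) * G z\<close>, the function that \<open>poly_bargmann\<close> differentiates. Each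
  Wirtinger derivative multiplies the kernel by
  \<open>pi\<close> and by a conjugated coordinate of \<open>w - z\<close>, which prepends a letter to \<open>js\<close>.\<close>

definition wtrans :: "'n list \<Rightarrow> (complex ^ 'n::finite \<Rightarrow> complex) \<Rightarrow> complex ^ 'n \<Rightarrow> complex"
  where "wtrans js G z = of_real (exp (- pi * (norm z)\<^sup>2)) * kconv (cmon js) G z"

lemma wtrans_bound:
  assumes G: "gauss_bounded C G"
  obtains A where "0 \<le> A" "\<And>z. norm (wtrans js G z) \<le> A * exp (- pi * (norm z)\<^sup>2 / 2)"
proof -
  define A where "A = C * kmass (gkernel (cmon js))"
  have A: "gauss_bounded A (kconv (cmon js) G)"
    unfolding A_def by (rule kconv_gauss_bounded[OF poly_growth_cmon G])
  have "norm (wtrans js G z) \<le> A * exp (- pi * (norm z)\<^sup>2 / 2)" for z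
  proof -
    have "norm (wtrans js G z) = exp (- pi * (norm z)\<^sup>2 / 2) * norm (weighted (kconv (cmon js) G) z)"
    proof -
      have "exp (- pi * (norm z)\<^sup>2) = exp (- pi * (norm z)\<^sup>2 / 2) * exp (- pi * (norm z)\<^sup>2 / 2)"
        unfolding exp_add[symmetric] by simp
      then show ?thesis by (simp add: wtrans_def norm_mult norm_weighted)
    qed
    also have "\<dots> \<le> exp (- pi * (norm z)\<^sup>2 / 2) * A"
      using A by (intro mult_left_mono) (auto simp: gauss_bounded_def)
    finally show ?thesis by (simp only: mult.commute)
  qed
  then show thesis using gauss_bounded_nonneg[OF A] that by blast
qed

definition wkernel :: "complex ^ 'n::finite \<Rightarrow> complex ^ 'n \<Rightarrow> complex"
  where "wkernel z w = of_real (exp (- pi * (norm z)\<^sup>2)) * rkernel z w"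

lemma wtrans_eq: "wtrans js G z = (LINT w|lborel. G w * (cmon js (w - z) * wkernel z w))"
proof -
  have "wtrans js G z = (LINT w|lborel. of_real (exp (- pi * (norm z)\<^sup>2)) * (G w * cmon js (w - z) * rkernel z w))"
    unfolding wtrans_def kconv_eq by (rule integral_mult_right_zero[symmetric])
  then show ?thesis by (simp add: wkernel_def mult_ac)
qed

lemma norm_wkernel:
  "norm (wkernel z w) = exp (- pi * (norm z)\<^sup>2 / 2) * (exp (- pi * (norm w)\<^sup>2 / 2) * exp (- pi * (norm (w - z))\<^sup>2 / 2))"
proof -
  have "exp (- pi * (norm z)\<^sup>2) * exp (pi * (norm z)\<^sup>2 / 2) = exp (- pi * (norm z)\<^sup>2 / 2)"
    unfolding exp_add[symmetric] by simp
  then show ?thesis by (simp add: wkernel_def norm_mult norm_rkernel mult.assoc[symmetric])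
qed

lemma wkernel_has_derivative:
  "((\<lambda>z. wkernel z w) has_derivative
    (\<lambda>h. (of_real pi * (h \<odot> vcnj w) - of_real (2 * pi * (z \<bullet> h))) * wkernel z w)) (at z)"
proof -
  have eq: "wkernel z w = of_real (exp (- pi * (norm w)\<^sup>2)) * exp (of_real pi * (z \<odot> vcnj w) - of_real (pi * (z \<bullet> z)))" for z
    unfolding wkernel_def rkernel_def exp_diff by (simp add: power2_norm_eq_inner exp_of_real[symmetric] exp_minus field_simps)
  have "((\<lambda>z. of_real pi * (z \<odot> vcnj w) - of_real (pi * (z \<bullet> z))) has_derivative
      (\<lambda>h. of_real pi * (h \<odot> vcnj w) - of_real (2 * pi * (z \<bullet> h)))) (at z)"
    by (rule has_derivative_eq_rhs, (rule derivative_intros)+)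
      (simp add: fun_eq_iff bprod.zero_right inner_commute algebra_simps)
  from has_derivative_mult_right[OF has_field_derivative_compose_FDERIV[OF DERIV_exp this], of "of_real (exp (- pi * (norm w)\<^sup>2))"]
  show ?thesis unfolding eq by (rule has_derivative_eq_rhs) (simp add: fun_eq_iff mult_ac)
qed

text \<open>Only the exponential \<open>wkernel\<close> contributes to the Wirtinger derivative; its exponent has
  derivative \<open>pi * cnj ((w - z) $ j)\<close>.\<close>

lemma wtrans_kernel_derivative:
  "\<exists>D. ((\<lambda>z. cmon js (w - z) * wkernel z w) has_derivative D) (at z) \<and>
    (\<forall>h. norm (D h) \<le> (real (length js) + 3 * pi) * (1 + norm (w - z)) ^ Suc (length js) * (1 + norm z) * norm (wkernel z w) * norm h) \<and>
    (\<forall>j. (D (axis j 1) - \<i> * D (axis j \<i>)) / 2 = of_real pi * (cmon (j # js) (w - z) * wkernel z w))"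
proof -
  obtain D where D: "((\<lambda>z. cmon js (w - z)) has_derivative D) (at z)"
    "\<And>h. norm (D h) \<le> real (length js) * (1 + norm (w - z)) ^ length js * norm h"
    "\<And>j. D (axis j \<i>) = - \<i> * D (axis j 1)" using cmon_has_derivative[of js w z] by blast
  define e where "e h = of_real pi * (h \<odot> vcnj w) - of_real (2 * pi * (z \<bullet> h))" for h
  define D' where "D' h = cmon js (w - z) * (e h * wkernel z w) + D h * wkernel z w" for h
  let ?r = "1 + norm (w - z)" and ?n = "length js" and ?s = "1 + norm z"
  have "((\<lambda>z. cmon js (w - z) * wkernel z w) has_derivative D') (at z)"
    unfolding D'_def e_def by (rule has_derivative_mult[OF D(1) wkernel_has_derivative])
  moreover have "norm (D' h) \<le> (real ?n + 3 * pi) * ?r ^ Suc ?n * ?s * norm (wkernel z w) * norm h" for h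
  proof -
    have "norm w \<le> norm (w - z) + norm z" using norm_triangle_sub[of w z] by (simp add: add.commute)
    moreover have "0 \<le> norm (w - z) * norm z" by simp
    moreover have "3 * (?r * ?s) = 3 + 3 * norm (w - z) + 3 * norm z + 3 * (norm (w - z) * norm z)"
      by (simp add: algebra_simps)
    ultimately have w: "norm w + 2 * norm z \<le> 3 * (?r * ?s)"
      using norm_ge_zero[of "w - z"] norm_ge_zero[of z] by linarith
    have 1: "norm (h \<odot> vcnj w) \<le> norm h * norm w" using norm_bprod_le[of h "vcnj w"] by (simp add: norm_vcnj)
    have 2: "\<bar>z \<bullet> h\<bar> \<le> norm z * norm h" by (rule Cauchy_Schwarz_ineq2)
    have "norm (e h) \<le> pi * norm (h \<odot> vcnj w) + 2 * pi * \<bar>z \<bullet> h\<bar>"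
      unfolding e_def by (rule order.trans[OF norm_triangle_ineq4]) (simp add: norm_mult abs_mult)
    also have "\<dots> \<le> pi * (norm h * norm w) + 2 * pi * (norm z * norm h)"
      by (intro add_mono mult_left_mono 1 2) auto
    also have "\<dots> = pi * norm h * (norm w + 2 * norm z)" by (simp add: algebra_simps)
    also have "\<dots> \<le> pi * norm h * (3 * (?r * ?s))" by (intro mult_left_mono w) auto
    finally have e: "norm (e h) \<le> pi * norm h * (3 * (?r * ?s))" .
    have "norm (D' h) \<le> norm (cmon js (w - z)) * (norm (e h) * norm (wkernel z w)) + norm (D h) * norm (wkernel z w)"
      unfolding D'_def by (rule order.trans[OF norm_triangle_ineq]) (simp only: norm_mult)
    also have "\<dots> \<le> ?r ^ ?n * (pi * norm h * (3 * (?r * ?s)) * norm (wkernel z w)) + (real ?n * ?r ^ ?n * norm h) * norm (wkernel z w)"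
      by (intro add_mono mult_mono mult_right_mono norm_cmon_le e D(2)) auto
    also have "real ?n * ?r ^ ?n * norm h \<le> real ?n * (?r ^ Suc ?n * ?s) * norm h"
    proof (intro mult_right_mono mult_left_mono)
      have "1 \<le> ?r * ?s" by (simp add: algebra_simps add_nonneg_nonneg)
      then have "?r ^ ?n * 1 \<le> ?r ^ ?n * (?r * ?s)" by (intro mult_left_mono) auto
      then show "?r ^ ?n \<le> ?r ^ Suc ?n * ?s" by (simp add: mult_ac)
    qed auto
    finally have "norm (D' h) \<le> ?r ^ ?n * (pi * norm h * (3 * (?r * ?s)) * norm (wkernel z w))
        + (real ?n * (?r ^ Suc ?n * ?s) * norm h) * norm (wkernel z w)"
      by (simp add: mult_right_mono)
    also have "\<dots> = (real ?n + 3 * pi) * ?r ^ Suc ?n * ?s * norm (wkernel z w) * norm h"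
      by (simp add: distrib_right distrib_left mult_ac)
    finally show ?thesis .
  qed
  moreover have "(D' (axis j 1) - \<i> * D' (axis j \<i>)) / 2 = of_real pi * (cmon (j # js) (w - z) * wkernel z w)" for j
  proof -
    have e1: "e (axis j 1) = of_real pi * cnj (w $ j) - of_real (2 * pi * Re (z $ j))"
      unfolding e_def by (simp add: bprod_commute[of "axis j _"] bprod_axis inner_axis inner_complex_def)
    have ei: "e (axis j \<i>) = of_real pi * (\<i> * cnj (w $ j)) - of_real (2 * pi * Im (z $ j))"
      unfolding e_def by (simp add: bprod_commute[of "axis j _"] bprod_axis inner_axis inner_complex_def)
    have "(e (axis j 1) - \<i> * e (axis j \<i>)) / 2 = of_real pi * cnj ((w - z) $ j)"
      unfolding e1 ei by (simp add: complex_eq_iff field_simps)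
    then have 1: "cmon js (w - z) * wkernel z w * ((e (axis j 1) - \<i> * e (axis j \<i>)) / 2)
        = of_real pi * (cmon (j # js) (w - z) * wkernel z w)" by (simp only: cmon_Cons mult_ac)
    have 2: "D (axis j 1) - \<i> * D (axis j \<i>) = 0" unfolding D(3) by (simp add: mult.assoc[symmetric])
    have "(D' (axis j 1) - \<i> * D' (axis j \<i>)) / 2
        = cmon js (w - z) * wkernel z w * ((e (axis j 1) - \<i> * e (axis j \<i>)) / 2)
          + (D (axis j 1) - \<i> * D (axis j \<i>)) * wkernel z w / 2"
      unfolding D'_def by (simp add: algebra_simps diff_divide_distrib add_divide_distrib)
    also have "\<dots> = of_real pi * (cmon (j # js) (w - z) * wkernel z w)"
      unfolding 1 2 by simp
    finally show ?thesis .
  qed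
  ultimately show ?thesis by blast
qed

lemma one_plus_norm_shift:
  fixes w z z0 :: "'a::real_normed_vector"
  assumes "dist z0 z < 1"
  shows "1 + norm (w - z0) \<le> 2 * (1 + norm (w - z))"
proof -
  have "norm (w - z0) \<le> norm (w - z) + norm (z - z0)"
    using norm_triangle_ineq[of "w - z" "z - z0"] by simp
  moreover have "norm (z - z0) < 1" using assms by (simp add: dist_norm norm_minus_commute)
  ultimately have "1 + norm (w - z0) \<le> 2 + norm (w - z)" by simp
  also have "\<dots> \<le> 2 * (1 + norm (w - z))" by simp
  finally show ?thesis .
qed

text \<open>The total derivative together with its decay, which justifies integration by parts, and the
  value of the Wirtinger derivatives.\<close>

definition wtrans_frechet ::
    "real \<Rightarrow> 'n list \<Rightarrow> (complex ^ 'n::finite \<Rightarrow> complex) \<Rightarrow> complex ^ 'n \<Rightarrow> (complex ^ 'n \<Rightarrow> complex) \<Rightarrow> bool"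
  where "wtrans_frechet K js G z D \<longleftrightarrow> (wtrans js G has_derivative D) (at z) \<and>
      (\<forall>h. norm (D h) \<le> K * ((1 + norm z) * exp (- pi * (norm z)\<^sup>2 / 2)) * norm h) \<and>
      (\<forall>j. (D (axis j 1) - \<i> * D (axis j \<i>)) / 2 = of_real pi * wtrans (j # js) G z)"

lemma wtrans_derivative:
  fixes G :: "complex ^ 'n::finite \<Rightarrow> complex"
  assumes G: "gauss_bounded C G"
  obtains K where "0 \<le> K" "\<And>z. \<exists>D. wtrans_frechet K js G z D"
proof -
  let ?M = "DIM(complex ^ 'n) + 2" and ?n = "length js"
  define L where "L = real ?n + 3 * pi"
  have L: "0 \<le> L" by (simp add: L_def)
  have C: "0 \<le> C" by (rule gauss_bounded_nonneg[OF G])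
  obtain E where E: "0 \<le> E" "\<And>r. 0 \<le> r \<Longrightarrow> (1 + r) ^ (Suc ?n + ?M) * exp (0 * r - pi / 2 * r\<^sup>2) \<le> E"
    using poly_times_gauss_bounded[of "pi / 2"] by (metis less_imp_le half_gt_zero pi_gt_zero)
  define dec where "dec v = 1 / (1 + norm v) ^ ?M" for v :: "complex ^ 'n"
  have dec: "integrable lborel dec" unfolding dec_def[abs_def] by (rule integrable_inverse_power)
  have dec_meas: "dec \<in> borel_measurable borel" using dec by auto
  have dec_shift: "integrable lborel (\<lambda>w. dec (w - z))" "(LINT w|lborel. dec (w - z)) = (LINT w|lborel. dec w)" for z
    using integrable_translate_iff[OF dec_meas, of "- z"] integral_translate[OF dec_meas, of "- z"] dec by simp_all
  define P where "P z w D \<longleftrightarrow> ((\<lambda>z. cmon js (w - z) * wkernel z w) has_derivative D) (at z) \<and>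
    (\<forall>h. norm (D h) \<le> L * (1 + norm (w - z)) ^ Suc ?n * (1 + norm z) * norm (wkernel z w) * norm h) \<and>
    (\<forall>j. (D (axis j 1) - \<i> * D (axis j \<i>)) / 2 = of_real pi * (cmon (j # js) (w - z) * wkernel z w))" for z w D
  define D where "D z w = (SOME D. P z w D)" for z w
  have "\<exists>D. P z w D" for z w
    unfolding P_def L_def by (rule wtrans_kernel_derivative)
  then have P: "P z w (D z w)" for z w
    unfolding D_def by (rule someI_ex)
  have der: "((\<lambda>z. G w * (cmon js (w - z) * wkernel z w)) has_derivative (\<lambda>h. G w * D z w h)) (at z)" for z w
    using P[of z w] unfolding P_def by (intro has_derivative_mult_right) blast
  define c where "c z = C * L * E * ((1 + norm z) * exp (- pi * (norm z)\<^sup>2 / 2))" for z :: "complex ^ 'n"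
  have bound: "norm (G w * D z w h) \<le> c z * dec (w - z) * norm h" for z w h
  proof -
    let ?r = "1 + norm (w - z)"
    let ?e = "exp (- pi * (norm z)\<^sup>2 / 2)" and ?f = "exp (- pi * (norm w)\<^sup>2 / 2)" and ?g = "exp (- pi * (norm (w - z))\<^sup>2 / 2)"
    have pos: "0 < ?r ^ ?M" by (simp add: add_pos_nonneg)
    have "norm (G w * D z w h) \<le> (C * exp (pi * (norm w)\<^sup>2 / 2)) * (L * ?r ^ Suc ?n * (1 + norm z) * norm (wkernel z w) * norm h)"
      unfolding norm_mult using P[of z w] C unfolding P_def
      by (intro mult_mono gauss_bounded_norm_le[OF G]) auto
    also have "\<dots> = C * L * (1 + norm z) * ?e * norm h * ((exp (pi * (norm w)\<^sup>2 / 2) * ?f) * (?r ^ Suc ?n * ?g))"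
      unfolding norm_wkernel by (simp add: mult_ac)
    also have "exp (pi * (norm w)\<^sup>2 / 2) * ?f = 1" unfolding exp_add[symmetric] by simp
    also have "?r ^ Suc ?n * ?g = (?r ^ (Suc ?n + ?M) * exp (0 * norm (w - z) - pi / 2 * (norm (w - z))\<^sup>2)) / ?r ^ ?M"
      using pos by (simp only: power_add) simp
    also have "C * L * (1 + norm z) * ?e * norm h * (1 * ((?r ^ (Suc ?n + ?M) * exp (0 * norm (w - z) - pi / 2 * (norm (w - z))\<^sup>2)) / ?r ^ ?M))
        \<le> C * L * (1 + norm z) * ?e * norm h * (1 * (E / ?r ^ ?M))"
      using C L pos by (intro mult_left_mono divide_right_mono E(2)) auto
    also have "\<dots> = c z * dec (w - z) * norm h"
      by (simp add: c_def dec_def)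
    finally show ?thesis .
  qed
  have int: "integrable lborel (\<lambda>w. G w * (cmon js (w - z) * wkernel z w))" for js z
  proof -
    have "integrable lborel (\<lambda>w. of_real (exp (- pi * (norm z)\<^sup>2)) * (G w * cmon js (w - z) * rkernel z w))"
      by (intro integrable_mult_right kconv_integrable[OF G poly_growth_cmon])
    then show ?thesis by (simp add: wkernel_def mult_ac)
  qed
  have deriv: "integrable lborel (\<lambda>w. G w * D z0 w h)"
    "(wtrans js G has_derivative (\<lambda>h. LINT w|lborel. G w * D z0 w h)) (at z0)" for z0 h
  proof -
    define B where "B w = C * L * E * (2 + norm z0) * 2 ^ ?M * dec (w - z0)" for w
    have B: "integrable lborel B" unfolding B_def by (intro integrable_mult_right dec_shift)
    have le: "norm (G w * D z w h) \<le> B w * norm h" if z: "z \<in> ball z0 1" for z w h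
    proof -
      have "c z \<le> C * L * E * ((2 + norm z0) * 1)"
        unfolding c_def
      proof (intro mult_left_mono mult_mono)
        show "1 + norm z \<le> 2 + norm z0"
          using z norm_triangle_ineq2[of z z0] by (simp add: dist_norm norm_minus_commute)
      qed (use C L E in auto)
      moreover have "dec (w - z) \<le> 2 ^ ?M * dec (w - z0)"
      proof -
        have "(1 + norm (w - z0)) ^ ?M \<le> (2 * (1 + norm (w - z))) ^ ?M"
          using z by (intro power_mono one_plus_norm_shift) auto
        then have le: "(1 + norm (w - z0)) ^ ?M \<le> 2 ^ ?M * (1 + norm (w - z)) ^ ?M"
          by (simp only: power_mult_distrib)
        have pos: "0 < (1 + norm (w - z)) ^ ?M" "0 < (1 + norm (w - z0)) ^ ?M" by (simp_all add: add_pos_nonneg)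
        have "1 / (1 + norm (w - z)) ^ ?M \<le> 2 ^ ?M / (1 + norm (w - z0)) ^ ?M"
          using le pos by (subst frac_le_eq) (simp_all only: divide_le_0_iff, simp_all add: mult.commute divide_nonpos_pos)
        then show ?thesis by (simp add: dec_def)
      qed
      ultimately have "c z * dec (w - z) \<le> (C * L * E * ((2 + norm z0) * 1)) * (2 ^ ?M * dec (w - z0))"
        using C L E by (intro mult_mono) (auto simp: dec_def)
      also have "\<dots> = B w" by (simp add: B_def)
      finally have "c z * dec (w - z) * norm h \<le> B w * norm h" by (rule mult_right_mono) simp
      then show ?thesis using bound[of w z h] by linarith
    qed
    note * = has_derivative_lebesgue_integral[where q="\<lambda>z w. G w * (cmon js (w - z) * wkernel z w)"
        and D="\<lambda>z w h. G w * D z w h" and B=B and ?z0.0=z0 and M=lborel, OF der le int B]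
    show "integrable lborel (\<lambda>w. G w * D z0 w h)" by (rule *(1))
    show "(wtrans js G has_derivative (\<lambda>h. LINT w|lborel. G w * D z0 w h)) (at z0)"
      using *(2) unfolding wtrans_eq[abs_def] by simp
  qed
  define I where "I = (LINT w|lborel. dec w)"
  have I: "0 \<le> I" unfolding I_def by (rule Bochner_Integration.integral_nonneg) (simp add: dec_def)
  show thesis
  proof (rule that)
    show "0 \<le> C * L * E * I" using C L E I by simp
    fix z0
    show "\<exists>D. wtrans_frechet (C * L * E * I) js G z0 D"
      unfolding wtrans_frechet_def
    proof (intro exI conjI allI)
      show "(wtrans js G has_derivative (\<lambda>h. LINT w|lborel. G w * D z0 w h)) (at z0)" by (rule deriv(2))
      show "norm (LINT w|lborel. G w * D z0 w h)
          \<le> C * L * E * I * ((1 + norm z0) * exp (- pi * (norm z0)\<^sup>2 / 2)) * norm h" for h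
      proof -
        have "norm (LINT w|lborel. G w * D z0 w h) \<le> (LINT w|lborel. norm (G w * D z0 w h))"
          by (rule integral_norm_bound)
        also have "\<dots> \<le> (LINT w|lborel. c z0 * dec (w - z0) * norm h)"
          by (rule integral_mono[OF integrable_norm[OF deriv(1)] _ bound])
            (intro integrable_mult_left integrable_mult_right dec_shift)
        also have "\<dots> = c z0 * I * norm h"
          using dec_shift(2)[of z0] by (simp add: I_def)
        finally show ?thesis by (simp add: c_def mult_ac)
      qed
      show "((LINT w|lborel. G w * D z0 w (axis j 1)) - \<i> * (LINT w|lborel. G w * D z0 w (axis j \<i>))) / 2
          = of_real pi * wtrans (j # js) G z0" for j
      proof -
        have "((LINT w|lborel. G w * D z0 w (axis j 1)) - \<i> * (LINT w|lborel. G w * D z0 w (axis j \<i>))) / 2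
            = (LINT w|lborel. (G w * D z0 w (axis j 1) - \<i> * (G w * D z0 w (axis j \<i>))) / 2)"
          using deriv(1)[of z0] by simp
        also have "\<dots> = (LINT w|lborel. of_real pi * (G w * (cmon (j # js) (w - z0) * wkernel z0 w)))"
        proof (rule Bochner_Integration.integral_cong[OF refl])
          fix w
          have "(G w * D z0 w (axis j 1) - \<i> * (G w * D z0 w (axis j \<i>))) / 2
              = G w * ((D z0 w (axis j 1) - \<i> * D z0 w (axis j \<i>)) / 2)"
            by (simp add: algebra_simps)
          also have "(D z0 w (axis j 1) - \<i> * D z0 w (axis j \<i>)) / 2 = of_real pi * (cmon (j # js) (w - z0) * wkernel z0 w)"
            using P[of z0 w] unfolding P_def by blast
          finally show "(G w * D z0 w (axis j 1) - \<i> * (G w * D z0 w (axis j \<i>))) / 2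
              = of_real pi * (G w * (cmon (j # js) (w - z0) * wkernel z0 w))" by (simp only: mult.left_commute)
        qed
        also have "\<dots> = of_real pi * wtrans (j # js) G z0"
          unfolding wtrans_eq by (rule integral_mult_right_zero)
        finally show ?thesis .
      qed
    qed
  qed
qed

lemma iterated_wirtinger_wtrans:
  assumes G: "gauss_bounded C G"
  shows "foldr wirtinger js (wtrans [] G) = (\<lambda>z. of_real pi ^ length js * wtrans js G z)"
proof (induction js)
  case (Cons j js)
  show ?case
  proof
    fix z
    obtain K D where "wtrans_frechet K js G z D"
      using wtrans_derivative[OF G, of js] by blast
    then have D: "(wtrans js G has_derivative D) (at z)"
      "(D (axis j 1) - \<i> * D (axis j \<i>)) / 2 = of_real pi * wtrans (j # js) G z"
      unfolding wtrans_frechet_def by simp_all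
    have "wirtinger j (\<lambda>z. of_real pi ^ length js * wtrans js G z) z
        = (of_real pi ^ length js * D (axis j 1) - \<i> * (of_real pi ^ length js * D (axis j \<i>))) / 2"
      by (rule wirtinger_eqI) (rule has_derivative_mult_right[OF D(1)])
    also have "\<dots> = of_real pi ^ length js * ((D (axis j 1) - \<i> * D (axis j \<i>)) / 2)"
      by (simp add: algebra_simps)
    finally show "foldr wirtinger (j # js) (wtrans [] G) z = of_real pi ^ length (j # js) * wtrans (j # js) G z"
      unfolding D(2) by (simp add: Cons mult_ac)
  qed
qed simp

text \<open>Integration by parts: the exponential is antiholomorphic in \<open>w\<close>, so the Wirtinger derivative
  only hits the monomial and the transform.\<close>

lemma wtrans_by_parts:
  fixes G :: "complex ^ 'n::finite \<Rightarrow> complex"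
  assumes G: "gauss_bounded C G"
  shows "integrable lborel (\<lambda>w. mon js (w - z) * exp (of_real pi * (z \<odot> vcnj w)) * wtrans is G w)"
    and "of_real pi * (LINT w|lborel. mon (j # js) (w - z) * exp (of_real pi * (z \<odot> vcnj w)) * wtrans (j # is) G w)
      = - (of_nat (Suc (count_list js j)) * (LINT w|lborel. mon js (w - z) * exp (of_real pi * (z \<odot> vcnj w)) * wtrans is G w))"
proof -
  let ?M = "DIM(complex ^ 'n) + 2"
  define ez where "ez w = exp (of_real pi * (z \<odot> vcnj w))" for w
  have ez_le: "norm (ez w) \<le> exp (pi * norm z * norm w)" for w
  proof -
    have "z \<bullet> w \<le> norm z * norm w" by (rule norm_cauchy_schwarz)
    then show ?thesis by (simp add: ez_def Re_bprod_vcnj mult.assoc)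
  qed
  have ez_deriv: "(ez has_derivative (\<lambda>h. of_real pi * (z \<odot> vcnj h) * ez w)) (at w)" for w
  proof -
    have "((\<lambda>w. of_real pi * (z \<odot> vcnj w)) has_derivative (\<lambda>h. of_real pi * (z \<odot> vcnj h))) (at w)"
      by (rule has_derivative_eq_rhs, (rule derivative_intros)+) (simp add: fun_eq_iff bprod.zero_left)
    from has_field_derivative_compose_FDERIV[OF DERIV_exp this] show ?thesis
      by (simp add: ez_def[abs_def])
  qed
  have shift: "1 + norm (w - z) \<le> (1 + norm z) * (1 + norm w)" for w
  proof -
    have "0 \<le> norm z * norm w" by simp
    then have "1 + (norm w + norm z) \<le> (1 + norm z) * (1 + norm w)" by (simp add: algebra_simps)
    then show ?thesis using norm_triangle_ineq4[of w z] by linarith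
  qed
  have mon_le: "norm (mon ks (w - z)) \<le> (1 + norm z) ^ length ks * (1 + norm w) ^ length ks" for ks w
  proof -
    have "norm (mon ks (w - z)) \<le> (1 + norm (w - z)) ^ length ks" by (rule norm_mon_le)
    also have "\<dots> \<le> ((1 + norm z) * (1 + norm w)) ^ length ks" by (intro power_mono shift) auto
    finally show ?thesis by (simp only: power_mult_distrib)
  qed
  have decay: "\<exists>E. \<forall>w :: complex ^ 'n. (1 + norm w) ^ N * (exp (pi * norm z * norm w) * exp (- pi * (norm w)\<^sup>2 / 2)) \<le> E / (1 + norm w) ^ ?M" for N
  proof -
    have "0 < pi / 2" by simp
    then obtain E where E: "\<And>r. 0 \<le> r \<Longrightarrow> (1 + r) ^ (N + ?M) * exp (pi * norm z * r - pi / 2 * r\<^sup>2) \<le> E"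
      using poly_times_gauss_bounded by blast
    show ?thesis
    proof (intro exI allI)
      fix w :: "complex ^ 'n"
      have pos: "0 < (1 + norm w) ^ ?M" by (simp add: add_pos_nonneg)
      have "(1 + norm w) ^ N * (exp (pi * norm z * norm w) * exp (- pi * (norm w)\<^sup>2 / 2)) * (1 + norm w) ^ ?M
          = (1 + norm w) ^ (N + ?M) * exp (pi * norm z * norm w - pi / 2 * (norm w)\<^sup>2)"
        unfolding exp_add[symmetric] power_add by (simp add: mult_ac)
      also have "\<dots> \<le> E" by (rule E) simp
      finally show "(1 + norm w) ^ N * (exp (pi * norm z * norm w) * exp (- pi * (norm w)\<^sup>2 / 2)) \<le> E / (1 + norm w) ^ ?M"
        using pos by (subst pos_le_divide_eq)
    qed
  qed
  have wt_cont: "continuous_on UNIV (wtrans is G)" for "is"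
  proof (rule continuous_at_imp_continuous_on, rule ballI)
    fix w
    obtain K D where "wtrans_frechet K is G w D"
      using wtrans_derivative[OF G, of "is"] by blast
    then have "(wtrans is G has_derivative D) (at w)" by (simp add: wtrans_frechet_def)
    then show "isCont (wtrans is G) w" by (rule has_derivative_continuous)
  qed
  have int: "integrable lborel (\<lambda>w. mon ks (w - z) * ez w * wtrans is G w)" for ks "is"
  proof -
    obtain A where A: "0 \<le> A" "\<And>w. norm (wtrans is G w) \<le> A * exp (- pi * (norm w)\<^sup>2 / 2)"
      using wtrans_bound[OF G] by blast
    obtain E where E: "\<And>w :: complex ^ 'n. (1 + norm w) ^ length ks * (exp (pi * norm z * norm w) * exp (- pi * (norm w)\<^sup>2 / 2)) \<le> E / (1 + norm w) ^ ?M"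
      using decay by blast
    show ?thesis
    proof (rule integrable_of_decay)
      have "continuous_on UNIV (\<lambda>w. mon ks (w - z))"
        by (intro continuous_on_compose2[OF continuous_on_mon, of UNIV] continuous_intros) auto
      then show "(\<lambda>w. mon ks (w - z) * ez w * wtrans is G w) \<in> borel_measurable borel"
        unfolding ez_def by (intro borel_measurable_continuous_onI continuous_intros wt_cont)
      fix w
      have "norm (mon ks (w - z) * ez w * wtrans is G w)
          \<le> ((1 + norm z) ^ length ks * (1 + norm w) ^ length ks) * exp (pi * norm z * norm w) * (A * exp (- pi * (norm w)\<^sup>2 / 2))"
        unfolding norm_mult using A(1) by (intro mult_mono mon_le ez_le A(2)) auto
      also have "\<dots> = (1 + norm z) ^ length ks * A * ((1 + norm w) ^ length ks * (exp (pi * norm z * norm w) * exp (- pi * (norm w)\<^sup>2 / 2)))"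
        by (simp add: mult_ac)
      also have "\<dots> \<le> (1 + norm z) ^ length ks * A * (E / (1 + norm w) ^ ?M)"
        using A(1) by (intro mult_left_mono E) auto
      finally show "norm (mon ks (w - z) * ez w * wtrans is G w) \<le> (1 + norm z) ^ length ks * A * E / (1 + norm w) ^ ?M"
        by simp
    qed
  qed
  then show "integrable lborel (\<lambda>w. mon js (w - z) * exp (of_real pi * (z \<odot> vcnj w)) * wtrans is G w)"
    by (simp add: ez_def)
  let ?ks = "j # js"
  define u where "u w = mon ?ks (w - z) * ez w * wtrans is G w" for w
  define Q where "Q w D \<longleftrightarrow> ((\<lambda>w. mon ?ks (w - z)) has_derivative D) (at w) \<and>
    (\<forall>h. norm (D h) \<le> real (length ?ks) * (1 + norm (w - z)) ^ length ?ks * norm h) \<and>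
    (\<forall>j. D (axis j \<i>) = \<i> * D (axis j 1)) \<and>
    (\<forall>j. D (axis j 1) = of_nat (count_list ?ks j) * mon (remove1 j ?ks) (w - z))" for w D
  define Dm where "Dm w = (SOME D. Q w D)" for w
  have "\<exists>D. Q w D" for w unfolding Q_def by (rule mon_has_derivative)
  then have "Q w (Dm w)" for w unfolding Dm_def by (rule someI_ex)
  then have Dm: "((\<lambda>w. mon ?ks (w - z)) has_derivative Dm w) (at w)"
    "norm (Dm w h) \<le> real (length ?ks) * (1 + norm (w - z)) ^ length ?ks * norm h"
    "Dm w (axis j \<i>) = \<i> * Dm w (axis j 1)"
    "Dm w (axis j 1) = of_nat (Suc (count_list js j)) * mon js (w - z)" for w h
    unfolding Q_def by simp_all
  obtain A where A: "0 \<le> A" "\<And>w. norm (wtrans is G w) \<le> A * exp (- pi * (norm w)\<^sup>2 / 2)"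
    using wtrans_bound[OF G] by blast
  obtain K where K0: "0 \<le> K" and K: "\<And>w. \<exists>D. wtrans_frechet K is G w D"
    using wtrans_derivative[OF G, of "is"] by blast
  define Dv where "Dv w = (SOME D. wtrans_frechet K is G w D)" for w
  have "wtrans_frechet K is G w (Dv w)" for w unfolding Dv_def by (rule someI_ex[OF K])
  then have Dv: "(wtrans is G has_derivative Dv w) (at w)"
    "norm (Dv w h) \<le> K * ((1 + norm w) * exp (- pi * (norm w)\<^sup>2 / 2)) * norm h"
    "(Dv w (axis j 1) - \<i> * Dv w (axis j \<i>)) / 2 = of_real pi * wtrans (j # is) G w" for w h
    unfolding wtrans_frechet_def by simp_all
  define D where "D w h = (mon ?ks (w - z) * ez w) * Dv w h
      + (mon ?ks (w - z) * (of_real pi * (z \<odot> vcnj h) * ez w) + Dm w h * ez w) * wtrans is G w" for w h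
  have u_deriv: "(u has_derivative D w) (at w)" for w
    unfolding u_def[abs_def] D_def
    by (rule has_derivative_mult[OF has_derivative_mult[OF Dm(1) ez_deriv] Dv(1)])
  have u_int: "integrable lborel u" unfolding u_def[abs_def] by (rule int)
  define n where "n = length ?ks"
  obtain E where E: "\<And>w :: complex ^ 'n. (1 + norm w) ^ (n + 1) * (exp (pi * norm z * norm w) * exp (- pi * (norm w)\<^sup>2 / 2)) \<le> E / (1 + norm w) ^ ?M"
    using decay by blast
  define c where "c = (1 + norm z) ^ n * (K + pi * norm z * A + real n * A)"
  have D_bound: "norm (D w h) \<le> c * E * norm h / (1 + norm w) ^ ?M" for w h
  proof -
    let ?r = "1 + norm w" and ?x = "exp (pi * norm z * norm w)" and ?g = "exp (- pi * (norm w)\<^sup>2 / 2)" and ?s = "(1 + norm z) ^ n"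
    have r: "?r ^ n \<le> ?r ^ (n + 1)" by (rule power_increasing) auto
    have m: "norm (mon ?ks (w - z)) \<le> ?s * ?r ^ n" unfolding n_def by (rule mon_le)
    have 1: "norm (mon ?ks (w - z) * ez w * Dv w h) \<le> (?s * ?r ^ n) * ?x * (K * (?r * ?g) * norm h)"
      unfolding norm_mult by (intro mult_mono m ez_le Dv(2)) auto
    have 2: "norm (mon ?ks (w - z) * (of_real pi * (z \<odot> vcnj h) * ez w) * wtrans is G w)
        \<le> (?s * ?r ^ (n + 1)) * (pi * (norm z * norm h) * ?x) * (A * ?g)"
      unfolding norm_mult
    proof (intro mult_mono ez_le A(2))
      show "norm (mon ?ks (w - z)) \<le> ?s * ?r ^ (n + 1)"
        by (rule order.trans[OF m]) (intro mult_left_mono r, simp)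
      show "norm (z \<odot> vcnj h) \<le> norm z * norm h" using norm_bprod_le[of z "vcnj h"] by (simp add: norm_vcnj)
    qed auto
    have 3: "norm (Dm w h * ez w * wtrans is G w) \<le> (real n * (?s * ?r ^ (n + 1)) * norm h) * ?x * (A * ?g)"
      unfolding norm_mult
    proof (intro mult_mono ez_le A(2))
      have "(1 + norm (w - z)) ^ n \<le> ?s * ?r ^ n"
        unfolding power_mult_distrib[symmetric] by (intro power_mono shift) auto
      also have "\<dots> \<le> ?s * ?r ^ (n + 1)" by (intro mult_left_mono r) simp
      finally have "real n * (1 + norm (w - z)) ^ n * norm h \<le> real n * (?s * ?r ^ (n + 1)) * norm h"
        by (intro mult_right_mono mult_left_mono) auto
      then show "norm (Dm w h) \<le> real n * (?s * ?r ^ (n + 1)) * norm h"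
        using Dm(2)[of w h] unfolding n_def[symmetric] by linarith
    qed auto
    have "norm (D w h) \<le> norm (mon ?ks (w - z) * ez w * Dv w h)
        + (norm (mon ?ks (w - z) * (of_real pi * (z \<odot> vcnj h) * ez w) * wtrans is G w) + norm (Dm w h * ez w * wtrans is G w))"
      unfolding D_def distrib_right by (rule order.trans[OF norm_triangle_ineq add_left_mono[OF norm_triangle_ineq]])
    also have "\<dots> \<le> (?s * ?r ^ n) * ?x * (K * (?r * ?g) * norm h)
        + ((?s * ?r ^ (n + 1)) * (pi * (norm z * norm h) * ?x) * (A * ?g) + (real n * (?s * ?r ^ (n + 1)) * norm h) * ?x * (A * ?g))"
      by (intro add_mono 1 2 3)
    also have "\<dots> = c * norm h * (?r ^ (n + 1) * (?x * ?g))"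
      unfolding c_def by (simp add: distrib_right distrib_left mult_ac)
    also have "\<dots> \<le> c * norm h * (E / ?r ^ ?M)"
      using K0 A(1) unfolding c_def by (intro mult_left_mono E) auto
    finally show ?thesis by (simp add: mult_ac)
  qed
  have zero: "(LINT w|lborel. D w v) = 0" and D_int: "integrable lborel (\<lambda>w. D w v)" for v
  proof -
    show "(LINT w|lborel. D w v) = 0"
      by (rule integral_directional_derivative_eq_0[OF u_deriv u_int D_bound])
    have u_meas: "u \<in> borel_measurable borel" using u_int by auto
    define e where "e n = inverse (real (Suc n))" for n
    have e: "0 < e n" for n by (simp add: e_def)
    have elim: "e \<longlonglongrightarrow> 0" unfolding e_def[abs_def] by (rule LIMSEQ_inverse_real_of_nat)
    have "(\<lambda>w. D w v) \<in> borel_measurable borel"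
    proof (rule borel_measurable_LIMSEQ_metric)
      show "(\<lambda>w. (1 / e n) *\<^sub>R (u (w + e n *\<^sub>R v) - u w)) \<in> borel_measurable borel" for n
        using u_meas by measurable
      show "(\<lambda>n. (1 / e n) *\<^sub>R (u (w + e n *\<^sub>R v) - u w)) \<longlonglongrightarrow> D w v" for w
        by (rule difference_quotient_LIMSEQ[OF u_deriv e elim])
    qed
    then show "integrable lborel (\<lambda>w. D w v)"
      by (rule integrable_of_decay[OF _ D_bound])
  qed
  let ?I = "LINT w|lborel. mon js (w - z) * ez w * wtrans is G w"
  let ?J = "LINT w|lborel. mon ?ks (w - z) * ez w * wtrans (j # is) G w"
  have "0 = ((LINT w|lborel. D w (axis j 1)) - \<i> * (LINT w|lborel. D w (axis j \<i>))) / 2"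
    by (simp add: zero)
  also have "\<dots> = (LINT w|lborel. (D w (axis j 1) - \<i> * D w (axis j \<i>)) / 2)"
    using D_int by simp
  also have "\<dots> = (LINT w|lborel. of_real pi * (mon ?ks (w - z) * ez w * wtrans (j # is) G w)
      + of_nat (Suc (count_list js j)) * (mon js (w - z) * ez w * wtrans is G w))"
  proof (rule Bochner_Integration.integral_cong[OF refl])
    fix w
    have 1: "z \<odot> vcnj (axis j 1) = z $ j" "z \<odot> vcnj (axis j \<i>) = - \<i> * z $ j"
    proof -
      have "vcnj (axis j 1) = axis j 1" "vcnj (axis j \<i>) = axis j (- \<i>)"
        by (auto simp: vec_eq_iff axis_def)
      then show "z \<odot> vcnj (axis j 1) = z $ j" "z \<odot> vcnj (axis j \<i>) = - \<i> * z $ j"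
        by (simp_all add: bprod_axis)
    qed
    have "(D w (axis j 1) - \<i> * D w (axis j \<i>)) / 2
        = mon ?ks (w - z) * ez w * ((Dv w (axis j 1) - \<i> * Dv w (axis j \<i>)) / 2)
        + mon ?ks (w - z) * of_real pi * ez w * wtrans is G w * ((z \<odot> vcnj (axis j 1) - \<i> * (z \<odot> vcnj (axis j \<i>))) / 2)
        + (Dm w (axis j 1) - \<i> * Dm w (axis j \<i>)) / 2 * ez w * wtrans is G w"
      unfolding D_def by (simp add: field_simps del: mon_Cons)
    also have "(z \<odot> vcnj (axis j 1) - \<i> * (z \<odot> vcnj (axis j \<i>))) / 2 = 0"
      unfolding 1 by (simp add: mult.assoc[symmetric])
    also have "(Dm w (axis j 1) - \<i> * Dm w (axis j \<i>)) / 2 = of_nat (Suc (count_list js j)) * mon js (w - z)"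
      unfolding Dm(3) Dm(4) by (simp add: mult.assoc[symmetric] del: of_nat_Suc)
    finally show "(D w (axis j 1) - \<i> * D w (axis j \<i>)) / 2
        = of_real pi * (mon ?ks (w - z) * ez w * wtrans (j # is) G w)
          + of_nat (Suc (count_list js j)) * (mon js (w - z) * ez w * wtrans is G w)"
      unfolding Dv(3) by (simp add: mult_ac del: of_nat_Suc mon_Cons)
  qed
  also have "\<dots> = of_real pi * ?J + of_nat (Suc (count_list js j)) * ?I"
    using int[of ?ks "j # is"] int[of js "is"] by (simp del: of_nat_Suc mon_Cons)
  finally have "of_real pi * ?J + of_nat (Suc (count_list js j)) * ?I = 0" by (rule sym)
  then show "of_real pi * (LINT w|lborel. mon (j # js) (w - z) * exp (of_real pi * (z \<odot> vcnj w)) * wtrans (j # is) G w)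
      = - (of_nat (Suc (count_list js j)) * (LINT w|lborel. mon js (w - z) * exp (of_real pi * (z \<odot> vcnj w)) * wtrans is G w))"
    unfolding eq_neg_iff_add_eq_0 ez_def .
qed

text \<open>Each integration by parts removes one letter from \<open>js\<close> on both sides and contributes a nonzero
  factor; its value does not depend on \<open>G\<close> and \<open>z\<close>.\<close>

lemma wtrans_mon_integral:
  "\<exists>c. c \<noteq> 0 \<and> (\<forall>C (G :: complex ^ 'n::finite \<Rightarrow> complex) z. gauss_bounded C G \<longrightarrow>
    (LINT w|lborel. mon js (w - z) * exp (of_real pi * (z \<odot> vcnj w)) * wtrans js G w)
      = c * (LINT w|lborel. exp (of_real pi * (z \<odot> vcnj w)) * wtrans [] G w))"
proof (induction js)
  case Nil
  show ?case by (intro exI[of _ 1]) simp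
next
  case (Cons j js)
  then obtain c where c: "c \<noteq> 0" "\<And>C (G :: complex ^ 'n \<Rightarrow> complex) z. gauss_bounded C G \<Longrightarrow>
    (LINT w|lborel. mon js (w - z) * exp (of_real pi * (z \<odot> vcnj w)) * wtrans js G w)
      = c * (LINT w|lborel. exp (of_real pi * (z \<odot> vcnj w)) * wtrans [] G w)" by blast
  let ?d = "- (of_nat (Suc (count_list js j)) * c) / of_real pi"
  have "?d \<noteq> 0" using c(1) by (simp del: of_nat_Suc)
  moreover have "(LINT w|lborel. mon (j # js) (w - z) * exp (of_real pi * (z \<odot> vcnj w)) * wtrans (j # js) G w)
      = ?d * (LINT w|lborel. exp (of_real pi * (z \<odot> vcnj w)) * wtrans [] G w)"
    if G: "gauss_bounded C G" for C z and G :: "complex ^ 'n \<Rightarrow> complex"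
  proof -
    let ?X = "LINT w|lborel. mon (j # js) (w - z) * exp (of_real pi * (z \<odot> vcnj w)) * wtrans (j # js) G w"
    have "of_real pi * ?X = - (of_nat (Suc (count_list js j)) * (c * (LINT w|lborel. exp (of_real pi * (z \<odot> vcnj w)) * wtrans [] G w)))"
      using wtrans_by_parts(2)[OF G, of j js z js] unfolding c(2)[OF G] .
    then have "of_real pi * ?X = of_real pi * (?d * (LINT w|lborel. exp (of_real pi * (z \<odot> vcnj w)) * wtrans [] G w))"
      by (simp add: mult.assoc del: of_nat_Suc mon_Cons)
    then show ?thesis by (simp only: mult_cancel_left of_real_eq_0_iff pi_neq_zero) simp
  qed
  ultimately show ?case by blast
qed

text \<open>After the integrations by parts only \<open>kconv (\<lambda>_. 1)\<close> is left, which reproduces \<open>G\<close>. So the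
  polyanalytic transform can be inverted by an operator of the same kind.\<close>

lemma kconv_mon_cmon:
  "\<exists>c. c \<noteq> 0 \<and> (\<forall>C (G :: complex ^ 'n::finite \<Rightarrow> complex) z. gauss_bounded C G \<longrightarrow> slice_entire G \<longrightarrow>
    kconv (mon js) (kconv (cmon js) G) z = c * G z)"
proof -
  obtain c where c: "c \<noteq> 0" "\<And>C (G :: complex ^ 'n \<Rightarrow> complex) z. gauss_bounded C G \<Longrightarrow>
    (LINT w|lborel. mon js (w - z) * exp (of_real pi * (z \<odot> vcnj w)) * wtrans js G w)
      = c * (LINT w|lborel. exp (of_real pi * (z \<odot> vcnj w)) * wtrans [] G w)"
    using wtrans_mon_integral by blast
  have eq: "kconv (mon ks) (kconv (cmon is) G) z = (LINT w|lborel. mon ks (w - z) * exp (of_real pi * (z \<odot> vcnj w)) * wtrans is G w)"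
    for ks "is" z and G :: "complex ^ 'n \<Rightarrow> complex"
    unfolding kconv_eq[of "mon ks"] rkernel_def[of z] wtrans_def by (simp only: mult_ac)
  have one: "mon [] = (\<lambda>_ :: complex ^ 'n. 1)" "cmon [] = (\<lambda>_ :: complex ^ 'n. 1)"
    by (simp_all add: fun_eq_iff)
  let ?g = "gauss_mass TYPE('n)"
  have "kconv (mon js) (kconv (cmon js) G) z = (c * ?g * ?g) * G z"
    if G: "gauss_bounded C G" and entire: "slice_entire G" for C G and z :: "complex ^ 'n"
  proof -
    have "kconv (mon js) (kconv (cmon js) G) z = c * kconv (mon []) (kconv (cmon []) G) z"
      unfolding eq c(2)[OF G] by simp
    also have "kconv (cmon []) G = (\<lambda>w. ?g * G w)"
      unfolding one using reproducing_formula[OF G entire] by (simp add: fun_eq_iff)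
    also have "kconv (mon []) (\<lambda>w. ?g * G w) z = ?g * kconv (\<lambda>_. 1) G z"
      unfolding one kconv_eq by (simp add: mult.assoc)
    also have "\<dots> = ?g * (?g * G z)" by (simp only: reproducing_formula[OF G entire])
    finally show ?thesis by (simp add: mult.assoc)
  qed
  moreover have "c * ?g * ?g \<noteq> 0" using c(1) gauss_mass_nonzero by simp
  ultimately show ?thesis by blast
qed

section \<open>The Gaussian integral\<close>

context
  fixes a :: "complex ^ 'n::finite"
begin

text \<open>For \<open>t = 1\<close> and \<open>a = z + w\<close> this is the product of two Bargmann kernels up to a scalar; the
  parameter \<open>t\<close> connects it with the real Gaussian.\<close>

definition gint :: "real \<Rightarrow> real ^ 'n \<Rightarrow> complex"
  where "gint t x = exp (of_real (2 * pi * t) * (vcomplex x \<odot> a) - of_real (2 * pi * (x \<bullet> x)))"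

lemma gint_decay:
  "\<exists>E\<ge>0. \<forall>t x. \<bar>t\<bar> \<le> T \<longrightarrow> (1 + norm x) ^ N * norm (gint t x) \<le> E / (1 + norm x) ^ M"
proof -
  have "0 < 2 * pi" by simp
  then obtain E where E: "0 < E" "\<And>r. 0 \<le> r \<Longrightarrow> (1 + r) ^ (N + M) * exp (2 * pi * T * norm a * r - 2 * pi * r\<^sup>2) \<le> E"
    using poly_times_gauss_bounded by blast
  have "(1 + norm x) ^ N * norm (gint t x) \<le> E / (1 + norm x) ^ M" if t: "\<bar>t\<bar> \<le> T" for t x
  proof -
    have pos: "0 < (1 + norm x) ^ M" by (simp add: add_pos_nonneg)
    have "t * Re (vcomplex x \<odot> a) \<le> \<bar>t\<bar> * \<bar>Re (vcomplex x \<odot> a)\<bar>"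
      unfolding abs_mult[symmetric] by (rule abs_ge_self)
    also have "\<dots> \<le> \<bar>t\<bar> * norm (vcomplex x \<odot> a)"
      by (rule mult_left_mono[OF abs_Re_le_cmod]) simp
    also have "\<dots> \<le> T * (norm x * norm a)"
      using t norm_bprod_le[of "vcomplex x" a] by (intro mult_mono) (auto simp: norm_vcomplex)
    finally have "2 * pi * (t * Re (vcomplex x \<odot> a)) \<le> 2 * pi * (T * (norm x * norm a))"
      by (rule mult_left_mono) simp
    then have "norm (gint t x) \<le> exp (2 * pi * T * norm a * norm x - 2 * pi * (norm x)\<^sup>2)"
      by (simp add: gint_def power2_norm_eq_inner mult_ac)
    then have "(1 + norm x) ^ (N + M) * norm (gint t x) \<le> (1 + norm x) ^ (N + M) * exp (2 * pi * T * norm a * norm x - 2 * pi * (norm x)\<^sup>2)"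
      by (rule mult_left_mono) simp
    also have "\<dots> \<le> E" by (rule E(2)) simp
    finally show ?thesis
      using pos by (simp add: pos_le_divide_eq power_add mult_ac)
  qed
  then show ?thesis using E(1) by (intro exI[of _ E]) simp
qed

lemma gint_continuous: "continuous_on UNIV (gint t)"
  unfolding gint_def[abs_def] by (intro continuous_intros)

lemma gint_mult_integrable:
  assumes p: "continuous_on UNIV p" "\<And>x. norm (p x) \<le> C * (1 + norm x) ^ N"
  shows "integrable lborel (\<lambda>x. p x * gint t x)"
proof -
  obtain E where E0: "0 \<le> E" and E': "\<forall>s x. \<bar>s\<bar> \<le> \<bar>t\<bar> \<longrightarrow> (1 + norm x) ^ N * norm (gint s x) \<le> E / (1 + norm x) ^ (DIM(real ^ 'n) + 2)"
    using gint_decay[of "\<bar>t\<bar>" N "DIM(real ^ 'n) + 2"] by (elim exE conjE)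
  note E = E0 E'[rule_format, OF order.refl]
  have C: "0 \<le> C" using order.trans[OF norm_ge_zero p(2)[of 0]] by simp
  show ?thesis
  proof (rule integrable_of_decay)
    show "(\<lambda>x. p x * gint t x) \<in> borel_measurable borel"
      by (intro borel_measurable_continuous_onI continuous_intros p(1) gint_continuous)
    fix x
    have "norm (p x * gint t x) \<le> (C * (1 + norm x) ^ N) * norm (gint t x)"
      unfolding norm_mult by (rule mult_right_mono[OF p(2)]) simp
    also have "\<dots> \<le> C * (E / (1 + norm x) ^ (DIM(real ^ 'n) + 2))"
      unfolding mult.assoc by (rule mult_left_mono[OF E(2) C])
    finally show "norm (p x * gint t x) \<le> C * E / (1 + norm x) ^ (DIM(real ^ 'n) + 2)" by simp
  qed
qed

lemma gint_integrable: "integrable lborel (gint t)"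
  using gint_mult_integrable[of "\<lambda>_. 1" 1 0 t] by simp

lemma gint_coord_integrable: "integrable lborel (\<lambda>x. of_real (x $ j) * gint t x)"
proof (rule gint_mult_integrable)
  show "continuous_on UNIV (\<lambda>x. complex_of_real (x $ j))" by (intro continuous_intros)
  show "norm (complex_of_real (x $ j)) \<le> 1 * (1 + norm x) ^ 1" for x :: "real ^ 'n"
    using component_le_norm_cart[of x j] by simp
qed

lemma gint_by_parts:
  "(LINT x|lborel. of_real (x $ j) * gint t x) = of_real t * a $ j / 2 * (LINT x|lborel. gint t x)"
proof -
  define D where "D x h = (of_real (2 * pi * t) * (vcomplex h \<odot> a) - of_real (4 * pi * (x \<bullet> h))) * gint t x" for x h
  have der: "(gint t has_derivative D x) (at x)" for x
  proof -
    have "((\<lambda>x. of_real (2 * pi * t) * (vcomplex x \<odot> a) - of_real (2 * pi * (x \<bullet> x))) has_derivative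
        (\<lambda>h. of_real (2 * pi * t) * (vcomplex h \<odot> a) - of_real (4 * pi * (x \<bullet> h)))) (at x)"
      by (rule has_derivative_eq_rhs, (rule derivative_intros)+)
        (simp add: fun_eq_iff bprod.zero_right inner_commute algebra_simps)
    from has_field_derivative_compose_FDERIV[OF DERIV_exp this] show ?thesis
      by (simp add: gint_def[abs_def] D_def[abs_def])
  qed
  have Dj: "D x (axis j 1) = of_real (2 * pi * t) * a $ j * gint t x - of_real (4 * pi) * (of_real (x $ j) * gint t x)" for x
  proof -
    have "vcomplex (axis j 1 :: real ^ 'n) = axis j 1" by (simp add: vec_eq_iff axis_def)
    then show ?thesis
      by (simp add: D_def bprod_commute[of "axis j 1"] bprod_axis inner_axis algebra_simps)
  qed
  obtain E where E0: "0 \<le> E" and E': "\<forall>s x. \<bar>s\<bar> \<le> \<bar>t\<bar> \<longrightarrow> (1 + norm x) ^ 1 * norm (gint s x) \<le> E / (1 + norm x) ^ (DIM(real ^ 'n) + 2)"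
    using gint_decay[of "\<bar>t\<bar>" 1 "DIM(real ^ 'n) + 2"] by (elim exE conjE)
  note E = E0 E'[rule_format, OF order.refl]
  have "(LINT x|lborel. D x (axis j 1)) = 0"
  proof (rule integral_directional_derivative_eq_0[OF der gint_integrable])
    fix x
    let ?c = "2 * pi * \<bar>t\<bar> * norm (a $ j) + 4 * pi"
    have "norm (D x (axis j 1)) \<le> 2 * pi * \<bar>t\<bar> * norm (a $ j) * norm (gint t x) + 4 * pi * (\<bar>x $ j\<bar> * norm (gint t x))"
      unfolding Dj by (rule order.trans[OF norm_triangle_ineq4]) (simp add: norm_mult abs_mult)
    also have "\<dots> \<le> 2 * pi * \<bar>t\<bar> * norm (a $ j) * ((1 + norm x) ^ 1 * norm (gint t x)) + 4 * pi * ((1 + norm x) ^ 1 * norm (gint t x))"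
    proof (intro add_mono mult_left_mono)
      show "norm (gint t x) \<le> (1 + norm x) ^ 1 * norm (gint t x)" by (simp add: algebra_simps)
      show "\<bar>x $ j\<bar> * norm (gint t x) \<le> (1 + norm x) ^ 1 * norm (gint t x)"
        using component_le_norm_cart[of x j] by (intro mult_right_mono) auto
    qed auto
    also have "\<dots> = ?c * ((1 + norm x) ^ 1 * norm (gint t x))" by (simp only: distrib_right)
    also have "\<dots> \<le> ?c * (E / (1 + norm x) ^ (DIM(real ^ 'n) + 2))"
      by (intro mult_left_mono E(2)) auto
    finally show "norm (D x (axis j 1)) \<le> ?c * E / (1 + norm x) ^ (DIM(real ^ 'n) + 2)" by simp
  qed
  then have "of_real (2 * pi * t) * a $ j * (LINT x|lborel. gint t x) - of_real (4 * pi) * (LINT x|lborel. of_real (x $ j) * gint t x) = 0"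
    unfolding Dj using gint_integrable gint_coord_integrable by simp
  then have "of_real (4 * pi) * (LINT x|lborel. of_real (x $ j) * gint t x)
      = of_real (4 * pi) * (of_real t * a $ j / 2 * (LINT x|lborel. gint t x))"
    by simp
  then show ?thesis by (simp only: mult_cancel_left) simp
qed

text \<open>Integrating by parts gives a first-order differential equation in \<open>t\<close>.\<close>

lemma gint_integral: "(LINT x|lborel. gint 1 x) = exp (of_real pi * (a \<odot> a) / 2) * (LINT x|lborel. gint 0 x)"
proof -
  define I where "I t = (LINT x|lborel. gint t x)" for t
  have int: "integrable lborel (\<lambda>x. (vcomplex x \<odot> a) * gint t x)"
    and eq: "(LINT x|lborel. (vcomplex x \<odot> a) * gint t x) = of_real t / 2 * (a \<odot> a) * I t" for t
  proof -
    have *: "(vcomplex x \<odot> a) * gint t x = (\<Sum>j\<in>UNIV. a $ j * (of_real (x $ j) * gint t x))" for x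
      by (simp only: bprod_def sum_distrib_right) (simp add: mult_ac)
    show "integrable lborel (\<lambda>x. (vcomplex x \<odot> a) * gint t x)"
      unfolding * by (intro Bochner_Integration.integrable_sum integrable_mult_right gint_coord_integrable)
    have "(LINT x|lborel. (vcomplex x \<odot> a) * gint t x) = (\<Sum>j\<in>UNIV. a $ j * (LINT x|lborel. of_real (x $ j) * gint t x))"
      unfolding * using gint_coord_integrable by (subst Bochner_Integration.integral_sum) auto
    also have "\<dots> = of_real t / 2 * (a \<odot> a) * I t"
      unfolding gint_by_parts I_def[symmetric] by (simp add: bprod_def sum_distrib_left sum_distrib_right mult_ac)
    finally show "(LINT x|lborel. (vcomplex x \<odot> a) * gint t x) = of_real t / 2 * (a \<odot> a) * I t" .
  qed
  have I_deriv: "(I has_vector_derivative of_real pi * of_real t0 * (a \<odot> a) * I t0) (at t0)" for t0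
  proof -
    define D where "D t x h = h *\<^sub>R (of_real (2 * pi) * ((vcomplex x \<odot> a) * gint t x))" for t x h
    have der: "((\<lambda>t. gint t x) has_derivative D t x) (at t)" for t x
    proof -
      have "((\<lambda>t. of_real (2 * pi * t) * (vcomplex x \<odot> a) - of_real (2 * pi * (x \<bullet> x))) has_derivative
          (\<lambda>h. of_real (2 * pi * h) * (vcomplex x \<odot> a))) (at t)"
        by (rule has_derivative_eq_rhs, (rule derivative_intros)+) (simp add: fun_eq_iff)
      from has_field_derivative_compose_FDERIV[OF DERIV_exp this] show ?thesis
        unfolding D_def gint_def by (rule has_derivative_eq_rhs) (simp add: fun_eq_iff scaleR_conv_of_real mult_ac)
    qed
    obtain E where E0: "0 \<le> E" and E': "\<forall>t x. \<bar>t\<bar> \<le> \<bar>t0\<bar> + 1 \<longrightarrow> (1 + norm x) ^ 1 * norm (gint t x) \<le> E / (1 + norm x) ^ (DIM(real ^ 'n) + 2)"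
      using gint_decay[of "\<bar>t0\<bar> + 1" 1 "DIM(real ^ 'n) + 2"] by (elim exE conjE)
    note E = E0 E'[rule_format]
    define B where "B x = 2 * pi * norm a * E * (1 / (1 + norm x) ^ (DIM(real ^ 'n) + 2))" for x :: "real ^ 'n"
    have bound: "norm (D t x h) \<le> B x * norm h" if t: "t \<in> ball t0 1" for t x h
    proof -
      have t': "\<bar>t\<bar> \<le> \<bar>t0\<bar> + 1" using t by (simp add: dist_real_def)
      have "norm (vcomplex x \<odot> a) \<le> norm a * (1 + norm x) ^ 1"
      proof -
        have "norm (vcomplex x \<odot> a) \<le> norm x * norm a" using norm_bprod_le[of "vcomplex x" a] by (simp add: norm_vcomplex)
        also have "\<dots> \<le> norm a * (1 + norm x) ^ 1" by (simp add: algebra_simps)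
        finally show ?thesis .
      qed
      then have "norm (vcomplex x \<odot> a) * norm (gint t x) \<le> (norm a * (1 + norm x) ^ 1) * norm (gint t x)"
        by (rule mult_right_mono) simp
      also have "\<dots> \<le> norm a * (E / (1 + norm x) ^ (DIM(real ^ 'n) + 2))"
        unfolding mult.assoc by (intro mult_left_mono E(2) t') simp
      finally have "\<bar>h\<bar> * (2 * pi * (norm (vcomplex x \<odot> a) * norm (gint t x))) \<le> \<bar>h\<bar> * (2 * pi * (norm a * (E / (1 + norm x) ^ (DIM(real ^ 'n) + 2))))"
        by (intro mult_left_mono) auto
      then show ?thesis by (simp add: D_def B_def norm_mult mult_ac)
    qed
    have B: "integrable lborel B" unfolding B_def by (intro integrable_mult_right integrable_inverse_power)
    have "((\<lambda>t. LINT x|lborel. gint t x) has_derivative (\<lambda>h. LINT x|lborel. D t0 x h)) (at t0)"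
      by (rule has_derivative_lebesgue_integral(2)[where q=gint and D=D and B=B, OF der bound gint_integrable B])
    moreover have "(LINT x|lborel. D t0 x h) = h *\<^sub>R (of_real pi * of_real t0 * (a \<odot> a) * I t0)" for h
    proof -
      have "(LINT x|lborel. D t0 x h) = h *\<^sub>R (of_real (2 * pi) * (LINT x|lborel. (vcomplex x \<odot> a) * gint t0 x))"
        unfolding D_def by simp
      then show ?thesis unfolding eq by simp
    qed
    ultimately show ?thesis unfolding has_vector_derivative_def I_def by simp
  qed
  define e where "e t = exp (- of_real pi * of_real (t\<^sup>2) * (a \<odot> a) / 2)" for t :: real
  have e_deriv: "(e has_vector_derivative (- of_real pi * of_real t * (a \<odot> a)) * e t) (at t)" for t
  proof -
    have "((\<lambda>t. - of_real pi * of_real (t\<^sup>2) * (a \<odot> a) / 2) has_derivative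
        (\<lambda>h. h *\<^sub>R (- of_real pi * of_real t * (a \<odot> a)))) (at t)"
      by (rule has_derivative_eq_rhs, (rule derivative_eq_intros refl | simp)+)
        (simp add: fun_eq_iff scaleR_conv_of_real field_simps)
    from has_field_derivative_compose_FDERIV[OF DERIV_exp this] show ?thesis
      unfolding has_vector_derivative_def e_def by simp
  qed
  have "((\<lambda>t. I t * e t) has_vector_derivative 0) (at t)" for t
  proof -
    have "((\<lambda>t. I t * e t) has_vector_derivative
        I t * ((- of_real pi * of_real t * (a \<odot> a)) * e t) + (of_real pi * of_real t * (a \<odot> a) * I t) * e t) (at t)"
      by (rule has_vector_derivative_mult[OF I_deriv e_deriv])
    then show ?thesis by (simp add: algebra_simps)
  qed
  then have "\<exists>c. \<forall>t\<in>UNIV. I t * e t = c"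
    by (intro has_derivative_zero_constant) (auto simp: has_vector_derivative_def)
  then have c: "I 1 * e 1 = I 0 * e 0" by auto
  have e0: "e 0 = 1" by (simp add: e_def)
  have e1: "e 1 * exp (of_real pi * (a \<odot> a) / 2) = 1" unfolding e_def exp_add[symmetric] by simp
  have "I 1 = (I 1 * e 1) * exp (of_real pi * (a \<odot> a) / 2)" unfolding mult.assoc e1 by simp
  also have "\<dots> = exp (of_real pi * (a \<odot> a) / 2) * I 0" unfolding c e0 by simp
  finally show ?thesis by (simp only: I_def)
qed

lemma gint_zero: "(LINT x|lborel. gint 0 x) = of_real (LINT x|lborel. exp (- (2 * pi) * (norm (x :: real ^ 'n))\<^sup>2))"
proof -
  have eq: "gint 0 x = of_real (exp (- (2 * pi) * (norm x)\<^sup>2))" for x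
    by (simp add: gint_def power2_norm_eq_inner exp_of_real[symmetric])
  show "(LINT x|lborel. gint 0 x) = of_real (LINT x|lborel. exp (- (2 * pi) * (norm (x :: real ^ 'n))\<^sup>2))"
    unfolding eq by (rule integral_complex_of_real)
qed

end

lemma bkernel_mult_integral:
  fixes z w :: "complex ^ 'n::finite"
  shows "(LINT x|lborel. bkernel z x * bkernel w x) = of_real (LINT x|lborel. exp (- (2 * pi) * (norm (x :: real ^ 'n))\<^sup>2)) * exp (of_real pi * (z \<odot> w))"
proof -
  let ?c = "exp (- of_real pi * (z \<odot> z + w \<odot> w) / 2)"
  have "bkernel z x * bkernel w x = ?c * gint (z + w) 1 x" for x
    unfolding bkernel_def gint_def exp_add[symmetric]
    by (rule arg_cong[where f=exp]) (simp add: bprod.add_right field_simps)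
  then have "(LINT x|lborel. bkernel z x * bkernel w x) = ?c * (LINT x|lborel. gint (z + w) 1 x)" by simp
  also have "\<dots> = ?c * exp (of_real pi * ((z + w) \<odot> (z + w)) / 2) * (LINT x|lborel. gint (z + w) 0 x)"
    by (simp add: gint_integral)
  also have "?c * exp (of_real pi * ((z + w) \<odot> (z + w)) / 2) = exp (of_real pi * (z \<odot> w))"
    unfolding exp_add[symmetric]
    by (rule arg_cong[where f=exp]) (simp add: bprod.add_right bprod.add_left bprod_commute[of w z] field_simps)
  finally show ?thesis by (simp add: gint_zero mult.commute)
qed

section \<open>Surjectivity of the Bargmann transform\<close>

definition vRe :: "complex ^ 'n \<Rightarrow> real ^ 'n"
  where "vRe z = (\<chi> j. Re (z $ j))"

text \<open>Up to the weight, the kernel is a Gaussian centred at the real part of \<open>z\<close>.\<close>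

lemma norm_bkernel: "norm (bkernel z x) = exp (pi * (norm z)\<^sup>2 / 2) * exp (- pi * (norm (x - vRe z))\<^sup>2)"
proof -
  have 1: "Re (vcomplex x \<odot> z) = x \<bullet> vRe z"
    by (simp add: bprod_def inner_vec_def vRe_def)
  have 2: "Re (z \<odot> z) = 2 * (norm (vRe z))\<^sup>2 - (norm z)\<^sup>2"
  proof -
    have v: "(norm (vRe z))\<^sup>2 = (\<Sum>j\<in>UNIV. (Re (z $ j))\<^sup>2)"
      unfolding power2_norm_eq_inner by (simp add: inner_vec_def vRe_def power2_eq_square)
    show ?thesis
      unfolding v norm_square_vec cmod_power2 bprod_def sum_distrib_left sum_subtractf[symmetric] Re_sum
      by (rule sum.cong) (simp_all add: power2_eq_square)
  qed
  have "norm (bkernel z x) = exp (2 * pi * (x \<bullet> vRe z) - pi * (norm x)\<^sup>2 - pi * (2 * (norm (vRe z))\<^sup>2 - (norm z)\<^sup>2) / 2)"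
    unfolding 1[symmetric] 2[symmetric] by (simp add: bkernel_def power2_norm_eq_inner)
  also have "\<dots> = exp (pi * (norm z)\<^sup>2 / 2 + - pi * (norm (x - vRe z))\<^sup>2)"
    unfolding norm_diff_square by (simp add: field_simps)
  finally show ?thesis by (simp only: exp_add)
qed

lemma vRe_vcnj [simp]: "vRe (vcnj w) = vRe w"
  by (simp add: vRe_def vcnj_def)

text \<open>The complex conjugate of the Bargmann transform of the conjugate of \<open>g\<close>, up to
  normalisation. It is the function against which a distribution is paired on the Fock side.\<close>

definition atrans :: "(real ^ 'n::finite \<Rightarrow> complex) \<Rightarrow> complex ^ 'n \<Rightarrow> complex"
  where "atrans g w = (LINT x|lborel. g x * bkernel (vcnj w) x)"

lemma
  fixes g :: "real ^ 'n::finite \<Rightarrow> complex"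
  assumes g: "continuous_on UNIV g" and S: "\<And>x. norm (g x) \<le> S"
  shows atrans_integrable: "integrable lborel (\<lambda>x. g x * bkernel z x)"
    and norm_atrans_le: "norm (atrans g w) \<le> S * exp (pi * (norm w)\<^sup>2 / 2) * (LINT x|lborel. exp (- pi * (norm (x :: real ^ 'n))\<^sup>2))"
proof -
  define gs where "gs x = exp (- pi * (norm (x :: real ^ 'n))\<^sup>2)" for x
  have gs: "integrable lborel gs" unfolding gs_def[abs_def] by (rule integrable_gauss) simp
  have gs_meas: "gs \<in> borel_measurable borel" using gs by auto
  have gs_shift: "integrable lborel (\<lambda>x. gs (x - u))" "(LINT x|lborel. gs (x - u)) = (LINT x|lborel. gs x)" for u
    using integrable_translate_iff[OF gs_meas, of "- u"] integral_translate[OF gs_meas, of "- u"] gs by simp_all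
  have le: "norm (g x * bkernel z x) \<le> S * (exp (pi * (norm z)\<^sup>2 / 2) * gs (x - vRe z))" for x and z :: "complex ^ 'n"
    unfolding norm_mult norm_bkernel gs_def by (rule mult_right_mono[OF S]) simp
  have bint: "integrable lborel (\<lambda>x. S * (exp (pi * (norm z)\<^sup>2 / 2) * gs (x - vRe z)))" for z :: "complex ^ 'n"
    by (intro integrable_mult_right gs_shift)
  have int: "integrable lborel (\<lambda>x. g x * bkernel z x)" for z
  proof (rule Bochner_Integration.integrable_bound[OF bint])
    have "(\<lambda>x. g x * bkernel z x) \<in> borel_measurable borel"
      by (intro borel_measurable_continuous_onI continuous_intros g)
    then show "(\<lambda>x. g x * bkernel z x) \<in> borel_measurable lborel" by simp
    show "AE x in lborel. norm (g x * bkernel z x) \<le> norm (S * (exp (pi * (norm z)\<^sup>2 / 2) * gs (x - vRe z)))"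
      unfolding real_norm_def by (rule AE_I2) (rule order.trans[OF le abs_ge_self])
  qed
  then show "integrable lborel (\<lambda>x. g x * bkernel z x)" .
  have "norm (atrans g w) \<le> (LINT x|lborel. norm (g x * bkernel (vcnj w) x))"
    unfolding atrans_def by (rule integral_norm_bound)
  also have "\<dots> \<le> (LINT x|lborel. S * (exp (pi * (norm (vcnj w))\<^sup>2 / 2) * gs (x - vRe (vcnj w))))"
    by (rule integral_mono[OF integrable_norm[OF int] bint le])
  also have "\<dots> = S * exp (pi * (norm w)\<^sup>2 / 2) * (LINT x|lborel. gs x)"
    using gs_shift(2) by (simp add: norm_vcnj)
  finally show "norm (atrans g w) \<le> S * exp (pi * (norm w)\<^sup>2 / 2) * (LINT x|lborel. exp (- pi * (norm (x :: real ^ 'n))\<^sup>2))"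
    unfolding gs_def .
qed

lemma schwartz_differentiable: "\<phi> \<in> schwartz \<Longrightarrow> partials js \<phi> differentiable (at x)"
  by (simp add: schwartz_def)

lemma schwartz_continuous: "\<phi> \<in> schwartz \<Longrightarrow> continuous_on UNIV (partials js \<phi>)"
  by (intro continuous_at_imp_continuous_on ballI differentiable_imp_continuous_within schwartz_differentiable)

lemma partials_Nil [simp]: "partials [] \<phi> = \<phi>" and partials_Cons [simp]: "partials (j # js) \<phi> = partial j (partials js \<phi>)"
  by (simp_all add: partials_def)

lemma schwartz_seminorm_mono:
  assumes \<phi>: "\<phi> \<in> (schwartz :: (real ^ 'n::finite \<Rightarrow> complex) set)" and le: "N \<le> M"
  shows "schwartz_seminorm N \<phi> \<le> schwartz_seminorm M \<phi>"
proof -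
  let ?f = "\<lambda>N js x. (1 + norm x) ^ N * norm (partials js \<phi> x)"
  have bdd: "bdd_above (range (?f N js))" for N js
    using \<phi> unfolding schwartz_def by (auto intro: bounded_imp_bdd_above)
  have sub: "?f N js x \<le> ?f M js x" for js x
    using le by (intro mult_right_mono power_increasing) auto
  have up: "?f M js x \<le> (SUP x. ?f M js x)" for js x by (rule cSUP_upper[OF UNIV_I bdd])
  have "finite {xs :: 'n list. set xs \<subseteq> UNIV \<and> length xs \<le> M}"
    by (rule finite_lists_length_le) simp
  then have fin: "finite {js :: 'n list. length js \<le> M}" by simp
  have "schwartz_seminorm N \<phi> \<le> (\<Sum>js | length js \<le> N. SUP x. ?f M js x)"
    unfolding schwartz_seminorm_def
    by (intro sum_mono cSUP_least order.trans[OF sub up]) auto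
  also have "\<dots> \<le> schwartz_seminorm M \<phi>"
    unfolding schwartz_seminorm_def
  proof (rule sum_mono2[OF fin])
    show "0 \<le> (SUP x. ?f M js x)" for js
      by (rule order.trans[OF _ up[where js=js and x=0]]) simp
  qed (use le in auto)
  finally show ?thesis .
qed

lemma partials_add:
  assumes "\<phi> \<in> schwartz" "\<psi> \<in> schwartz"
  shows "partials js (\<lambda>x. \<phi> x + \<psi> x) = (\<lambda>x. partials js \<phi> x + partials js \<psi> x)"
proof (induction js)
  case (Cons j js)
  show ?case unfolding partials_Cons Cons
    by (intro ext partial_add schwartz_differentiable assms)
qed simp

lemma schwartz_add:
  fixes \<phi> \<psi> :: "real ^ 'n::finite \<Rightarrow> complex"
  assumes "\<phi> \<in> schwartz" "\<psi> \<in> schwartz"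
  shows "(\<lambda>x. \<phi> x + \<psi> x) \<in> schwartz"
  unfolding schwartz_def
proof (intro CollectI conjI allI)
  show "partials js (\<lambda>x. \<phi> x + \<psi> x) differentiable at x" for js x
    unfolding partials_add[OF assms] by (intro differentiable_add schwartz_differentiable assms)
  fix N and js :: "'n list"
  let ?N = "N + length js"
  have "(1 + norm x) ^ N * norm (partials js \<phi> x + partials js \<psi> x) \<le> schwartz_seminorm ?N \<phi> + schwartz_seminorm ?N \<psi>" for x
  proof -
    have "(1 + norm x) ^ N * norm (partials js \<phi> x + partials js \<psi> x) \<le> (1 + norm x) ^ ?N * (norm (partials js \<phi> x) + norm (partials js \<psi> x))"
      by (intro mult_mono power_increasing norm_triangle_ineq) auto
    also have "\<dots> \<le> schwartz_seminorm ?N \<phi> + schwartz_seminorm ?N \<psi>"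
      unfolding distrib_left by (intro add_mono schwartz_seminorm_bound assms) auto
    finally show ?thesis .
  qed
  then show "bounded (range (\<lambda>x. (1 + norm x) ^ N * norm (partials js (\<lambda>x. \<phi> x + \<psi> x) x)))"
    unfolding partials_add[OF assms] bounded_iff by (intro exI[of _ "schwartz_seminorm ?N \<phi> + schwartz_seminorm ?N \<psi>"]) auto
qed

lemma partial_cmult:
  assumes "\<phi> differentiable at x"
  shows "partial j (\<lambda>x. c * \<phi> x) x = c * partial j \<phi> x"
  using has_derivative_mult_right[OF assms[unfolded frechet_derivative_works], of c]
  by (subst partial_eqI) (auto simp: partial_def)

lemma partials_cmult:
  assumes "\<phi> \<in> schwartz"
  shows "partials js (\<lambda>x. c * \<phi> x) = (\<lambda>x. c * partials js \<phi> x)"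
proof (induction js)
  case (Cons j js)
  show ?case unfolding partials_Cons Cons
    by (intro ext partial_cmult schwartz_differentiable assms)
qed simp

lemma schwartz_cmult:
  fixes \<phi> :: "real ^ 'n::finite \<Rightarrow> complex"
  assumes "\<phi> \<in> schwartz"
  shows "(\<lambda>x. c * \<phi> x) \<in> schwartz"
  unfolding schwartz_def
proof (intro CollectI conjI allI)
  show "partials js (\<lambda>x. c * \<phi> x) differentiable at x" for js x
    unfolding partials_cmult[OF assms] by (intro differentiable_mult differentiable_const schwartz_differentiable assms)
  fix N and js :: "'n list"
  have "bounded (range (\<lambda>x. (1 + norm x) ^ N * norm (partials js \<phi> x)))"
    using assms by (simp add: schwartz_def)
  then obtain B where B: "\<And>x. \<bar>(1 + norm x) ^ N * norm (partials js \<phi> x)\<bar> \<le> B"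
    unfolding bounded_iff by auto
  have "norm ((1 + norm x) ^ N * norm (c * partials js \<phi> x)) \<le> norm c * B" for x
  proof -
    have "norm ((1 + norm x) ^ N * norm (c * partials js \<phi> x)) = norm c * \<bar>(1 + norm x) ^ N * norm (partials js \<phi> x)\<bar>"
      by (simp add: norm_mult abs_mult)
    also have "\<dots> \<le> norm c * B" by (rule mult_left_mono[OF B]) simp
    finally show ?thesis .
  qed
  then show "bounded (range (\<lambda>x. (1 + norm x) ^ N * norm (partials js (\<lambda>x. c * \<phi> x) x)))"
    unfolding partials_cmult[OF assms] bounded_iff by blast
qed

definition mpartial :: "(real ^ 'n::finite \<Rightarrow> complex) \<Rightarrow> 'n \<Rightarrow> nat \<Rightarrow> 'n list \<Rightarrow> real ^ 'n \<Rightarrow> complex"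
  where "mpartial \<phi> j b js x = of_real (x $ j) ^ b * partials js \<phi> x"

lemma mpartial_bound:
  assumes "\<phi> \<in> schwartz"
  shows "(1 + norm x) ^ M * norm (mpartial \<phi> j b js x) \<le> schwartz_seminorm (b + M + length js) \<phi>"
proof -
  have "\<bar>x $ j\<bar> ^ b \<le> (1 + norm x) ^ b"
    using component_le_norm_cart[of x j] by (intro power_mono) auto
  then have "norm (mpartial \<phi> j b js x) \<le> (1 + norm x) ^ b * norm (partials js \<phi> x)"
    unfolding mpartial_def by (simp add: norm_mult norm_power mult_right_mono)
  then have "(1 + norm x) ^ M * norm (mpartial \<phi> j b js x) \<le> (1 + norm x) ^ M * ((1 + norm x) ^ b * norm (partials js \<phi> x))"
    by (rule mult_left_mono) simp
  also have "\<dots> = (1 + norm x) ^ (b + M) * norm (partials js \<phi> x)" by (simp add: power_add mult_ac)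
  also have "\<dots> \<le> (1 + norm x) ^ (b + M + length js) * norm (partials js \<phi> x)"
    by (intro mult_right_mono power_increasing) auto
  also have "\<dots> \<le> schwartz_seminorm (b + M + length js) \<phi>"
    by (rule schwartz_seminorm_bound[OF assms]) simp
  finally show ?thesis .
qed

lemma mpartial_continuous: "\<phi> \<in> schwartz \<Longrightarrow> continuous_on UNIV (mpartial \<phi> j b js)"
  unfolding mpartial_def[abs_def] by (intro continuous_intros schwartz_continuous)

lemma mpartial_norm_le: "\<phi> \<in> schwartz \<Longrightarrow> norm (mpartial \<phi> j b js x) \<le> schwartz_seminorm (b + length js) \<phi>"
  using mpartial_bound[of \<phi> x 0 j b js] by simp

lemma mpartial_has_derivative:
  assumes "\<phi> \<in> schwartz"
  shows "\<exists>D. (mpartial \<phi> j b js has_derivative D) (at x) \<and>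
    D (axis j 1) = of_nat b * mpartial \<phi> j (b - 1) js x + mpartial \<phi> j b (j # js) x"
proof -
  have 1: "(partials js \<phi> has_derivative frechet_derivative (partials js \<phi>) (at x)) (at x)"
    using schwartz_differentiable[OF assms] by (simp add: frechet_derivative_works)
  have 2: "((\<lambda>x. complex_of_real (x $ j)) has_derivative (\<lambda>h. of_real (h $ j))) (at x)"
    by (rule derivative_intros bounded_linear.has_derivative[OF bounded_linear_vec_nth] has_derivative_ident)+
  have 3: "((\<lambda>y :: complex. y ^ b) has_field_derivative of_nat b * of_real (x $ j) ^ (b - 1)) (at (of_real (x $ j)))"
    by (rule derivative_eq_intros refl | simp)+
  note has_derivative_mult[OF has_field_derivative_compose_FDERIV[OF 3 2] 1]
  then show ?thesis
    unfolding mpartial_def[abs_def]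
    by (intro exI conjI, assumption) (simp add: partial_def algebra_simps)
qed

text \<open>Integration by parts against the kernel: multiplication by \<open>cnj (w $ j)\<close> becomes the
  creation operator, multiplication by the coordinate minus the partial derivative over \<open>2 * pi\<close>.\<close>

lemma atrans_creation:
  fixes \<phi> :: "real ^ 'n::finite \<Rightarrow> complex"
  assumes \<phi>: "\<phi> \<in> schwartz"
  shows "of_real (2 * pi) * (cnj (w $ j) * atrans (mpartial \<phi> j b js) w)
    = of_real (2 * pi) * atrans (mpartial \<phi> j (Suc b) js) w
      - (of_nat b * atrans (mpartial \<phi> j (b - 1) js) w + atrans (mpartial \<phi> j b (j # js)) w)"
proof -
  let ?M = "DIM(real ^ 'n) + 2"
  let ?bk = "bkernel (vcnj w)"
  let ?m = "mpartial \<phi> j"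
  define e where "e = exp (pi * (norm w)\<^sup>2 / 2)"
  have int: "integrable lborel (\<lambda>x. ?m b js x * ?bk x)" for b js
    by (rule atrans_integrable[OF mpartial_continuous[OF \<phi>] mpartial_norm_le[OF \<phi>]])
  have bk: "norm (?bk x) \<le> e" for x
    unfolding norm_bkernel norm_vcnj e_def using mult_left_mono[of "exp (- pi * (norm (x - vRe (vcnj w)))\<^sup>2)" 1 "exp (pi * (norm w)\<^sup>2 / 2)"] by simp
  have e0: "0 \<le> e" by (simp add: e_def)
  define E where "E x = of_nat b * (?m (b - 1) js x * ?bk x) + ?m b (j # js) x * ?bk x
      + of_real (2 * pi) * cnj (w $ j) * (?m b js x * ?bk x) - of_real (2 * pi) * (?m (Suc b) js x * ?bk x)" for x
  have ex: "\<exists>D. ((\<lambda>x. ?m b js x * ?bk x) has_derivative D) (at x) \<and> D (axis j 1) = E x" for x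
  proof -
    obtain D where D: "(?m b js has_derivative D) (at x)"
      "D (axis j 1) = of_nat b * ?m (b - 1) js x + ?m b (j # js) x"
      using mpartial_has_derivative[OF \<phi>] by blast
    have ax: "vcomplex (axis j 1 :: real ^ 'n) = axis j 1" by (simp add: vec_eq_iff axis_def)
    show ?thesis
    proof (intro exI conjI)
      show "((\<lambda>x. ?m b js x * ?bk x) has_derivative (\<lambda>h. ?m b js x * ((2 * of_real pi * (vcomplex h \<odot> vcnj w) - of_real (2 * pi * (x \<bullet> h))) * ?bk x) + D h * ?bk x)) (at x)"
        by (rule has_derivative_mult[OF D(1) has_derivative_bkernel])
      show "?m b js x * ((2 * of_real pi * (vcomplex (axis j 1) \<odot> vcnj w) - of_real (2 * pi * (x \<bullet> axis j 1))) * ?bk x) + D (axis j 1) * ?bk x = E x"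
        unfolding D(2) E_def ax by (simp add: bprod_commute[of "axis j 1"] bprod_axis inner_axis mpartial_def algebra_simps)
    qed
  qed
  define P where "P x D \<longleftrightarrow> ((\<lambda>x. ?m b js x * ?bk x) has_derivative D) (at x) \<and> D (axis j 1) = E x" for x D
  define D where "D x = (SOME D. P x D)" for x
  have "\<exists>D. P x D" for x unfolding P_def by (rule ex)
  then have "P x (D x)" for x unfolding D_def by (rule someI_ex)
  then have D: "((\<lambda>x. ?m b js x * ?bk x) has_derivative D x) (at x)" "D x (axis j 1) = E x" for x
    unfolding P_def by simp_all
  define S where "S b js = schwartz_seminorm (b + ?M + length js) \<phi>" for b and js :: "'n list"
  have dec: "norm (?m b js x * ?bk x) \<le> S b js * e / (1 + norm x) ^ ?M" for b js x
  proof -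
    have pos: "0 < (1 + norm x) ^ ?M" by (simp add: add_pos_nonneg)
    have "norm (?m b js x) \<le> S b js / (1 + norm x) ^ ?M"
      using mpartial_bound[OF \<phi>, of x ?M j b js] pos unfolding S_def by (simp only: pos_le_divide_eq mult.commute)
    then have "norm (?m b js x) * norm (?bk x) \<le> S b js / (1 + norm x) ^ ?M * e"
      by (rule mult_mono[OF _ bk]) (use schwartz_seminorm_nonneg[OF \<phi>] in \<open>auto simp: S_def\<close>)
    then show ?thesis by (simp add: norm_mult)
  qed
  have "(LINT x|lborel. D x (axis j 1)) = 0"
  proof (rule integral_directional_derivative_eq_0[OF D(1) int])
    fix x :: "real ^ 'n"
    let ?d = "(1 + norm x) ^ ?M"
    have "norm (D x (axis j 1)) \<le> real b * norm (?m (b - 1) js x * ?bk x) + norm (?m b (j # js) x * ?bk x)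
        + 2 * pi * norm (w $ j) * norm (?m b js x * ?bk x) + 2 * pi * norm (?m (Suc b) js x * ?bk x)"
    proof -
      have n4: "norm (p + q + r - s) \<le> norm p + norm q + norm r + norm s" for p q r s :: complex
        using norm_triangle_ineq4[of "p + q + r" s] norm_triangle_ineq[of "p + q" r] norm_triangle_ineq[of p q] by linarith
      show ?thesis unfolding D(2) E_def by (rule order.trans[OF n4]) (simp add: norm_mult)
    qed
    also have "\<dots> \<le> real b * (S (b - 1) js * e / ?d) + S b (j # js) * e / ?d
        + 2 * pi * norm (w $ j) * (S b js * e / ?d) + 2 * pi * (S (Suc b) js * e / ?d)"
      by (intro add_mono mult_left_mono dec) auto
    also have "\<dots> = (real b * (S (b - 1) js * e) + S b (j # js) * e + 2 * pi * norm (w $ j) * (S b js * e) + 2 * pi * (S (Suc b) js * e)) / ?d"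
      by (simp only: add_divide_distrib times_divide_eq_right)
    finally show "norm (D x (axis j 1)) \<le> (real b * (S (b - 1) js * e) + S b (j # js) * e + 2 * pi * norm (w $ j) * (S b js * e) + 2 * pi * (S (Suc b) js * e)) / ?d" .
  qed
  then have "of_nat b * atrans (?m (b - 1) js) w + atrans (?m b (j # js)) w
      + of_real (2 * pi) * cnj (w $ j) * atrans (?m b js) w - of_real (2 * pi) * atrans (?m (Suc b) js) w = 0"
    unfolding D(2) E_def atrans_def using int by simp
  then show ?thesis by (simp add: algebra_simps)
qed

text \<open>Every factor \<open>w $ j\<close> is traded for a creation operator, at the price of a stronger Schwartz
  seminorm. The statement carries coordinate powers and derivatives so that the induction closes.\<close>

lemma atrans_mpartial_decay:
  fixes j :: "'n::finite"
  shows "\<exists>C N. 0 \<le> C \<and> (\<forall>\<phi>\<in>schwartz. \<forall>w. norm (w $ j) ^ M * norm (atrans (mpartial \<phi> j b js) w)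
    \<le> C * schwartz_seminorm N \<phi> * exp (pi * (norm w)\<^sup>2 / 2))"
proof (induction M arbitrary: b js)
  case 0
  define I where "I = (LINT x|lborel. exp (- pi * (norm (x :: real ^ 'n))\<^sup>2))"
  have I: "0 \<le> I" unfolding I_def by (rule Bochner_Integration.integral_nonneg) simp
  have "norm (w $ j) ^ 0 * norm (atrans (mpartial \<phi> j b js) w) \<le> I * schwartz_seminorm (b + length js) \<phi> * exp (pi * (norm w)\<^sup>2 / 2)"
    if "\<phi> \<in> schwartz" for \<phi> and w :: "complex ^ 'n"
    using norm_atrans_le[OF mpartial_continuous[OF that] mpartial_norm_le[OF that], of j b js w] unfolding I_def by (simp add: mult_ac)
  then show ?case using I by blast
next
  case (Suc M)
  obtain C1 N1 where 1: "0 \<le> C1" "\<forall>\<phi>\<in>schwartz. \<forall>w. norm (w $ j) ^ M * norm (atrans (mpartial \<phi> j (Suc b) js) w)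
    \<le> C1 * schwartz_seminorm N1 \<phi> * exp (pi * (norm w)\<^sup>2 / 2)" using Suc.IH by blast
  obtain C2 N2 where 2: "0 \<le> C2" "\<forall>\<phi>\<in>schwartz. \<forall>w. norm (w $ j) ^ M * norm (atrans (mpartial \<phi> j (b - 1) js) w)
    \<le> C2 * schwartz_seminorm N2 \<phi> * exp (pi * (norm w)\<^sup>2 / 2)" using Suc.IH by blast
  obtain C3 N3 where 3: "0 \<le> C3" "\<forall>\<phi>\<in>schwartz. \<forall>w. norm (w $ j) ^ M * norm (atrans (mpartial \<phi> j b (j # js)) w)
    \<le> C3 * schwartz_seminorm N3 \<phi> * exp (pi * (norm w)\<^sup>2 / 2)" using Suc.IH by blast
  let ?N = "N1 + N2 + N3" and ?C = "C1 + real b * C2 + C3"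
  have "norm (w $ j) ^ Suc M * norm (atrans (mpartial \<phi> j b js) w) \<le> ?C * schwartz_seminorm ?N \<phi> * exp (pi * (norm w)\<^sup>2 / 2)"
    if \<phi>: "\<phi> \<in> schwartz" for \<phi> and w :: "complex ^ 'n"
  proof -
    let ?e = "exp (pi * (norm w)\<^sup>2 / 2)" and ?s = "schwartz_seminorm ?N \<phi>" and ?r = "norm (w $ j) ^ M"
    let ?A = "\<lambda>b js. atrans (mpartial \<phi> j b js) w"
    have mono: "C * schwartz_seminorm N \<phi> * ?e \<le> C * ?s * ?e" if "N \<le> ?N" "0 \<le> C" for C N
      by (intro mult_right_mono mult_left_mono schwartz_seminorm_mono[OF \<phi>] that) auto
    have b1: "?r * norm (?A (Suc b) js) \<le> C1 * ?s * ?e"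
      by (rule order.trans[OF 1(2)[rule_format, OF \<phi>] mono]) (use 1 in auto)
    have b2: "?r * norm (?A (b - 1) js) \<le> C2 * ?s * ?e"
      by (rule order.trans[OF 2(2)[rule_format, OF \<phi>] mono]) (use 2 in auto)
    have b3: "?r * norm (?A b (j # js)) \<le> C3 * ?s * ?e"
      by (rule order.trans[OF 3(2)[rule_format, OF \<phi>] mono]) (use 3 in auto)
    have n3: "norm (p - (q + r)) \<le> norm p + norm q + norm r" for p q r :: complex
      using norm_triangle_ineq4[of p "q + r"] norm_triangle_ineq[of q r] by linarith
    have pi1: "1 \<le> 2 * pi" using pi_gt3 by linarith
    have "2 * pi * (norm (w $ j) * norm (?A b js)) = norm (of_real (2 * pi) * (cnj (w $ j) * ?A b js))"
      by (simp add: norm_mult)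
    also have "\<dots> \<le> norm (of_real (2 * pi) * ?A (Suc b) js) + norm (of_nat b * ?A (b - 1) js) + norm (?A b (j # js))"
      unfolding atrans_creation[OF \<phi>] by (rule n3)
    also have "\<dots> = 2 * pi * norm (?A (Suc b) js) + 1 * (real b * norm (?A (b - 1) js)) + 1 * norm (?A b (j # js))"
      by (simp add: norm_mult)
    also have "\<dots> \<le> 2 * pi * norm (?A (Suc b) js) + 2 * pi * (real b * norm (?A (b - 1) js)) + 2 * pi * norm (?A b (j # js))"
      by (intro add_mono mult_right_mono pi1) auto
    also have "\<dots> = 2 * pi * (norm (?A (Suc b) js) + real b * norm (?A (b - 1) js) + norm (?A b (j # js)))"
      by (simp only: distrib_left)
    finally have "norm (w $ j) * norm (?A b js) \<le> norm (?A (Suc b) js) + real b * norm (?A (b - 1) js) + norm (?A b (j # js))"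
      by (rule mult_left_le_imp_le) simp
    then have "?r * (norm (w $ j) * norm (?A b js)) \<le> ?r * (norm (?A (Suc b) js) + real b * norm (?A (b - 1) js) + norm (?A b (j # js)))"
      by (rule mult_left_mono) simp
    also have "\<dots> = ?r * norm (?A (Suc b) js) + real b * (?r * norm (?A (b - 1) js)) + ?r * norm (?A b (j # js))"
      by (simp only: distrib_left mult.left_commute)
    also have "\<dots> \<le> C1 * ?s * ?e + real b * (C2 * ?s * ?e) + C3 * ?s * ?e"
      by (intro add_mono mult_left_mono b1 b2 b3) auto
    also have "\<dots> = ?C * ?s * ?e" by (simp add: distrib_right)
    finally show ?thesis by (simp add: mult_ac)
  qed
  moreover have "0 \<le> ?C" using 1 2 3 by simp
  ultimately show ?case by blast
qed

lemma one_plus_norm_power_le: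
  fixes w :: "complex ^ 'n::finite"
  shows "(1 + norm w) ^ M \<le> (1 + real CARD('n)) ^ M * (1 + (\<Sum>j\<in>UNIV. norm (w $ j) ^ M))"
proof -
  define m where "m = Max (range (\<lambda>j. norm (w $ j)))"
  have m: "norm (w $ j) \<le> m" for j unfolding m_def by (rule Max_ge) auto
  have "m \<in> range (\<lambda>j. norm (w $ j))" unfolding m_def by (rule Max_in) auto
  then obtain i where i: "m = norm (w $ i)" by blast
  have "norm w \<le> (\<Sum>j\<in>UNIV. norm (w $ j))"
    unfolding norm_vec_def by (rule L2_set_le_sum) simp
  also have "\<dots> \<le> real CARD('n) * m" using sum_bounded_above[of UNIV "\<lambda>j. norm (w $ j)" m] m by simp
  finally have w: "norm w \<le> real CARD('n) * m" .
  have s: "0 \<le> (\<Sum>j\<in>UNIV. norm (w $ j) ^ M)" by (rule sum_nonneg) simp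
  have "1 + norm w \<le> (1 + real CARD('n)) * max 1 m"
  proof -
    have "real CARD('n) * m \<le> real CARD('n) * max 1 m" by (intro mult_left_mono) auto
    moreover have "1 \<le> max 1 m" by simp
    ultimately have "1 + norm w \<le> max 1 m + real CARD('n) * max 1 m" using w by linarith
    then show ?thesis by (simp only: distrib_right mult_1_left)
  qed
  then have "(1 + norm w) ^ M \<le> (1 + real CARD('n)) ^ M * max 1 m ^ M"
    unfolding power_mult_distrib[symmetric] by (rule power_mono) simp
  also have "max 1 m ^ M \<le> 1 + (\<Sum>j\<in>UNIV. norm (w $ j) ^ M)"
  proof (cases "m \<le> 1")
    case True
    then show ?thesis using s by (simp add: max_def)
  next
    case False
    have "norm (w $ i) ^ M \<le> (\<Sum>j\<in>UNIV. norm (w $ j) ^ M)" by (rule member_le_sum) auto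
    then show ?thesis using False i by (simp add: max_def)
  qed
  finally show ?thesis by (simp add: mult_left_mono)
qed

lemma atrans_decay:
  "\<exists>C N. 0 \<le> C \<and> (\<forall>\<phi>\<in>(schwartz :: (real ^ 'n::finite \<Rightarrow> complex) set). \<forall>w.
    norm (atrans \<phi> w) \<le> C * schwartz_seminorm N \<phi> * exp (pi * (norm w)\<^sup>2 / 2) / (1 + norm w) ^ M)"
proof -
  have eq: "mpartial \<phi> j 0 [] = \<phi>" for \<phi> and j :: 'n by (simp add: mpartial_def fun_eq_iff)
  obtain C0 N0 where 0: "0 \<le> C0" "\<forall>\<phi>\<in>(schwartz :: (real ^ 'n \<Rightarrow> complex) set). \<forall>w. norm (atrans \<phi> w) \<le> C0 * schwartz_seminorm N0 \<phi> * exp (pi * (norm w)\<^sup>2 / 2)"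
    using atrans_mpartial_decay[of "undefined :: 'n" 0 0 "[]"] unfolding eq power_0 mult_1_left by blast
  have "\<forall>j. \<exists>C N. 0 \<le> C \<and> (\<forall>\<phi>\<in>(schwartz :: (real ^ 'n \<Rightarrow> complex) set). \<forall>w. norm (w $ j) ^ M * norm (atrans \<phi> w) \<le> C * schwartz_seminorm N \<phi> * exp (pi * (norm w)\<^sup>2 / 2))"
  proof
    fix j :: 'n
    show "\<exists>C N. 0 \<le> C \<and> (\<forall>\<phi>\<in>(schwartz :: (real ^ 'n \<Rightarrow> complex) set). \<forall>w. norm (w $ j) ^ M * norm (atrans \<phi> w) \<le> C * schwartz_seminorm N \<phi> * exp (pi * (norm w)\<^sup>2 / 2))"
      using atrans_mpartial_decay[of j M 0 "[]"] unfolding eq .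
  qed
  then obtain C N where C: "\<forall>j. 0 \<le> C j \<and> (\<forall>\<phi>\<in>(schwartz :: (real ^ 'n \<Rightarrow> complex) set). \<forall>w. norm (w $ j) ^ M * norm (atrans \<phi> w) \<le> C j * schwartz_seminorm (N j) \<phi> * exp (pi * (norm w)\<^sup>2 / 2))"
    unfolding choice_iff by blast
  let ?N = "N0 + (\<Sum>j\<in>UNIV. N j)"
  let ?K = "(1 + real CARD('n)) ^ M * (C0 + (\<Sum>j\<in>UNIV. C j))"
  have "norm (atrans \<phi> w) \<le> ?K * schwartz_seminorm ?N \<phi> * exp (pi * (norm w)\<^sup>2 / 2) / (1 + norm w) ^ M"
    if \<phi>: "\<phi> \<in> schwartz" for \<phi> and w :: "complex ^ 'n"
  proof -
    let ?e = "exp (pi * (norm w)\<^sup>2 / 2)" and ?s = "schwartz_seminorm ?N \<phi>"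
    have pos: "0 < (1 + norm w) ^ M" by (simp add: add_pos_nonneg)
    have mono: "D * schwartz_seminorm L \<phi> * ?e \<le> D * ?s * ?e" if "L \<le> ?N" "0 \<le> D" for D L
      by (intro mult_right_mono mult_left_mono schwartz_seminorm_mono[OF \<phi>] that) auto
    have b0: "norm (atrans \<phi> w) \<le> C0 * ?s * ?e"
      by (rule order.trans[OF 0(2)[rule_format, OF \<phi>] mono]) (use 0 in auto)
    have bj: "norm (w $ j) ^ M * norm (atrans \<phi> w) \<le> C j * ?s * ?e" for j
    proof (rule order.trans)
      show "norm (w $ j) ^ M * norm (atrans \<phi> w) \<le> C j * schwartz_seminorm (N j) \<phi> * ?e" using C \<phi> by blast
      show "C j * schwartz_seminorm (N j) \<phi> * ?e \<le> C j * ?s * ?e"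
      proof (rule mono)
        have "N j \<le> (\<Sum>j\<in>UNIV. N j)" by (rule member_le_sum) auto
        then show "N j \<le> ?N" by simp
        show "0 \<le> C j" using C by blast
      qed
    qed
    have "norm (atrans \<phi> w) * (1 + norm w) ^ M \<le> norm (atrans \<phi> w) * ((1 + real CARD('n)) ^ M * (1 + (\<Sum>j\<in>UNIV. norm (w $ j) ^ M)))"
      by (rule mult_left_mono[OF one_plus_norm_power_le]) simp
    also have "\<dots> = (1 + real CARD('n)) ^ M * (norm (atrans \<phi> w) + (\<Sum>j\<in>UNIV. norm (w $ j) ^ M * norm (atrans \<phi> w)))"
      by (simp add: algebra_simps sum_distrib_left)
    also have "\<dots> \<le> (1 + real CARD('n)) ^ M * (C0 * ?s * ?e + (\<Sum>j\<in>UNIV. C j * ?s * ?e))"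
      by (intro mult_left_mono add_mono b0 sum_mono bj) simp
    also have "(\<Sum>j\<in>UNIV. C j * ?s * ?e) = (\<Sum>j\<in>UNIV. C j) * ?s * ?e"
      by (simp only: sum_distrib_right)
    also have "(1 + real CARD('n)) ^ M * (C0 * ?s * ?e + (\<Sum>j\<in>UNIV. C j) * ?s * ?e) = ?K * ?s * ?e"
      by (simp only: distrib_right distrib_left mult.assoc)
    finally show ?thesis using pos by (simp add: pos_le_divide_eq)
  qed
  moreover have "0 \<le> ?K" using 0 C by (intro mult_nonneg_nonneg add_nonneg_nonneg sum_nonneg) auto
  ultimately show ?thesis by blast
qed

lemma atrans_measurable:
  assumes "continuous_on UNIV g"
  shows "atrans g \<in> borel_measurable borel"
proof -
  have cont: "continuous_on UNIV (\<lambda>p. g (snd p) * bkernel (vcnj (fst p)) (snd p))"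
    by (intro continuous_intros continuous_on_compose2[OF assms, of UNIV snd]) auto
  have "(\<lambda>p. g (snd p) * bkernel (vcnj (fst p)) (snd p)) \<in> borel_measurable (borel \<Otimes>\<^sub>M lborel)"
    using borel_measurable_continuous_onI[OF cont]
    by (simp add: measurable_cong_sets[OF sets_pair_measure_cong[OF refl sets_lborel] refl] borel_prod)
  then have "(\<lambda>(w, x). g x * bkernel (vcnj w) x) \<in> borel_measurable (borel \<Otimes>\<^sub>M lborel)"
    by (simp add: case_prod_beta')
  then show ?thesis
    unfolding atrans_def[abs_def] by (rule lborel.borel_measurable_lebesgue_integral)
qed

text \<open>The distribution is \<open>\<phi> \<mapsto> \<integral> G w * atrans \<phi> w * exp (- pi * norm w ^ 2)\<close> up to a constant. It is
  tempered since \<open>atrans \<phi>\<close> beats the weight by any power of \<open>1 + norm w\<close>. At the Bargmann kernel,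
  \<open>atrans\<close> is the reproducing kernel, so the reproducing formula returns \<open>G\<close>.\<close>

lemma bargmann_surj:
  fixes G :: "complex ^ 'n::finite \<Rightarrow> complex"
  assumes G: "gauss_bounded C G" and entire: "slice_entire G"
  obtains g where "g \<in> tempered" "bargmann g = G"
proof -
  let ?M = "DIM(complex ^ 'n) + 2"
  define \<kappa> where "\<kappa> = complex_of_real (2 powr (real CARD('n) / 4)) *
    of_real (LINT x|lborel. exp (- (2 * pi) * (norm (x :: real ^ 'n))\<^sup>2)) * gauss_mass TYPE('n)"
  have \<kappa>: "\<kappa> \<noteq> 0"
    unfolding \<kappa>_def using gauss_mass_nonzero nonzero_gauss_integral[of "2 * pi", where 'a="real ^ 'n"]
    by simp
  define g where "g \<phi> = (if \<phi> \<in> schwartz then inverse \<kappa> * (LINT w|lborel. G w * atrans \<phi> w * of_real (exp (- pi * (norm w)\<^sup>2))) else undefined)" for \<phi>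
  obtain C' N where C': "0 \<le> C'" "\<forall>\<phi>\<in>(schwartz :: (real ^ 'n \<Rightarrow> complex) set). \<forall>w.
    norm (atrans \<phi> w) \<le> C' * schwartz_seminorm N \<phi> * exp (pi * (norm w)\<^sup>2 / 2) / (1 + norm w) ^ ?M"
    using atrans_decay by blast
  have C: "0 \<le> C" by (rule gauss_bounded_nonneg[OF G])
  have cont: "continuous_on UNIV \<phi>" if "\<phi> \<in> schwartz" for \<phi> :: "real ^ 'n \<Rightarrow> complex"
    using schwartz_continuous[OF that, of "[]"] by simp
  have bdd: "norm (\<phi> x) \<le> schwartz_seminorm 0 \<phi>" if "\<phi> \<in> schwartz" for \<phi> :: "real ^ 'n \<Rightarrow> complex" and x
    using schwartz_seminorm_bound[OF that, of "[]" 0 x] by simp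
  have le: "norm (G w * atrans \<phi> w * of_real (exp (- pi * (norm w)\<^sup>2))) \<le> C * C' * schwartz_seminorm N \<phi> * (1 / (1 + norm w) ^ ?M)"
    if "\<phi> \<in> schwartz" for \<phi> w
  proof -
    have "norm (G w * atrans \<phi> w * of_real (exp (- pi * (norm w)\<^sup>2)))
        \<le> (C * exp (pi * (norm w)\<^sup>2 / 2)) * (C' * schwartz_seminorm N \<phi> * exp (pi * (norm w)\<^sup>2 / 2) / (1 + norm w) ^ ?M) * exp (- pi * (norm w)\<^sup>2)"
      unfolding norm_mult norm_of_real abs_exp_cancel
      by (intro mult_right_mono mult_mono gauss_bounded_norm_le[OF G] C'(2)[rule_format, OF that]) (use C in auto)
    also have "\<dots> = C * C' * schwartz_seminorm N \<phi> * (1 / (1 + norm w) ^ ?M) * (exp (pi * (norm w)\<^sup>2 / 2) * exp (pi * (norm w)\<^sup>2 / 2) * exp (- pi * (norm w)\<^sup>2))"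
      by simp
    also have "exp (pi * (norm w)\<^sup>2 / 2) * exp (pi * (norm w)\<^sup>2 / 2) * exp (- pi * (norm w)\<^sup>2) = 1"
      unfolding exp_add[symmetric] by simp
    finally show ?thesis by simp
  qed
  have int: "integrable lborel (\<lambda>w. G w * atrans \<phi> w * of_real (exp (- pi * (norm w)\<^sup>2)))" if \<phi>: "\<phi> \<in> schwartz" for \<phi>
  proof (rule integrable_of_decay)
    have "(\<lambda>w :: complex ^ 'n. complex_of_real (exp (- pi * (norm w)\<^sup>2))) \<in> borel_measurable borel"
      by (intro borel_measurable_continuous_onI continuous_intros)
    then show "(\<lambda>w. G w * atrans \<phi> w * of_real (exp (- pi * (norm w)\<^sup>2))) \<in> borel_measurable borel"
      by (intro borel_measurable_times gauss_bounded_measurable[OF G] atrans_measurable cont \<phi>)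
    show "norm (G w * atrans \<phi> w * of_real (exp (- pi * (norm w)\<^sup>2))) \<le> C * C' * schwartz_seminorm N \<phi> / (1 + norm w) ^ ?M" for w
      using le[OF \<phi>, of w] by simp
  qed
  have "g \<in> tempered"
    unfolding tempered_def
  proof (intro CollectI conjI ballI allI exI)
    show "g \<in> extensional schwartz" by (simp add: extensional_def g_def)
    show "g (\<lambda>t. \<phi> t + \<psi> t) = g \<phi> + g \<psi>" if \<phi>: "\<phi> \<in> schwartz" and \<psi>: "\<psi> \<in> schwartz" for \<phi> \<psi>
    proof -
      have "atrans (\<lambda>t. \<phi> t + \<psi> t) w = atrans \<phi> w + atrans \<psi> w" for w
        unfolding atrans_def distrib_right
        by (rule Bochner_Integration.integral_add[OF atrans_integrable[OF cont[OF \<phi>] bdd[OF \<phi>]] atrans_integrable[OF cont[OF \<psi>] bdd[OF \<psi>]]])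
      then have "(LINT w|lborel. G w * atrans (\<lambda>t. \<phi> t + \<psi> t) w * of_real (exp (- pi * (norm w)\<^sup>2)))
          = (LINT w|lborel. G w * atrans \<phi> w * of_real (exp (- pi * (norm w)\<^sup>2)) + G w * atrans \<psi> w * of_real (exp (- pi * (norm w)\<^sup>2)))"
        by (simp only: distrib_left distrib_right)
      also have "\<dots> = (LINT w|lborel. G w * atrans \<phi> w * of_real (exp (- pi * (norm w)\<^sup>2))) + (LINT w|lborel. G w * atrans \<psi> w * of_real (exp (- pi * (norm w)\<^sup>2)))"
        by (rule Bochner_Integration.integral_add[OF int[OF \<phi>] int[OF \<psi>]])
      finally show ?thesis using \<phi> \<psi> schwartz_add[OF \<phi> \<psi>] by (simp only: g_def if_True distrib_left)
    qed
    show "g (\<lambda>t. c * \<phi> t) = c * g \<phi>" if \<phi>: "\<phi> \<in> schwartz" for c \<phi>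
    proof -
      have "atrans (\<lambda>t. c * \<phi> t) w = c * atrans \<phi> w" for w
        unfolding atrans_def mult.assoc by (rule integral_mult_right_zero)
      then have "(LINT w|lborel. G w * atrans (\<lambda>t. c * \<phi> t) w * of_real (exp (- pi * (norm w)\<^sup>2)))
          = (LINT w|lborel. c * (G w * atrans \<phi> w * of_real (exp (- pi * (norm w)\<^sup>2))))"
        by (simp only: mult_ac)
      also have "\<dots> = c * (LINT w|lborel. G w * atrans \<phi> w * of_real (exp (- pi * (norm w)\<^sup>2)))"
        by (rule integral_mult_right_zero)
      finally show ?thesis using \<phi> schwartz_cmult[OF \<phi>] by (simp only: g_def if_True mult.left_commute)
    qed
    show "norm (g \<phi>) \<le> (norm (inverse \<kappa>) * (C * C' * (LINT w|lborel. 1 / (1 + norm (w :: complex ^ 'n)) ^ ?M))) * schwartz_seminorm N \<phi>"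
      if \<phi>: "\<phi> \<in> schwartz" for \<phi>
    proof -
      have "norm (LINT w|lborel. G w * atrans \<phi> w * of_real (exp (- pi * (norm w)\<^sup>2)))
          \<le> (LINT w|lborel. norm (G w * atrans \<phi> w * of_real (exp (- pi * (norm w)\<^sup>2))))"
        by (rule integral_norm_bound)
      also have "\<dots> \<le> (LINT w|lborel. C * C' * schwartz_seminorm N \<phi> * (1 / (1 + norm (w :: complex ^ 'n)) ^ ?M))"
        by (rule integral_mono[OF integrable_norm[OF int[OF \<phi>]] integrable_mult_right[OF integrable_inverse_power] le[OF \<phi>]])
      also have "\<dots> = C * C' * schwartz_seminorm N \<phi> * (LINT w|lborel. 1 / (1 + norm (w :: complex ^ 'n)) ^ ?M)"
        by (rule integral_mult_right_zero)
      finally have "norm (inverse \<kappa>) * norm (LINT w|lborel. G w * atrans \<phi> w * of_real (exp (- pi * (norm w)\<^sup>2)))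
          \<le> norm (inverse \<kappa>) * (C * C' * schwartz_seminorm N \<phi> * (LINT w|lborel. 1 / (1 + norm (w :: complex ^ 'n)) ^ ?M))"
        by (rule mult_left_mono) simp
      then show ?thesis using \<phi> by (simp only: g_def if_True norm_mult mult_ac)
    qed
  qed
  moreover have "bargmann g z = G z" for z
  proof -
    define c1 where "c1 = complex_of_real (LINT x|lborel. exp (- (2 * pi) * (norm (x :: real ^ 'n))\<^sup>2))"
    have K: "bkernel z \<in> schwartz" using bkernel_schwartz[of 1 z] by simp
    have at: "atrans (bkernel z) w = c1 * exp (of_real pi * (z \<odot> vcnj w))" for w
      unfolding atrans_def c1_def by (rule bkernel_mult_integral)
    have "(LINT w|lborel. G w * atrans (bkernel z) w * of_real (exp (- pi * (norm w)\<^sup>2))) = c1 * kconv (\<lambda>_. 1) G z"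
      unfolding at kconv_eq rkernel_def integral_mult_right_zero[symmetric] by (simp only: mult_ac mult_1_left)
    also have "\<dots> = c1 * (gauss_mass TYPE('n) * G z)"
      by (simp only: reproducing_formula[OF G entire])
    finally have "bargmann g z = of_real (2 powr (real CARD('n) / 4)) * (inverse \<kappa> * (c1 * (gauss_mass TYPE('n) * G z)))"
      using K by (simp only: bargmann_eq g_def if_True)
    also have "\<dots> = inverse \<kappa> * \<kappa> * G z"
      unfolding \<kappa>_def c1_def by (simp only: mult_ac)
    finally show ?thesis using \<kappa> by simp
  qed
  ultimately show thesis using that[of g] by (simp add: fun_eq_iff)
qed

section \<open>Modulation spaces and Fock spaces as spaces of entire functions\<close>

text \<open>The identification of phase space with \<open>complex ^ 'n\<close> by \<open>x - \<i> * \<omega>\<close>; the sign matches the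
  convention for the short-time Fourier transform.\<close>

definition tfmap :: "(real ^ 'n) \<times> (real ^ 'n) \<Rightarrow> complex ^ 'n"
  where "tfmap p = (\<chi> j. Complex (fst p $ j) (- (snd p $ j)))"

definition tfmap_inv :: "complex ^ 'n \<Rightarrow> (real ^ 'n) \<times> (real ^ 'n)"
  where "tfmap_inv z = (vRe z, \<chi> j. - Im (z $ j))"

lemma tfmap_inv: "tfmap (tfmap_inv z) = z"
  by (simp add: tfmap_def tfmap_inv_def vRe_def vec_eq_iff)

lemma norm_tfmap_square: "(norm (tfmap (x, \<omega>) :: complex ^ 'n::finite))\<^sup>2 = x \<bullet> x + \<omega> \<bullet> \<omega>"
  unfolding norm_square_vec cmod_power2
  by (simp add: tfmap_def inner_vec_def sum.distrib power2_eq_square)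

lemma distr_tfmap: "distr lborel borel (tfmap :: (real ^ 'n::finite) \<times> (real ^ 'n) \<Rightarrow> _) = lborel"
proof (rule distr_lborel_isometry)
  show "linear (tfmap :: (real ^ 'n) \<times> (real ^ 'n) \<Rightarrow> _)"
    by (rule linearI) (simp_all add: tfmap_def vec_eq_iff complex_eq_iff)
  show "surj (tfmap :: (real ^ 'n) \<times> (real ^ 'n) \<Rightarrow> _)"
    by (rule surjI[of _ tfmap_inv]) (rule tfmap_inv)
  fix p :: "(real ^ 'n) \<times> (real ^ 'n)"
  obtain x \<omega> where p: "p = (x, \<omega>)" by (rule prod.exhaust)
  have "(norm (tfmap p))\<^sup>2 = (norm p)\<^sup>2"
    unfolding p norm_tfmap_square by (simp add: power2_norm_eq_inner)
  then show "norm (tfmap p) = norm p" by simp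
qed

lemma tfmap_measurable: "(tfmap :: (real ^ 'n::finite) \<times> (real ^ 'n) \<Rightarrow> _) \<in> borel_measurable borel"
proof (rule borel_measurable_continuous_onI)
  have "continuous_on UNIV (\<lambda>p :: (real ^ 'n) \<times> (real ^ 'n). \<chi> j. complex_of_real (fst p $ j) - \<i> * complex_of_real (snd p $ j))"
    by (intro continuous_intros)
  moreover have "(tfmap :: (real ^ 'n) \<times> (real ^ 'n) \<Rightarrow> _) = (\<lambda>p :: (real ^ 'n) \<times> (real ^ 'n). \<chi> j. complex_of_real (fst p $ j) - \<i> * complex_of_real (snd p $ j))"
    by (simp add: tfmap_def fun_eq_iff vec_eq_iff complex_eq_iff)
  ultimately show "continuous_on UNIV (tfmap :: (real ^ 'n) \<times> (real ^ 'n) \<Rightarrow> _)" by (simp only:)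
qed

lemma tfmap_inv_measurable: "(tfmap_inv :: complex ^ 'n::finite \<Rightarrow> _) \<in> borel_measurable borel"
  unfolding tfmap_inv_def[abs_def] vRe_def
  by (intro borel_measurable_continuous_onI continuous_intros)

lemma Lp_norm_distr:
  fixes T :: "'a::euclidean_space \<Rightarrow> 'b::euclidean_space"
  assumes T: "T \<in> borel_measurable borel" and distr: "distr lborel borel T = lborel"
    and f: "f \<in> borel_measurable borel"
  shows "Lp_norm p lborel (\<lambda>x. f (T x)) = Lp_norm p lborel f"
proof -
  have fT: "(\<lambda>x. f (T x)) \<in> borel_measurable borel"
    using measurable_compose[OF T f] .
  have nn: "(\<integral>\<^sup>+x. g (T x) \<partial>lborel) = (\<integral>\<^sup>+x. g x \<partial>lborel)" if "g \<in> borel_measurable borel" for g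
  proof -
    have "(\<integral>\<^sup>+x. g x \<partial>distr lborel borel T) = (\<integral>\<^sup>+x. g (T x) \<partial>lborel)"
      by (rule nn_integral_distr) (use T that in simp_all)
    then show ?thesis by (simp add: distr)
  qed
  have "esssup lborel (\<lambda>x. ennreal (norm (f (T x)))) = esssup lborel (\<lambda>x. ennreal (norm (f x)))"
  proof -
    have "(AE x in lborel. ennreal (norm (f (T x))) \<le> c) \<longleftrightarrow> (AE x in lborel. ennreal (norm (f x)) \<le> c)" for c
    proof -
      have "{x \<in> space borel. ennreal (norm (f x)) \<le> c} \<in> sets borel" using f by measurable
      then have "(AE x in distr lborel borel T. ennreal (norm (f x)) \<le> c) \<longleftrightarrow> (AE x in lborel. ennreal (norm (f (T x))) \<le> c)"
        using T by (intro AE_distr_iff) simp_all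
      then show ?thesis unfolding distr by (rule sym)
    qed
    moreover have "(\<lambda>x. ennreal (norm (f (T x)))) \<in> borel_measurable lborel" "(\<lambda>x. ennreal (norm (f x))) \<in> borel_measurable lborel"
      using f fT by simp_all
    ultimately show ?thesis by (simp add: esssup_eq_AE)
  qed
  moreover have "(\<integral>\<^sup>+x. ennreal (norm (f (T x)) powr r) \<partial>lborel) = (\<integral>\<^sup>+x. ennreal (norm (f x) powr r) \<partial>lborel)" for r
    by (rule nn[of "\<lambda>y. ennreal (norm (f y) powr r)"]) (use f in measurable)
  ultimately show ?thesis by (simp add: Lp_norm_def)
qed

text \<open>The conjugated time-frequency shift of the Gaussian is a weighted Bargmann kernel up to a
  phase factor.\<close>

lemma stft_eq_bargmann:
  fixes f :: "(real ^ 'n::finite \<Rightarrow> complex) \<Rightarrow> complex"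
  assumes f: "f \<in> tempered"
  shows "stft f (x, \<omega>) = exp (- of_real pi * \<i> * of_real (x \<bullet> \<omega>)) * weighted (bargmann f) (tfmap (x, \<omega>))"
proof -
  let ?z = "tfmap (x, \<omega>)"
  let ?g = "complex_of_real (2 powr (real CARD('n) / 4))"
  let ?c = "exp (- of_real pi * \<i> * of_real (x \<bullet> \<omega>)) * of_real (exp (- pi * (norm ?z)\<^sup>2 / 2))"
  have tz: "vcomplex t \<odot> ?z = of_real (t \<bullet> x) - \<i> * of_real (t \<bullet> \<omega>)" for t :: "real ^ 'n"
    by (simp add: bprod_def tfmap_def inner_vec_def complex_eq_iff sum_negf)
  have zz: "?z \<odot> ?z = of_real (x \<bullet> x - \<omega> \<bullet> \<omega>) - 2 * \<i> * of_real (x \<bullet> \<omega>)"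
    by (simp add: bprod_def tfmap_def inner_vec_def complex_eq_iff sum_subtractf sum_negf sum_distrib_left mult_ac)
  have "cnj (tf_shift x \<omega> gauss0 t) = ?g * ?c * bkernel ?z t" for t
  proof -
    have c: "?c = exp (- of_real pi * \<i> * of_real (x \<bullet> \<omega>) - of_real pi * of_real (x \<bullet> x + \<omega> \<bullet> \<omega>) / 2)"
      unfolding norm_tfmap_square exp_of_real[symmetric] exp_add[symmetric]
      by (rule arg_cong[where f=exp]) (simp add: field_simps)
    have "cnj (tf_shift x \<omega> gauss0 t) = ?g * (exp (- (2 * of_real pi * \<i> * of_real (\<omega> \<bullet> t))) * exp (of_real (- pi * ((t - x) \<bullet> (t - x)))))"
      by (simp add: tf_shift_def gauss0_def exp_cnj exp_of_real[symmetric] mult_ac)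
    also have "\<dots> = ?g * (?c * bkernel ?z t)"
      unfolding c bkernel_def tz zz exp_add[symmetric]
      by (rule arg_cong[where f="\<lambda>y. ?g * exp y"])
        (simp add: inner_diff_left inner_diff_right inner_commute field_simps)
    finally show ?thesis by (simp only: mult.assoc)
  qed
  then have "stft f (x, \<omega>) = f (\<lambda>t. ?g * ?c * bkernel ?z t)" by (simp add: stft_def)
  also have "\<dots> = ?g * ?c * f (bkernel ?z)"
    using tempered_mult[OF f, of "bkernel ?z"] bkernel_schwartz[of 1 ?z] by simp
  finally show ?thesis by (simp add: bargmann_eq weighted_def mult_ac)
qed

lemma modulation_iff_bargmann:
  fixes f :: "(real ^ 'n::finite \<Rightarrow> complex) \<Rightarrow> complex"
  shows "f \<in> modulation p \<longleftrightarrow> f \<in> tempered \<and> weighted (bargmann f) \<in> Lp p lborel"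
proof (cases "f \<in> tempered")
  case f: True
  define e where "e q = exp (- of_real pi * \<i> * of_real (fst q \<bullet> snd q))" for q :: "(real ^ 'n) \<times> (real ^ 'n)"
  have e_meas: "e \<in> borel_measurable borel" "(\<lambda>q. inverse (e q)) \<in> borel_measurable borel"
    unfolding e_def[abs_def] by (intro borel_measurable_continuous_onI continuous_intros; simp)+
  have e_norm: "norm (e q) = 1" for q by (simp add: e_def norm_exp_eq_Re)
  have stft: "stft f q = e q * weighted (bargmann f) (tfmap q)" for q
    using stft_eq_bargmann[OF f, of "fst q" "snd q"] by (simp add: e_def)
  have "stft f \<in> borel_measurable borel \<longleftrightarrow> weighted (bargmann f) \<in> borel_measurable borel"
  proof
    assume m: "stft f \<in> borel_measurable borel"
    have "weighted (bargmann f) = (\<lambda>z. inverse (e (tfmap_inv z)) * stft f (tfmap_inv z))"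
    proof
      fix z
      have "e (tfmap_inv z) \<noteq> 0" by (simp add: e_def)
      then show "weighted (bargmann f) z = inverse (e (tfmap_inv z)) * stft f (tfmap_inv z)"
        unfolding stft tfmap_inv by simp
    qed
    moreover have "(\<lambda>z. inverse (e (tfmap_inv z)) * stft f (tfmap_inv z)) \<in> borel_measurable borel"
      by (intro borel_measurable_times measurable_compose[OF tfmap_inv_measurable] e_meas(2) m)
    ultimately show "weighted (bargmann f) \<in> borel_measurable borel" by simp
  next
    assume m: "weighted (bargmann f) \<in> borel_measurable borel"
    have "stft f = (\<lambda>q. e q * weighted (bargmann f) (tfmap q))" by (rule ext) (rule stft)
    then show "stft f \<in> borel_measurable borel"
      using borel_measurable_times[OF e_meas(1) measurable_compose[OF tfmap_measurable m]] by simp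
  qed
  moreover have "Lp_norm p lborel (stft f) = Lp_norm p lborel (weighted (bargmann f))"
    if m: "weighted (bargmann f) \<in> borel_measurable borel"
  proof -
    have "Lp_norm p lborel (stft f) = Lp_norm p lborel (\<lambda>q. weighted (bargmann f) (tfmap q))"
      by (rule Lp_norm_cong_norm) (simp add: stft norm_mult e_norm)
    also have "\<dots> = Lp_norm p lborel (weighted (bargmann f))"
      by (rule Lp_norm_distr[OF tfmap_measurable distr_tfmap m])
    finally show ?thesis .
  qed
  ultimately show ?thesis using f by (auto simp: modulation_def Lp_def)
qed (simp add: modulation_def)

lemma foldr_funpow: "foldr (\<lambda>j. f j ^^ n j) js x = foldr f (concat (map (\<lambda>j. replicate (n j) j) js)) x"
proof (induction js)
  case (Cons j js)
  have "foldr f (replicate m j) y = (f j ^^ m) y" for m y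
    by (induction m) simp_all
  then show ?case using Cons by simp
qed simp

lemma kconv_cmult: "kconv (\<lambda>v. c * P v) F = (\<lambda>z. c * kconv P F z)"
proof
  fix z
  have "kconv (\<lambda>v. c * P v) F z = (LINT w|lborel. c * (F w * P (w - z) * rkernel z w))"
    unfolding kconv_eq by (simp only: mult_ac)
  then show "kconv (\<lambda>v. c * P v) F z = c * kconv P F z"
    unfolding kconv_eq integral_mult_right_zero .
qed

lemma kconv_cmult_right: "kconv P (\<lambda>w. c * F w) = (\<lambda>z. c * kconv P F z)"
proof
  fix z
  have "kconv P (\<lambda>w. c * F w) z = (LINT w|lborel. c * (F w * P (w - z) * rkernel z w))"
    unfolding kconv_eq by (simp only: mult_ac)
  then show "kconv P (\<lambda>w. c * F w) z = c * kconv P F z"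
    unfolding kconv_eq integral_mult_right_zero .
qed

lemma poly_growth_cmult:
  assumes "poly_growth P"
  shows "poly_growth (\<lambda>v. c * P v)"
proof -
  obtain D N where D: "0 \<le> D" "\<And>w. norm (P w) \<le> D * (1 + norm w) ^ N"
    using assms unfolding poly_growth_def by blast
  have "norm (c * P w) \<le> (norm c * D) * (1 + norm w) ^ N" for w
    unfolding norm_mult mult.assoc by (rule mult_left_mono[OF D(2)]) simp
  moreover have "0 \<le> norm c * D" using D by simp
  moreover have "continuous_on UNIV (\<lambda>v. c * P v)"
    using assms unfolding poly_growth_def by (intro continuous_intros) simp
  ultimately show ?thesis unfolding poly_growth_def by blast
qed

lemma gauss_bounded_cmult:
  assumes "gauss_bounded C F"
  shows "gauss_bounded (norm c * C) (\<lambda>w. c * F w)"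
  unfolding gauss_bounded_def
proof (intro conjI allI)
  show "(\<lambda>w. c * F w) \<in> borel_measurable borel"
    using gauss_bounded_measurable[OF assms] by measurable
  fix z
  have "norm (weighted (\<lambda>w. c * F w) z) = norm c * norm (weighted F z)"
    by (simp add: norm_weighted norm_mult)
  also have "\<dots> \<le> norm c * C"
    using assms by (intro mult_left_mono) (auto simp: gauss_bounded_def)
  finally show "norm (weighted (\<lambda>w. c * F w) z) \<le> norm c * C" .
qed

lemma slice_entire_cmult: "slice_entire F \<Longrightarrow> slice_entire (\<lambda>w. c * F w)"
  unfolding slice_entire_def by (intro allI holomorphic_intros) blast

text \<open>The polyanalytic Fock spaces are the images of the spaces of entire functions under one
  operator \<open>kconv P\<close> that has a left inverse of the same type. This reduces the theorem to
  operators with dominated kernels.\<close>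

lemma fock_characterization:
  fixes k :: "nat ^ 'n::finite"
  obtains P Q :: "complex ^ 'n \<Rightarrow> complex" where "poly_growth P" "poly_growth Q"
    "\<And>p. 1 \<le> p \<Longrightarrow> fock p k = kconv P ` {F. slice_entire F \<and> weighted F \<in> Lp p lborel}"
    "\<And>C F. gauss_bounded C F \<Longrightarrow> slice_entire F \<Longrightarrow> kconv Q (kconv P F) = F"
proof -
  define js where "js = concat (map (\<lambda>j. replicate (k $ j) j) (coords :: 'n list))"
  define g0 where "g0 = gauss_mass TYPE('n)"
  define a where "a = complex_of_real (1 / sqrt ((\<Prod>j\<in>UNIV. fact (k $ j)) * pi ^ (\<Sum>j\<in>UNIV. k $ j))) * of_real pi ^ length js * inverse g0"
  have g0: "g0 \<noteq> 0" unfolding g0_def by (rule gauss_mass_nonzero)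
  have a: "a \<noteq> 0"
  proof -
    have "(\<Prod>j\<in>UNIV. fact (k $ j)) * pi ^ (\<Sum>j\<in>UNIV. k $ j) > 0"
      by (intro mult_pos_pos prod_pos zero_less_power) auto
    then show ?thesis using g0 unfolding a_def by (auto simp del: of_real_power)
  qed
  obtain b where b: "b \<noteq> 0" "\<forall>C (G :: complex ^ 'n \<Rightarrow> complex) z. gauss_bounded C G \<longrightarrow> slice_entire G \<longrightarrow>
    kconv (mon js) (kconv (cmon js) G) z = b * G z" using kconv_mon_cmon by blast
  define P where "P v = a * cmon js v" for v
  define Q where "Q v = inverse (a * b) * mon js v" for v
  have P: "poly_growth P" unfolding P_def[abs_def] by (rule poly_growth_cmult[OF poly_growth_cmon])
  have Q: "poly_growth Q" unfolding Q_def[abs_def] by (rule poly_growth_cmult[OF poly_growth_mon])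
  have inv: "kconv Q (kconv P F) = F" if F: "gauss_bounded C F" "slice_entire F" for C F
    unfolding P_def[abs_def] Q_def[abs_def] kconv_cmult kconv_cmult_right b(2)[rule_format, OF F] using a b(1) by (simp add: field_simps)
  have pb: "poly_bargmann k f = kconv P (bargmann f)" if f: "f \<in> tempered" and B: "gauss_bounded C (bargmann f)" for f C
  proof
    fix z
    define F where "F w = inverse g0 * bargmann f w" for w
    have entire: "slice_entire (bargmann f)" by (rule slice_entire_bargmann[OF f])
    have F: "gauss_bounded (norm (inverse g0) * C) F" unfolding F_def[abs_def] by (rule gauss_bounded_cmult[OF B])
    have "wtrans [] F u = of_real (exp (- pi * (norm u)\<^sup>2)) * bargmann f u" for u
    proof -
      have "cmon [] = (\<lambda>_ :: complex ^ 'n. 1)" by (simp add: fun_eq_iff)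
      then have "kconv (cmon []) F u = inverse g0 * (g0 * bargmann f u)"
        unfolding F_def[abs_def] kconv_cmult_right using reproducing_formula[OF B entire] by (simp add: g0_def)
      then show ?thesis using g0 by (simp add: wtrans_def)
    qed
    then have w: "wtrans [] F = (\<lambda>u. of_real (exp (- pi * (norm u)\<^sup>2)) * bargmann f u)" by (rule ext)
    have "wirtinger_multi k (\<lambda>u. of_real (exp (- pi * (norm u)\<^sup>2)) * bargmann f u) z = of_real pi ^ length js * wtrans js F z"
      unfolding wirtinger_multi_def foldr_funpow js_def[symmetric] w[symmetric] iterated_wirtinger_wtrans[OF F] ..
    moreover have "wtrans js F z = of_real (exp (- pi * (norm z)\<^sup>2)) * (inverse g0 * kconv (cmon js) (bargmann f) z)"
      unfolding wtrans_def F_def[abs_def] kconv_cmult_right ..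
    moreover have "complex_of_real (exp (pi * (norm z)\<^sup>2)) * of_real (exp (- pi * (norm z)\<^sup>2)) = 1"
      unfolding of_real_mult[symmetric] exp_add[symmetric] by simp
    ultimately have "poly_bargmann k f z = a * kconv (cmon js) (bargmann f) z"
      unfolding poly_bargmann_def a_def by (simp add: mult_ac)
    then show "poly_bargmann k f z = kconv P (bargmann f) z"
      unfolding P_def[abs_def] kconv_cmult .
  qed
  have fock: "fock p k = kconv P ` {F. slice_entire F \<and> weighted F \<in> Lp p lborel}" if p: "1 \<le> p" for p
  proof (intro equalityI subsetI)
    fix E assume "E \<in> fock p k"
    then obtain f where E: "E = poly_bargmann k f" and f: "f \<in> modulation p" unfolding fock_def by blast
    then have f': "f \<in> tempered" "weighted (bargmann f) \<in> Lp p lborel" by (simp_all add: modulation_iff_bargmann)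
    have entire: "slice_entire (bargmann f)" by (rule slice_entire_bargmann[OF f'(1)])
    obtain C where "gauss_bounded C (bargmann f)"
      using slice_entire_Lp_imp_gauss_bounded[OF entire f'(2) p] by blast
    then have "E = kconv P (bargmann f)" unfolding E by (rule pb[OF f'(1)])
    then show "E \<in> kconv P ` {F. slice_entire F \<and> weighted F \<in> Lp p lborel}"
      using entire f'(2) by blast
  next
    fix E assume "E \<in> kconv P ` {F. slice_entire F \<and> weighted F \<in> Lp p lborel}"
    then obtain F where E: "E = kconv P F" and F: "slice_entire F" "weighted F \<in> Lp p lborel" by blast
    obtain C where C: "gauss_bounded C F"
      using slice_entire_Lp_imp_gauss_bounded[OF F p] by blast
    obtain f where f: "f \<in> tempered" "bargmann f = F" using bargmann_surj[OF C F(1)] by blast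
    have "f \<in> modulation p" using f F(2) by (simp add: modulation_iff_bargmann)
    moreover have "poly_bargmann k f = E" unfolding E f(2)[symmetric] by (rule pb[OF f(1), of C]) (simp add: f(2) C)
    ultimately show "E \<in> fock p k" unfolding fock_def by blast
  qed
  show thesis
  proof (rule that[OF P Q])
    show "fock p k = kconv P ` {F. slice_entire F \<and> weighted F \<in> Lp p lborel}" if "1 \<le> p" for p
      using that by (rule fock)
    show "kconv Q (kconv P F) = F" if "gauss_bounded C F" "slice_entire F" for C F
      using that by (rule inv)
  qed
qed

section \<open>The integral operator\<close>

definition S_kernel :: "((complex ^ 'n::finite) \<times> (complex ^ 'n) \<Rightarrow> complex) \<Rightarrow> complex ^ 'n \<Rightarrow> complex ^ 'n \<Rightarrow> complex"
  where "S_kernel \<psi> z w = exp (of_real pi * (z \<odot> vcnj w)) * \<psi> (z - w, z - vcnj w) * of_real (exp (- pi * (norm w)\<^sup>2))"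

lemma S_integrand_eq: "S_integrand \<psi> E z = (\<lambda>w. E w * S_kernel \<psi> z w)"
  by (simp add: S_integrand_def[abs_def] S_kernel_def mult.assoc)

lemma S_op_eq: "S_op \<psi> = kernel_op (S_kernel \<psi>)"
  by (simp add: S_op_def[abs_def] kernel_op_def[abs_def] S_integrand_eq)

text \<open>The factor \<open>exp (pi * z \<odot> vcnj w)\<close> of the kernel cancels against the one in the bound for \<open>\<psi>\<close>.\<close>

lemma norm_S_kernel_le:
  assumes H: "\<And>z w. norm (\<psi> (w - z, w - vcnj z)) \<le>
      norm (exp (of_real (pi * ((norm z)\<^sup>2 + (norm w)\<^sup>2) / 2) - of_real pi * (w \<odot> vcnj z))) * H (z - w)"
  shows "norm (S_kernel \<psi> z w) \<le> exp (pi * (norm z)\<^sup>2 / 2) * (exp (- pi * (norm w)\<^sup>2 / 2) * H (w - z))"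
proof -
  let ?a = "exp (pi * (z \<bullet> w))" and ?g = "exp (- pi * (norm w)\<^sup>2)"
  let ?b = "exp (pi * ((norm w)\<^sup>2 + (norm z)\<^sup>2) / 2 - pi * (z \<bullet> w))"
  have "norm (\<psi> (z - w, z - vcnj w)) \<le> ?b * H (w - z)"
    using H[where z=w and w=z] by (simp add: Re_bprod_vcnj)
  then have "?a * norm (\<psi> (z - w, z - vcnj w)) * ?g \<le> ?a * (?b * H (w - z)) * ?g"
    by (intro mult_right_mono mult_left_mono) auto
  also have "\<dots> = (?a * ?b * ?g) * H (w - z)"
    by (simp only: mult_ac)
  also have "?a * ?b * ?g = exp (pi * (norm z)\<^sup>2 / 2) * exp (- pi * (norm w)\<^sup>2 / 2)"
    unfolding exp_add[symmetric] by (rule arg_cong[where f=exp]) (simp add: field_simps)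
  finally show ?thesis
    by (simp add: S_kernel_def norm_mult Re_bprod_vcnj mult_ac)
qed

lemma S_kernel_measurable:
  assumes \<psi>: "\<psi> \<in> borel_measurable borel"
  shows "(\<lambda>p. S_kernel \<psi> (fst p) (snd p)) \<in> borel_measurable borel"
proof -
  have "continuous_on UNIV (\<lambda>p. (fst p - snd p, fst p - vcnj (snd p)))"
    by (intro continuous_intros)
  then have 1: "(\<lambda>p. \<psi> (fst p - snd p, fst p - vcnj (snd p))) \<in> borel_measurable borel"
    by (intro measurable_compose[OF borel_measurable_continuous_onI \<psi>])
  show ?thesis
    unfolding S_kernel_def
    by (intro borel_measurable_times 1 borel_measurable_continuous_onI[of "\<lambda>p. exp (of_real pi * (fst p \<odot> vcnj (snd p)))"]
        borel_measurable_continuous_onI[of "\<lambda>p. complex_of_real (exp (- pi * (norm (snd p))\<^sup>2))"] continuous_intros)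
qed

text \<open>The bound for \<open>\<psi>\<close> holds everywhere with a Lebesgue measurable function. A Borel function
  that agrees with it almost everywhere dominates the kernel for almost every \<open>w\<close>, for every
  fixed \<open>z\<close>, because null sets are translation invariant.\<close>

lemma borel_representative:
  fixes H :: "'a::euclidean_space \<Rightarrow> real"
  assumes H: "integrable lebesgue H" and nonneg: "\<And>x. 0 \<le> H x"
  obtains h where "h \<in> borel_measurable borel" "integrable lborel h" "\<And>x. 0 \<le> h x"
    "\<And>z. AE w in lborel. H (w - z) = h (w - z)"
proof -
  obtain g where g: "g \<in> borel_measurable lborel" "AE x in lborel. H x = g x"
    using completion_ex_borel_measurable_real[OF borel_measurable_integrable[OF H]] by blast
  define h where "h x = max 0 (g x)" for x
  have h: "h \<in> borel_measurable borel" using g(1) unfolding h_def[abs_def] by simp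
  have ae: "AE x in lborel. H x = h x"
    using g(2)
  proof eventually_elim
    case (elim x)
    then show ?case using nonneg[of x] by (simp add: h_def)
  qed
  have "integrable lebesgue h"
  proof (rule integrable_cong_AE[THEN iffD1, OF _ _ _ H])
    show "H \<in> borel_measurable lebesgue" using H by auto
    show "h \<in> borel_measurable lebesgue" using h by (simp add: measurable_completion)
    show "AE x in lebesgue. H x = h x" using ae by (rule AE_completion)
  qed
  then have "integrable lborel h" using h by (simp add: integrable_completion)
  moreover have "AE w in lborel. H (w - z) = h (w - z)" for z
  proof -
    obtain N where N: "{x \<in> space lborel. \<not> H x = h x} \<subseteq> N" "N \<in> null_sets lborel"
      using ae by (auto elim!: AE_E simp: null_sets_def)
    have "AE x in distr lborel borel (\<lambda>w. w + - z). x \<notin> N"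
      unfolding distr_lborel_translate by (rule AE_not_in[OF N(2)])
    then have "AE w in lborel. w + - z \<notin> N"
      using N(2) by (subst (asm) AE_distr_iff) (auto simp: null_sets_def)
    then show ?thesis by eventually_elim (use N(1) in auto)
  qed
  ultimately show thesis using that[of h] h by (simp add: h_def)
qed

text \<open>Dilations approximate a weighted-bounded entire function by weighted-integrable ones.\<close>

lemma dilation_approximation:
  fixes F :: "complex ^ 'n::finite \<Rightarrow> complex"
  assumes F: "gauss_bounded C F" and entire: "slice_entire F"
  obtains G where "\<And>n. gauss_bounded C (G n)" "\<And>n. slice_entire (G n)"
    "\<And>n. weighted (G n) \<in> Lp 1 lborel" "\<And>z. (\<lambda>n :: nat. G n z) \<longlonglongrightarrow> F z"
proof -
  define r where "r n = real n / real (Suc n)" for n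
  have r: "0 \<le> r n" "r n < 1" for n by (auto simp: r_def)
  define G where "G n z = F (of_real (r n) *s z)" for n z
  have C: "0 \<le> C" by (rule gauss_bounded_nonneg[OF F])
  have meas: "G n \<in> borel_measurable borel" for n
  proof -
    have "(\<lambda>z :: complex ^ 'n. complex_of_real (r n) *s z) \<in> borel_measurable borel"
      by (intro borel_measurable_continuous_onI continuous_intros)
    from measurable_compose[OF this gauss_bounded_measurable[OF F]] show ?thesis
      unfolding G_def[abs_def] .
  qed
  have le: "norm (weighted (G n) z) \<le> C * exp (- (pi / 2 * (1 - (r n)\<^sup>2)) * (norm z)\<^sup>2)" for n z
  proof -
    have "norm (weighted (G n) z) \<le> (C * exp (pi * (norm (complex_of_real (r n) *s z))\<^sup>2 / 2)) * exp (- pi * (norm z)\<^sup>2 / 2)"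
      unfolding norm_weighted G_def by (rule mult_right_mono[OF gauss_bounded_norm_le[OF F]]) simp
    also have "(norm (complex_of_real (r n) *s z))\<^sup>2 = (r n)\<^sup>2 * (norm z)\<^sup>2"
      by (simp add: norm_smult_vec power_mult_distrib)
    also have "(C * exp (pi * ((r n)\<^sup>2 * (norm z)\<^sup>2) / 2)) * exp (- pi * (norm z)\<^sup>2 / 2)
        = C * exp (- (pi / 2 * (1 - (r n)\<^sup>2)) * (norm z)\<^sup>2)"
      unfolding mult.assoc exp_add[symmetric] by (simp add: field_simps)
    finally show ?thesis .
  qed
  have r2: "0 < pi / 2 * (1 - (r n)\<^sup>2)" for n
    using r[of n] by (simp add: power_less_one_iff)
  show thesis
  proof (rule that)
    fix n
    show "gauss_bounded C (G n)"
      unfolding gauss_bounded_def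
    proof (intro conjI allI meas)
      fix z :: "complex ^ 'n"
      have "C * exp (- (pi / 2 * (1 - (r n)\<^sup>2)) * (norm z)\<^sup>2) \<le> C * 1"
        using r2[of n] C by (intro mult_left_mono) (auto simp del: mult_minus_left simp: mult_nonneg_nonneg)
      then show "norm (weighted (G n) z) \<le> C" using le[of n z] by simp
    qed
    show "slice_entire (G n)"
      unfolding slice_entire_def
    proof (intro allI)
      fix z v
      have "(\<lambda>\<zeta>. F (of_real (r n) *s z + \<zeta> *s (of_real (r n) *s v))) holomorphic_on UNIV"
        using entire unfolding slice_entire_def by blast
      moreover have "of_real (r n) *s z + \<zeta> *s (of_real (r n) *s v) = of_real (r n) *s (z + \<zeta> *s v)" for \<zeta> :: complex
        by (simp add: vec_eq_iff algebra_simps)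
      ultimately show "(\<lambda>\<zeta>. G n (z + \<zeta> *s v)) holomorphic_on UNIV" by (simp only: G_def)
    qed
    show "weighted (G n) \<in> Lp 1 lborel"
    proof -
      have int: "integrable lborel (\<lambda>z :: complex ^ 'n. C * exp (- (pi / 2 * (1 - (r n)\<^sup>2)) * (norm z)\<^sup>2))"
        by (intro integrable_mult_right integrable_gauss r2)
      have "integrable lborel (weighted (G n))"
      proof (rule Bochner_Integration.integrable_bound[OF int])
        show "weighted (G n) \<in> borel_measurable lborel" using weighted_measurable[OF meas[of n]] by simp
        show "AE z in lborel. norm (weighted (G n) z) \<le> norm (C * exp (- (pi / 2 * (1 - (r n)\<^sup>2)) * (norm z)\<^sup>2))"
          unfolding real_norm_def by (rule AE_I2) (rule order.trans[OF le abs_ge_self])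
      qed
      then have "(\<integral>\<^sup>+z. ennreal (norm (weighted (G n) z)) \<partial>lborel) < \<infinity>"
        by (simp add: integrable_iff_bounded)
      then have "Lp_norm 1 lborel (weighted (G n)) < \<infinity>"
        by (subst Lp_norm_finite_iff) (simp_all add: powr_one_gt_zero_iff)
      then show ?thesis using weighted_measurable[OF meas[of n]] by (simp add: Lp_def)
    qed
  next
    fix z
    have "(\<lambda>\<zeta>. F (0 + \<zeta> *s z)) holomorphic_on UNIV" using entire unfolding slice_entire_def by blast
    then have "isCont (\<lambda>\<zeta>. F (0 + \<zeta> *s z)) 1"
      by (meson UNIV_I continuous_on_eq_continuous_at holomorphic_on_imp_continuous_on open_UNIV)
    moreover have "(\<lambda>n. complex_of_real (r n)) \<longlonglongrightarrow> 1"
    proof -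
      have "r \<longlonglongrightarrow> 1" unfolding r_def[abs_def] by (rule LIMSEQ_n_over_Suc_n)
      then show ?thesis using tendsto_of_real by fastforce
    qed
    ultimately have "(\<lambda>n. F (0 + complex_of_real (r n) *s z)) \<longlonglongrightarrow> F (0 + 1 *s z)"
      by (rule isCont_tendsto_compose)
    then show "(\<lambda>n. G n z) \<longlonglongrightarrow> F z" by (simp add: G_def)
  qed
qed

theorem theorem4p3:
  fixes k :: "nat ^ 'n::finite"
    and \<psi> :: "(complex ^ 'n) \<times> (complex ^ 'n) \<Rightarrow> complex"
  assumes "\<psi> \<in> borel_measurable borel"
    and "S_maps \<psi> (fock 1 k) (fock \<infinity> k)"
    and "\<exists>H :: complex ^ 'n \<Rightarrow> real. integrable lebesgue H \<and>
      (\<forall>z w. norm (\<psi> (w - z, w - vcnj z)) \<le>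
        norm (exp (of_real (pi * ((norm z)\<^sup>2 + (norm w)\<^sup>2) / 2) - of_real pi * (w \<odot> vcnj z))) * H (z - w))"
  shows "\<forall>p::ennreal. 1 \<le> p \<longrightarrow> S_bounded \<psi> p k"
proof (intro allI impI)
  fix p :: ennreal assume p: "1 \<le> p"
  obtain H :: "complex ^ 'n \<Rightarrow> real" where H: "integrable lebesgue H"
    and \<psi>H: "\<And>z w. norm (\<psi> (w - z, w - vcnj z)) \<le>
        norm (exp (of_real (pi * ((norm z)\<^sup>2 + (norm w)\<^sup>2) / 2) - of_real pi * (w \<odot> vcnj z))) * H (z - w)"
    using assms(3) by blast
  have H0: "0 \<le> H v" for v
  proof -
    have "0 \<le> norm (exp (of_real (pi * ((norm v)\<^sup>2 + (norm (0 :: complex ^ 'n))\<^sup>2) / 2) - of_real pi * (0 \<odot> vcnj v))) * H v"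
      using order.trans[OF norm_ge_zero \<psi>H[of 0 v]] by simp
    then show ?thesis by (simp add: zero_le_mult_iff)
  qed
  obtain h where h: "h \<in> borel_measurable borel" "integrable lborel h" "\<And>x. 0 \<le> h x"
    "\<And>z. AE w in lborel. H (w - z) = h (w - z)"
    using borel_representative[OF H H0] by blast
  interpret dominated_kernel "S_kernel \<psi>" h
  proof
    show "AE w in lborel. norm (S_kernel \<psi> z w) \<le> exp (pi * (norm z)\<^sup>2 / 2) * (exp (- pi * (norm w)\<^sup>2 / 2) * h (w - z))" for z
      using h(4)[of z]
    proof eventually_elim
      case (elim w)
      show ?case using norm_S_kernel_le[OF \<psi>H, where z=z and w=w] unfolding elim .
    qed
  qed (use S_kernel_measurable[OF assms(1)] h in simp_all)
  obtain P Q :: "complex ^ 'n \<Rightarrow> complex" where P: "poly_growth P" and Q: "poly_growth Q"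
    and fock: "\<And>p. 1 \<le> p \<Longrightarrow> fock p k = kconv P ` {F. slice_entire F \<and> weighted F \<in> Lp p lborel}"
    and inv: "\<And>C F. gauss_bounded C F \<Longrightarrow> slice_entire F \<Longrightarrow> kconv Q (kconv P F) = F"
    using fock_characterization[of k] by blast
  have main: "\<exists>C. gauss_bounded C E \<and> S_op \<psi> E \<in> fock p k" if E: "E \<in> fock p k" for E
  proof -
    obtain F where EF: "E = kconv P F" and F: "slice_entire F" and F_Lp: "weighted F \<in> Lp p lborel"
      using E unfolding fock[OF p] by blast
    obtain C where C: "gauss_bounded C F"
      using slice_entire_Lp_imp_gauss_bounded[OF F F_Lp p] by blast
    define C1 where "C1 = C * kmass (gkernel P)"
    have E_bdd: "gauss_bounded C1 E"
      unfolding EF C1_def by (rule kconv_gauss_bounded[OF P C])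
    have E_Lp: "weighted E \<in> Lp p lborel"
      unfolding EF by (rule kconv_Lp[OF P C p F_Lp])
    obtain F' where F': "\<And>n. gauss_bounded C (F' n)" "\<And>n. slice_entire (F' n)"
      "\<And>n. weighted (F' n) \<in> Lp 1 lborel" "\<And>z. (\<lambda>n. F' n z) \<longlonglongrightarrow> F z"
      using dilation_approximation[OF C F] by blast
    define E' where "E' n = kconv P (F' n)" for n
    have E'_bdd: "gauss_bounded C1 (E' n)" for n
      unfolding E'_def C1_def by (rule kconv_gauss_bounded[OF P F'(1)])
    have E'_lim: "(\<lambda>n. E' n z) \<longlonglongrightarrow> E z" for z
      unfolding E'_def EF by (rule kconv_tendsto[OF P F'(1) F'(4)])
    have SE_lim: "(\<lambda>n. S_op \<psi> (E' n) z) \<longlonglongrightarrow> S_op \<psi> E z" for z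
      unfolding S_op_eq by (rule kernel_op_tendsto[OF E'_bdd E'_lim])
    \<comment> \<open>The only use of the mapping property that is assumed for \<open>p = 1\<close>.\<close>
    have "\<exists>G. slice_entire G \<and> weighted G \<in> Lp \<infinity> lborel \<and> S_op \<psi> (E' n) = kconv P G" for n
    proof -
      have "E' n \<in> fock 1 k" unfolding fock[OF order.refl] E'_def using F'(2,3) by blast
      then have "S_op \<psi> (E' n) \<in> fock \<infinity> k" using assms(2) unfolding S_maps_def by blast
      moreover have "(1 :: ennreal) \<le> \<infinity>" by simp
      ultimately show ?thesis using fock[of \<infinity>] by blast
    qed
    then obtain G' where G': "\<forall>n. slice_entire (G' n) \<and> weighted (G' n) \<in> Lp \<infinity> lborel \<and> S_op \<psi> (E' n) = kconv P (G' n)"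
      by (rule choice[OF allI, THEN exE])
    have SE'_bdd: "gauss_bounded (C1 * kmass h) (S_op \<psi> (E' n))" for n
      unfolding S_op_eq by (rule kernel_op_gauss_bounded[OF E'_bdd])
    have SE_bdd: "gauss_bounded (C1 * kmass h) (S_op \<psi> E)"
      unfolding S_op_eq by (rule kernel_op_gauss_bounded[OF E_bdd])
    have G'_eq: "G' n = kconv Q (S_op \<psi> (E' n))" for n
    proof -
      obtain B where "gauss_bounded B (G' n)"
        using slice_entire_Lp_imp_gauss_bounded[of "G' n" \<infinity>] G' by auto
      then show ?thesis using inv G' by metis
    qed
    \<comment> \<open>The candidate for the entire function behind \<open>S_op \<psi> E\<close>: it is defined by an integral, and
      it is the limit of the entire functions \<open>G' n\<close>.\<close>
    define G where "G = kconv Q (S_op \<psi> E)"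
    define C2 where "C2 = C1 * kmass h * kmass (gkernel Q)"
    have G'_bdd: "gauss_bounded C2 (G' n)" for n
      unfolding G'_eq C2_def by (rule kconv_gauss_bounded[OF Q SE'_bdd])
    have G_bdd: "gauss_bounded C2 G"
      unfolding G_def C2_def by (rule kconv_gauss_bounded[OF Q SE_bdd])
    have G_lim: "(\<lambda>n. G' n z) \<longlonglongrightarrow> G z" for z
      unfolding G'_eq G_def by (rule kconv_tendsto[OF Q SE'_bdd SE_lim])
    \<comment> \<open>The reproducing formula passes to the limit, so \<open>G\<close> is entire.\<close>
    have "kconv (\<lambda>_. 1) G z = gauss_mass TYPE('n) * G z" for z
    proof (rule LIMSEQ_unique)
      show "(\<lambda>n. kconv (\<lambda>_. 1) (G' n) z) \<longlonglongrightarrow> kconv (\<lambda>_. 1) G z"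
        by (rule kconv_tendsto[OF poly_growth_1 G'_bdd G_lim])
      have "kconv (\<lambda>_. 1) (G' n) z = gauss_mass TYPE('n) * G' n z" for n
        using reproducing_formula[OF G'_bdd] G' by blast
      then show "(\<lambda>n. kconv (\<lambda>_. 1) (G' n) z) \<longlonglongrightarrow> gauss_mass TYPE('n) * G z"
        using tendsto_mult[OF tendsto_const G_lim] by simp
    qed
    then have G_eq: "G = (\<lambda>z. inverse (gauss_mass TYPE('n)) * kconv (\<lambda>_. 1) G z)"
      using gauss_mass_nonzero[where 'n='n] by (simp add: fun_eq_iff)
    have "slice_entire (\<lambda>z. inverse (gauss_mass TYPE('n)) * kconv (\<lambda>_. 1) G z)"
      by (rule slice_entire_cmult[OF slice_entire_kconv[OF G_bdd]])
    then have "slice_entire G"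
      by (rule ssubst[OF G_eq, where P=slice_entire])
    moreover have "weighted G \<in> Lp p lborel"
    proof -
      have "weighted (S_op \<psi> E) \<in> Lp p lborel"
        unfolding S_op_eq by (rule kernel_op_Lp[OF E_bdd p E_Lp])
      then show ?thesis
        unfolding G_def by (rule kconv_Lp[OF Q SE_bdd p])
    qed
    moreover have "S_op \<psi> E = kconv P G"
    proof
      fix z
      have "(\<lambda>n. S_op \<psi> (E' n) z) \<longlonglongrightarrow> kconv P G z"
        using kconv_tendsto[OF P G'_bdd G_lim] G' by simp
      then show "S_op \<psi> E z = kconv P G z" by (rule LIMSEQ_unique[OF SE_lim])
    qed
    ultimately have "S_op \<psi> E \<in> fock p k" unfolding fock[OF p] by blast
    then show ?thesis using E_bdd by blast
  qed
  show "S_bounded \<psi> p k"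
    unfolding S_bounded_def S_maps_def
  proof (intro conjI ballI allI exI)
    fix E assume "E \<in> fock p k"
    then obtain C where E: "gauss_bounded C E" and SE: "S_op \<psi> E \<in> fock p k" using main by blast
    show "integrable lborel (S_integrand \<psi> E z)" for z
      unfolding S_integrand_eq by (rule integrand_integrable[OF E])
    show "S_op \<psi> E \<in> fock p k" by (rule SE)
    show "fock_norm p (S_op \<psi> E) \<le> ennreal (kmass h) * fock_norm p E"
      unfolding fock_norm_eq S_op_eq by (rule kernel_op_norm_le[OF E p])
  qed
qed

end
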